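(* Let $f$ be the monodromy of an orientable, atoroidal once-punctured torus bundle $M$ over $S^1$. If $f\in\mathcal{C}$, then $M$ has Property VH.
   Context: A compact 3-manifold is Haken if it is irreducible and contains an orientable essential surface; it is virtually Haken if it is finitely covered by a Haken manifold. A knot manifold is an irreducible, orientable, compact 3-manifold whose boundary is a single torus. A slope on a torus is a non-trivial isotopy class of (unoriented) simple closed curves; $M(\alpha)$ is the Dehn filling of $M$ along the slope $\alpha$ on $\partial M$. A knot manifold $M$ has Property VH if $M(\alpha)$ is virtually Haken for all but finitely many slopes $\alpha$ on $\partial M$. $I(\cdot,\cdot)$ is the intersection pairing on $H_1(\partial M)$. Let $F$ be a torus with an open disk removed, and let $x,y$ be the standard free generators of $\pi_1F$, represented up to free homotopy by simple closed curves in the interior of $F$ meeting transversely in exactly one point. $D_x,D_y$ are Dehn twists (of the same handedness) along these curves. $\mathcal{M}_1^1$ is the group of orientation-preserving automorphisms of $F$ restricting to the identity on $\partial F$, modulo isotopies fixing $\partial F$ pointwise, and $\phi:\mathcal{M}_1^1\to SL_2(\mathbb{Z})$, $\phi(f)=f_*$, is the action on $H_1(F)\cong\mathbb{Z}^2$. Set $H_i=\phi^{-1}\langle D_{x*},D_{y*}^i\rangle$ for $i=3,4$. The once-punctured torus bundle with monodromy $f$ is $M=M_f=F\times[0,1]/(z,0)\sim(f(z),1)$. For $f\in H_i$ with $M_f$ atoroidal, $\beta_i^1=\beta_i^1(f)$ and $\beta_i^2=\beta_i^2(f)$ denote slopes on $\partial M_f$ with the following property: there is an integer $N$ such that $M_f(\alpha)$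 is virtually Haken whenever $|I(\alpha,\beta_i^1)|>N$ and $|I(\alpha,\beta_i^2)|>1$. (Such slopes exist for every such $f$.) $\mathcal{C}$ is the set of mapping classes $f$ of $F$ such that $f\in H_3\cap H_4$ and, for such slopes, $\{\beta_3^1,\beta_3^2\}\cap\{\beta_4^1,\beta_4^2\}=\emptyset$. *)

theory Defs
  imports "HOL-Homology.Homology" "HOL-Algebra.Bij" "HOL-Algebra.Generated_Groups"
begin

section \<open>Quotients and disjoint unions of topological spaces\<close>

text \<open>The quotient topology along \<open>q\<close>; the points of the quotient are the values of \<open>q\<close>, so
  \<open>q\<close> plays the role of a choice of one representative in each equivalence class.\<close>

definition quotient_along :: "'a topology \<Rightarrow> ('a \<Rightarrow> 'b) \<Rightarrow> 'b topology" where
  "quotient_along X q =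
     topology (\<lambda>U. U \<subseteq> q ` topspace X \<and> openin X {x \<in> topspace X. q x \<in> U})"

lemma openin_quotient_along:
  "openin (quotient_along X q) U \<longleftrightarrow>
     U \<subseteq> q ` topspace X \<and> openin X {x \<in> topspace X. q x \<in> U}"
proof -
  have "istopology (\<lambda>U. U \<subseteq> q ` topspace X \<and> openin X {x \<in> topspace X. q x \<in> U})"
    unfolding istopology_def
  proof (intro conjI allI impI)
    fix S T
    assume S: "S \<subseteq> q ` topspace X \<and> openin X {x \<in> topspace X. q x \<in> S}"
      and T: "T \<subseteq> q ` topspace X \<and> openin X {x \<in> topspace X. q x \<in> T}"
    have "{x \<in> topspace X. q x \<in> S \<inter> T} =
          {x \<in> topspace X. q x \<in> S} \<inter> {x \<in> topspace X. q x \<in> T}" by auto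
    then show "openin X {x \<in> topspace X. q x \<in> S \<inter> T}" using S T by auto
    show "S \<inter> T \<subseteq> q ` topspace X" using S by auto
  next
    fix \<K>
    assume K: "\<forall>K\<in>\<K>. K \<subseteq> q ` topspace X \<and> openin X {x \<in> topspace X. q x \<in> K}"
    have "{x \<in> topspace X. q x \<in> \<Union>\<K>} = (\<Union>K\<in>\<K>. {x \<in> topspace X. q x \<in> K})" by auto
    moreover have "openin X (\<Union>K\<in>\<K>. {x \<in> topspace X. q x \<in> K})" using K by blast
    ultimately show "openin X {x \<in> topspace X. q x \<in> \<Union>\<K>}" by simp
    show "\<Union>\<K> \<subseteq> q ` topspace X" using K by auto
  qed
  then show ?thesis by (simp add: quotient_along_def topology_inverse')
qed

lemma topspace_quotient_along: "topspace (quotient_along X q) = q ` topspace X"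
proof
  show "topspace (quotient_along X q) \<subseteq> q ` topspace X"
    using openin_topspace openin_quotient_along by metis
  have "{x \<in> topspace X. q x \<in> q ` topspace X} = topspace X" by auto
  then have "openin (quotient_along X q) (q ` topspace X)" by (simp add: openin_quotient_along)
  then show "q ` topspace X \<subseteq> topspace (quotient_along X q)" by (rule openin_subset)
qed

lemma quotient_map_quotient_along: "quotient_map X (quotient_along X q) q"
  unfolding quotient_map_def by (auto simp: topspace_quotient_along openin_quotient_along)

definition disjoint_union :: "'a topology \<Rightarrow> 'b topology \<Rightarrow> ('a + 'b) topology" where
  "disjoint_union X Y = topology (\<lambda>U. openin X (Inl -` U) \<and> openin Y (Inr -` U))"

lemma openin_disjoint_union:
  "openin (disjoint_union X Y) U \<longleftrightarrow> openin X (Inl -` U) \<and> openin Y (Inr -` U)"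
proof -
  have "istopology (\<lambda>U. openin X (Inl -` U) \<and> openin Y (Inr -` U))"
    by (auto simp: istopology_def vimage_Union)
  then show ?thesis by (simp add: disjoint_union_def topology_inverse')
qed


section \<open>Topological manifolds with boundary\<close>

definition half_space :: "nat \<Rightarrow> (nat \<Rightarrow> real) topology" where
  "half_space n = subtopology (Euclidean_space n) {x. x 0 \<ge> 0}"

text \<open>Second countability is not required because the notion is only used for compact spaces,
  where it is automatic.\<close>

definition manifold :: "nat \<Rightarrow> 'a topology \<Rightarrow> bool" where
  "manifold n X \<longleftrightarrow> Hausdorff_space X \<and>
     (\<forall>x\<in>topspace X. \<exists>U V. openin X U \<and> x \<in> U \<and> openin (half_space n) V \<and>
        subtopology X U homeomorphic_space subtopology (half_space n) V)"

definition compact_3_manifold :: "'a topology \<Rightarrow> bool" where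
  "compact_3_manifold X \<longleftrightarrow>
     topspace X \<noteq> {} \<and> manifold 3 X \<and> compact_space X \<and> connected_space X"

definition manifold_interior :: "nat \<Rightarrow> 'a topology \<Rightarrow> 'a set" where
  "manifold_interior n X =
     {x. \<exists>U. openin X U \<and> x \<in> U \<and> subtopology X U homeomorphic_space Euclidean_space n}"

definition manifold_boundary :: "nat \<Rightarrow> 'a topology \<Rightarrow> 'a set" where
  "manifold_boundary n X = topspace X - manifold_interior n X"

abbreviation boundary_space :: "'a topology \<Rightarrow> 'a topology" where
  "boundary_space M \<equiv> subtopology M (manifold_boundary 3 M)"

text \<open>An orientation is a locally consistent choice of generators of the local homology groups
  \<open>H\<^sub>n(X, X - {x})\<close> at the interior points \<open>x\<close>.\<close>

definition orientation :: "nat \<Rightarrow> 'a topology \<Rightarrow> ('a \<Rightarrow> 'a chain set) \<Rightarrow> bool" where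
  "orientation n X \<mu> \<longleftrightarrow>
     (\<forall>x\<in>manifold_interior n X.
        (let G = relative_homology_group (int n) X (topspace X - {x})
         in \<mu> x \<in> carrier G \<and> generate G {\<mu> x} = carrier G) \<and>
        (\<exists>U c. openin X U \<and> x \<in> U \<and> U \<subseteq> manifold_interior n X \<and>
           c \<in> carrier (relative_homology_group (int n) X (topspace X - U)) \<and>
           (\<forall>y\<in>U. hom_induced (int n) X (topspace X - U) X (topspace X - {y}) id c = \<mu> y)))"

definition orientable :: "nat \<Rightarrow> 'a topology \<Rightarrow> bool" where
  "orientable n X \<longleftrightarrow> (\<exists>\<mu>. orientation n X \<mu>)"

definition orientation_preserving :: "nat \<Rightarrow> 'a topology \<Rightarrow> ('a \<Rightarrow> 'a) \<Rightarrow> bool" where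
  "orientation_preserving n X f \<longleftrightarrow>
     (\<exists>\<mu>. orientation n X \<mu> \<and>
        (\<forall>x\<in>manifold_interior n X.
           hom_induced (int n) X (topspace X - {x}) X (topspace X - {f x}) f (\<mu> x) = \<mu> (f x)))"


section \<open>Essential surfaces, Haken and virtually Haken manifolds\<close>

abbreviation "interval_space \<equiv> top_of_set {0..1::real}"
abbreviation "circle \<equiv> top_of_set (sphere (0::complex) 1)"
abbreviation "disc \<equiv> top_of_set (cball (0::complex) 1)"
abbreviation "ball3 \<equiv> top_of_set (cball (0::real^3) 1)"
abbreviation "sphere2 \<equiv> top_of_set (sphere (0::real^3) 1)"
abbreviation "torus \<equiv> prod_topology circle circle"

text \<open>A connected, compact, properly embedded, locally flat surface. The local model
  \<open>(V, V \<inter> {y. y 2 = 0})\<close> with \<open>V\<close> open in the half space \<open>y 0 \<ge> 0\<close> forces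
  \<open>\<partial>S = S \<inter> \<partial>M\<close>. Local flatness is the topological counterpart of working with
  smooth or piecewise linear surfaces.\<close>

definition proper_surface :: "'a topology \<Rightarrow> 'a set \<Rightarrow> bool" where
  "proper_surface M S \<longleftrightarrow>
     S \<noteq> {} \<and> compactin M S \<and> connectedin M S \<and>
     (\<forall>x\<in>S. \<exists>U V \<phi>. openin M U \<and> x \<in> U \<and> openin (half_space 3) V \<and>
        homeomorphic_map (subtopology M U) (subtopology (half_space 3) V) \<phi> \<and>
        \<phi> ` (U \<inter> S) = V \<inter> {y. y 2 = 0})"

definition irreducible_manifold :: "'a topology \<Rightarrow> bool" where
  "irreducible_manifold M \<longleftrightarrow>
     (\<forall>S. proper_surface M S \<and> subtopology M S homeomorphic_space sphere2 \<longrightarrow>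
        (\<exists>e. embedding_map ball3 M e \<and> e ` sphere 0 1 = S))"

definition incompressible :: "'a topology \<Rightarrow> 'a set \<Rightarrow> bool" where
  "incompressible M S \<longleftrightarrow>
     (\<forall>e. embedding_map disc M e \<and> e ` cball 0 1 \<inter> S = e ` sphere 0 1 \<longrightarrow>
        (\<exists>d. embedding_map disc (subtopology M S) d \<and> d ` sphere 0 1 = e ` sphere 0 1))"

text \<open>Every disc whose boundary is the union of an arc in \<open>S\<close> and an arc in \<open>\<partial>M\<close>, and which
  meets \<open>S\<close> and \<open>\<partial>M\<close> in nothing else, cuts off a disc from \<open>S\<close>.\<close>

definition boundary_incompressible :: "'a topology \<Rightarrow> 'a set \<Rightarrow> bool" where
  "boundary_incompressible M S \<longleftrightarrow>
     (let upper = {z \<in> sphere (0::complex) 1. Im z \<ge> 0};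
          lower = {z \<in> sphere (0::complex) 1. Im z \<le> 0}
      in \<forall>e. embedding_map disc M e \<and> e ` cball 0 1 \<inter> S = e ` upper \<and>
           e ` cball 0 1 \<inter> manifold_boundary 3 M = e ` lower \<longrightarrow>
           (\<exists>d. embedding_map disc (subtopology M S) d \<and> d ` upper = e ` upper \<and>
              d ` lower \<subseteq> manifold_boundary 3 M))"

definition boundary_parallel :: "'a topology \<Rightarrow> 'a set \<Rightarrow> bool" where
  "boundary_parallel M S \<longleftrightarrow>
     (\<exists>P. embedding_map (prod_topology (subtopology M S) interval_space) M P \<and>
        (\<forall>s\<in>S. P (s, 0) = s \<and> P (s, 1) \<in> manifold_boundary 3 M) \<and>
        (\<forall>s\<in>S \<inter> manifold_boundary 3 M. \<forall>t\<in>{0..1}. P (s, t) \<in> manifold_boundary 3 M))"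

definition essential_surface :: "'a topology \<Rightarrow> 'a set \<Rightarrow> bool" where
  "essential_surface M S \<longleftrightarrow>
     proper_surface M S \<and> \<not> subtopology M S homeomorphic_space sphere2 \<and>
     incompressible M S \<and> boundary_incompressible M S \<and> \<not> boundary_parallel M S"

definition haken :: "'a topology \<Rightarrow> bool" where
  "haken M \<longleftrightarrow> compact_3_manifold M \<and> irreducible_manifold M \<and>
     (\<exists>S. essential_surface M S \<and> orientable 2 (subtopology M S))"

definition finite_covering :: "'b topology \<Rightarrow> 'a topology \<Rightarrow> ('b \<Rightarrow> 'a) \<Rightarrow> bool" where
  "finite_covering E X p \<longleftrightarrow>
     continuous_map E X p \<and> p ` topspace E = topspace X \<and>
     (\<forall>x\<in>topspace X. finite {e \<in> topspace E. p e = x}) \<and>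
     (\<forall>x\<in>topspace X. \<exists>U \<V>. openin X U \<and> x \<in> U \<and>
        {e \<in> topspace E. p e \<in> U} = \<Union>\<V> \<and> disjoint \<V> \<and>
        (\<forall>V\<in>\<V>. openin E V \<and> homeomorphic_map (subtopology E V) (subtopology X U) p))"

text \<open>Numbering the points of each fibre identifies the total space of any finite covering of \<open>X\<close>
  with a subset of \<open>X \<times> \<nat>\<close>, so quantifying over topologies on \<open>'a \<times> nat\<close> captures all
  finite coverings.\<close>

definition virtually_haken :: "'a topology \<Rightarrow> bool" where
  "virtually_haken X \<longleftrightarrow>
     (\<exists>(E :: ('a \<times> nat) topology) p. finite_covering E X p \<and> haken E)"

definition atoroidal :: "'a topology \<Rightarrow> bool" where
  "atoroidal M \<longleftrightarrow>
     \<not> (\<exists>S. essential_surface M S \<and> subtopology M S homeomorphic_space torus)"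


section \<open>Slopes and the intersection pairing\<close>

definition isotopic_curves :: "'a topology \<Rightarrow> ('a set \<times> 'a set) set" where
  "isotopic_curves X =
     {(C, C'). \<exists>H. continuous_map (prod_topology interval_space circle) X H \<and>
        (\<forall>t\<in>{0..1}. embedding_map circle X (\<lambda>z. H (t, z))) \<and>
        C = (\<lambda>z. H (0, z)) ` sphere 0 1 \<and> C' = (\<lambda>z. H (1, z)) ` sphere 0 1}"

text \<open>Unoriented simple closed curves are represented by their images; a curve is trivial if it is
  null-homotopic.\<close>

definition nontrivial_simple_closed_curves :: "'a topology \<Rightarrow> 'a set set" where
  "nontrivial_simple_closed_curves X =
     {\<gamma> ` sphere 0 1 | \<gamma>. embedding_map circle X \<gamma> \<and>
        \<not> (\<exists>c. homotopic_with (\<lambda>_. True) circle X \<gamma> (\<lambda>_. c))}"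

definition slopes :: "'a topology \<Rightarrow> 'a set set set" where
  "slopes X = nontrivial_simple_closed_curves X // isotopic_curves X"

definition circle_class :: "complex chain set" where
  "circle_class = (SOME c. c \<in> carrier (homology_group 1 circle) \<and>
     generate (homology_group 1 circle) {c} = carrier (homology_group 1 circle))"

definition curve_class :: "'a topology \<Rightarrow> (complex \<Rightarrow> 'a) \<Rightarrow> 'a chain set" where
  "curve_class X \<gamma> = hom_induced 1 circle {} X {} \<gamma> circle_class"

text \<open>The intersection pairing on \<open>H\<^sub>1\<close> of a torus \<open>T\<close>: the alternating bilinear form taking the
  value \<open>1\<close> on the classes of the two coordinate circles, which meet transversely in one point.
  Its sign depends on the identification \<open>h\<close> of \<open>T\<close> with the standard torus (that is, on an
  orientation of \<open>T\<close>); only absolute values are used below.\<close>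

definition intersection_pairing :: "'a topology \<Rightarrow> 'a chain set \<Rightarrow> 'a chain set \<Rightarrow> int" where
  "intersection_pairing T a b =
     (let h = (SOME h. homeomorphic_map torus T h);
          G = homology_group 1 T;
          e1 = curve_class T (\<lambda>z. h (z, 1));
          e2 = curve_class T (\<lambda>z. h (1, z));
          coords = (\<lambda>c. THE (mn :: int \<times> int).
             c = (e1 [^]\<^bsub>G\<^esub> fst mn) \<otimes>\<^bsub>G\<^esub> (e2 [^]\<^bsub>G\<^esub> snd mn))
      in fst (coords a) * snd (coords b) - snd (coords a) * fst (coords b))"

text \<open>The homology class of a slope is well defined up to sign.\<close>

definition slope_class :: "'a topology \<Rightarrow> 'a set set \<Rightarrow> 'a chain set" where
  "slope_class T \<alpha> =
     curve_class T (SOME \<gamma>. embedding_map circle T \<gamma> \<and> \<gamma> ` sphere 0 1 \<in> \<alpha>)"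

definition slope_distance :: "'a topology \<Rightarrow> 'a set set \<Rightarrow> 'a set set \<Rightarrow> int" where
  "slope_distance T \<alpha> \<beta> = \<bar>intersection_pairing T (slope_class T \<alpha>) (slope_class T \<beta>)\<bar>"


section \<open>Dehn filling and Property VH\<close>

abbreviation "solid_torus \<equiv> prod_topology disc circle"

text \<open>The space \<open>M \<union>\<^sub>h (D\<^sup>2 \<times> S\<^sup>1)\<close>, with each point \<open>v\<close> of \<open>\<partial>D\<^sup>2 \<times> S\<^sup>1\<close> identified
  with \<open>h v \<in> \<partial>M\<close>.\<close>

definition glue_solid_torus ::
  "'a topology \<Rightarrow> (complex \<times> complex \<Rightarrow> 'a) \<Rightarrow> ('a + complex \<times> complex) topology" where
  "glue_solid_torus M h =
     quotient_along (disjoint_union M solid_torus)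
       (\<lambda>p. case p of Inl x \<Rightarrow> Inl x
          | Inr v \<Rightarrow> if v \<in> sphere 0 1 \<times> sphere 0 1 then Inl (h v) else Inr v)"

text \<open>The gluing map takes a meridian of the solid torus to a curve of slope \<open>\<alpha>\<close>. Up to
  homeomorphism the result does not depend on the choice of such a map.\<close>

definition dehn_filling :: "'a topology \<Rightarrow> 'a set set \<Rightarrow> ('a + complex \<times> complex) topology" where
  "dehn_filling M \<alpha> = glue_solid_torus M
     (SOME h. homeomorphic_map torus (boundary_space M) h \<and> h ` (sphere 0 1 \<times> {1}) \<in> \<alpha>)"

text \<open>The notion is meant for knot manifolds; torus bundles with once-punctured torus fibre are
  of this kind.\<close>

definition property_VH :: "'a topology \<Rightarrow> bool" where
  "property_VH M \<longleftrightarrow>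
     finite {\<alpha> \<in> slopes (boundary_space M). \<not> virtually_haken (dehn_filling M \<alpha>)}"


section \<open>The once-punctured torus and its mapping classes\<close>

definition removed_disc :: "(complex \<times> complex) set" where
  "removed_disc = {(cis a, cis b) | a b. (a - pi)\<^sup>2 + (b - pi)\<^sup>2 < 1}"

definition F_boundary :: "(complex \<times> complex) set" where
  "F_boundary = {(cis a, cis b) | a b. (a - pi)\<^sup>2 + (b - pi)\<^sup>2 = 1}"

definition F_space :: "(complex \<times> complex) topology" where
  "F_space = top_of_set (sphere 0 1 \<times> sphere 0 1 - removed_disc)"

definition F_homeo :: "(complex \<times> complex \<Rightarrow> complex \<times> complex) \<Rightarrow> bool" where
  "F_homeo f \<longleftrightarrow> homeomorphic_map F_space F_space f \<and> (\<forall>z\<in>F_boundary. f z = z)"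

definition isotopic_F :: "((complex \<times> complex \<Rightarrow> complex \<times> complex) \<times>
    (complex \<times> complex \<Rightarrow> complex \<times> complex)) set" where
  "isotopic_F =
     {(f, g). F_homeo f \<and> F_homeo g \<and>
        (\<exists>H. continuous_map (prod_topology interval_space F_space) F_space H \<and>
           (\<forall>t\<in>{0..1}. F_homeo (\<lambda>z. H (t, z))) \<and>
           (\<forall>z\<in>topspace F_space. H (0, z) = f z \<and> H (1, z) = g z))}"

definition mapping_classes :: "(complex \<times> complex \<Rightarrow> complex \<times> complex) set set" where
  "mapping_classes = {f. F_homeo f \<and> orientation_preserving 2 F_space f} // isotopic_F"

text \<open>Dehn twists along the generators \<open>x = S\<^sup>1 \<times> {1}\<close> and \<open>y = {1} \<times> S\<^sup>1\<close>, supported in the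
  annuli \<open>\<bar>Arg w\<bar> \<le> 1\<close> and \<open>\<bar>Arg z\<bar> \<le> 1\<close>. The second is the conjugate of the first by the
  rotation \<open>(z, w) \<mapsto> (cnj w, z)\<close>, which preserves orientation, whence the opposite sign for
  twists of the same handedness.\<close>

definition twist_angle :: "real \<Rightarrow> real" where
  "twist_angle s = pi * (1 + max (-1) (min 1 s))"

definition twist_x :: "complex \<times> complex \<Rightarrow> complex \<times> complex" where
  "twist_x = (\<lambda>(z, w). (z * cis (twist_angle (Arg w)), w))"

definition twist_y :: "complex \<times> complex \<Rightarrow> complex \<times> complex" where
  "twist_y = (\<lambda>(z, w). (z, w * cis (- twist_angle (Arg z))))"

definition H1F :: "(complex \<times> complex) chain set monoid" where
  "H1F = homology_group 1 F_space"

definition homology_action ::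
  "(complex \<times> complex \<Rightarrow> complex \<times> complex) \<Rightarrow>
     (complex \<times> complex) chain set \<Rightarrow> (complex \<times> complex) chain set" where
  "homology_action f = restrict (hom_induced 1 F_space {} F_space {} f) (carrier H1F)"

text \<open>\<open>SL\<^sub>2(\<int>)\<close> is realised as a subgroup of the automorphism group of \<open>H\<^sub>1(F) \<cong> \<int>\<^sup>2\<close>.\<close>

definition phi :: "(complex \<times> complex \<Rightarrow> complex \<times> complex) set \<Rightarrow>
     (complex \<times> complex) chain set \<Rightarrow> (complex \<times> complex) chain set" where
  "phi c = the_elem (homology_action ` c)"

definition H_subgroup :: "nat \<Rightarrow> (complex \<times> complex \<Rightarrow> complex \<times> complex) set set" where
  "H_subgroup i =
     {c \<in> mapping_classes. phi c \<in> generate (AutoGroup H1F)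
        {homology_action twist_x, homology_action twist_y [^]\<^bsub>AutoGroup H1F\<^esub> i}}"

text \<open>The mapping torus \<open>F \<times> [0,1] / (z,0) \<sim> (f(z),1)\<close>.\<close>

definition torus_bundle ::
  "(complex \<times> complex \<Rightarrow> complex \<times> complex) \<Rightarrow> ((complex \<times> complex) \<times> real) topology" where
  "torus_bundle f =
     quotient_along (prod_topology F_space interval_space)
       (\<lambda>(z, t). if t = 0 then (f z, 1) else (z, t))"


section \<open>The slopes \<open>\<beta>\<^sub>i\<close> and the class \<open>\<C>\<close>\<close>

definition beta_slopes :: "nat \<Rightarrow> (complex \<times> complex \<Rightarrow> complex \<times> complex) set \<Rightarrow>
    (complex \<times> complex \<Rightarrow> complex \<times> complex) \<Rightarrow>
    ((complex \<times> complex) \<times> real) set set \<Rightarrow> ((complex \<times> complex) \<times> real) set set \<Rightarrow> bool" where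
  "beta_slopes i c f \<beta>1 \<beta>2 \<longleftrightarrow>
     (let M = torus_bundle f; T = boundary_space M in
        c \<in> H_subgroup i \<and> f \<in> c \<and> atoroidal M \<and> \<beta>1 \<in> slopes T \<and> \<beta>2 \<in> slopes T \<and>
        (\<exists>N::int. \<forall>\<alpha>\<in>slopes T.
           slope_distance T \<alpha> \<beta>1 > N \<and> slope_distance T \<alpha> \<beta>2 > 1 \<longrightarrow>
             virtually_haken (dehn_filling M \<alpha>)))"

text \<open>No particular choice of slopes \<open>\<beta>\<^sub>i\<close> is singled out: \<open>c\<close> belongs to \<open>\<C>\<close> as soon as some
  choice of slopes with the defining property satisfies the disjointness condition.
  Isotopic representatives give homeomorphic bundles, so it is immaterial that the condition is
  imposed on all representatives \<open>f\<close> of the mapping class \<open>c\<close> rather than on one of them.\<close>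

definition class_C :: "(complex \<times> complex \<Rightarrow> complex \<times> complex) set set" where
  "class_C =
     {c \<in> H_subgroup 3 \<inter> H_subgroup 4. \<forall>f\<in>c. \<exists>\<beta>31 \<beta>32 \<beta>41 \<beta>42.
        beta_slopes 3 c f \<beta>31 \<beta>32 \<and> beta_slopes 4 c f \<beta>41 \<beta>42 \<and>
        {\<beta>31, \<beta>32} \<inter> {\<beta>41, \<beta>42} = {}}"

end

theory Submission
  imports Defs "HOL-Complex_Analysis.Complex_Analysis"
begin

text \<open>By the defining property of the slopes \<open>\<beta>\<close>, a slope \<open>\<alpha>\<close> with \<open>M(\<alpha>)\<close> not virtually Haken is at
  bounded distance from one of \<open>\<beta>\<^sub>3\<^sup>1, \<beta>\<^sub>3\<^sup>2\<close> and from one of \<open>\<beta>\<^sub>4\<^sup>1, \<beta>\<^sub>4\<^sup>2\<close>. These are distinct slopes, so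
  the corresponding primitive vectors of \<open>\<int>\<^sup>2\<close> are linearly independent and only finitely many
  vectors are at bounded distance from both. What needs work is that \<open>\<partial>M\<close> is a torus and that slopes
  on a torus are determined by their classes in \<open>\<int>\<^sup>2\<close>, up to sign.

  After a linear automorphism a simple closed curve has class \<open>(d, 0)\<close> and lifts to the quotient
  \<open>\<complex> - {0}\<close> of the universal cover. If \<open>d > 1\<close>, a \<open>d\<close>-th root of the lift is a Jordan curve around
  \<open>0\<close> disjoint from a rotated copy of itself, which is impossible. If \<open>d = 1\<close>, the lift is a Jordan
  curve around \<open>0\<close> disjoint from its images under \<open>z \<mapsto> e\<^bsup>2\<pi>k\<^esup>z\<close>. A Riemann map \<open>\<phi>\<close> of its inside with
  \<open>\<phi>(0) = 0\<close> extends to the boundary by Caratheodory's theorem, and the curves \<open>\<phi>(r z) / r\<close> deform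
  it to a round circle; by the Schwarz lemma they stay disjoint from their images, so this is an
  isotopy in the torus. Classes in \<open>H\<^sub>1\<close> are computed by coning off lifted paths in the universal cover.\<close>

unbundle no fps_syntax


section \<open>Boundary values of conformal maps onto Jordan domains\<close>

text \<open>\<open>property_VH\<close> counts isotopy classes of embedded circles, so bounding
  homology vectors is useless until homologous curves are known to be isotopic through embeddings,
  and this for merely continuous curves: there is no transversality and there are no bigons to
  remove. Complex analysis replaces such surgery. The Riemann map is normalized at 0 because the
  deck transformations are scalings fixing 0, which makes them comparable with its level curves. The
  price is that the family of level curves has to reach the given curve, injectively, at radius 1;
  hence the full theorem of Caratheodory, with the length-area method for continuity and a maximum
  modulus argument for injectivity. The intersection pairing is defined through arbitrary choices (a
  homeomorphism, a generator of H_1 of the circle, coordinates given by \<open>THE\<close>) and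
  becomes computable only after the coordinate classes are shown to be independent. Finally,
  \<open>manifold_boundary\<close> is defined by the absence of Euclidean neighbourhoods, so finding
  the boundary of a mapping torus takes invariance of domain.\<close>

lemma lborel_vec2:
  "distr (lborel :: (real \<times> real) measure) borel (\<lambda>(x, y). vector [x, y] :: real^2) = lborel"
proof (rule lborel_eqI [symmetric])
  fix l u :: "real^2"
  assume le: "\<And>b. b \<in> Basis \<Longrightarrow> l \<bullet> b \<le> u \<bullet> b"
  have B2: "(Basis :: (real^2) set) = {axis 1 1, axis 2 1}"
    by (auto simp: Basis_vec_def UNIV_2)
  have le': "l $ 1 \<le> u $ 1" "l $ 2 \<le> u $ 2"
    using le[of "axis 1 1"] le[of "axis 2 1"] by (auto simp: B2 inner_axis)
  have cont: "continuous_on UNIV (\<lambda>(x, y). vector [x, y] :: real^2)"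
  proof -
    have "continuous_on UNIV (\<lambda>p::real\<times>real. (\<chi> i. if i = 1 then fst p else snd p) :: real^2)"
    proof (rule continuous_on_vec_lambda)
      show "continuous_on UNIV (\<lambda>p::real\<times>real. if i = 1 then fst p else snd p)" for i :: 2
        by (cases "i = 1") (auto intro!: continuous_intros)
    qed
    moreover have "(\<lambda>p::real\<times>real. (\<chi> i. if i = 1 then fst p else snd p) :: real^2) = (\<lambda>(x, y). vector [x, y] :: real^2)"
      by (auto simp: fun_eq_iff vec_eq_iff forall_2)
    ultimately show ?thesis by metis
  qed
  then have m: "(\<lambda>(x, y). vector [x, y] :: real^2) \<in> borel_measurable lborel"
    by (simp add: borel_measurable_continuous_onI)
  have pre: "(\<lambda>(x, y). vector [x, y] :: real^2) -` box l u \<inter> space lborel = box (l $ 1, l $ 2) (u $ 1, u $ 2)"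
    by (auto simp: box_def B2 inner_axis Basis_prod_def)
  show "emeasure (distr lborel borel (\<lambda>(x, y). vector [x, y] :: real^2)) (box l u) = (\<Prod>b\<in>Basis. (u - l) \<bullet> b)"
    unfolding emeasure_distr[OF m borel_open[OF open_box]] pre using le' by (auto simp: emeasure_lborel_box_eq B2 inner_axis Basis_prod_def axis_eq_axis)
qed auto

text \<open>An injective holomorphic map has real Jacobian
  \<open>(cmod (deriv f z))\<^sup>2\<close>, so this integral is the area of the bounded image of
  \<open>S\<close>. It is stated as an iterated integral because the length-area argument looks at
  single vertical lines.\<close>

lemma area_finite_complex:
  fixes f :: "complex \<Rightarrow> complex"
  assumes "open S" and hol: "f holomorphic_on S" and inj: "inj_on f S" and bdd: "bounded (f ` S)"
  shows "(\<integral>\<^sup>+x. \<integral>\<^sup>+y. ennreal (indicator S (Complex x y) * (cmod (deriv f (Complex x y)))\<^sup>2) \<partial>lborel \<partial>lborel) < \<infinity>"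
proof -
  define c where "c = (\<lambda>v::real^2. Complex (v $ 1) (v $ 2))"
  define d where "d = (\<lambda>z. vector [Re z, Im z] :: real^2)"
  have blc: "bounded_linear c"
    unfolding c_def Complex_eq by (intro bounded_linear_add bounded_linear_const_mult bounded_linear_compose[OF bounded_linear_of_real bounded_linear_vec_nth])
  have bld: "bounded_linear d"
    unfolding d_def
    by (rule linear_conv_bounded_linear[THEN iffD1], rule linearI) (auto simp: vec_eq_iff forall_2)
  have cd: "c (d z) = z" and dc: "d (c v) = v" for z v
    by (auto simp: c_def d_def vec_eq_iff forall_2)
  define T where "T = c -` S"
  have contc: "continuous_on UNIV c" and contd: "continuous_on UNIV d"
    using blc bld by (auto simp: linear_continuous_on)
  have openT: "open T"
    unfolding T_def using \<open>open S\<close> contc by (simp add: open_vimage)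
  define g where "g = d \<circ> f \<circ> c"
  define g' where "g' = (\<lambda>v. d \<circ> (\<lambda>h. deriv f (c v) * h) \<circ> c)"
  have der: "(g has_derivative g' v) (at v within T)" if "v \<in> T" for v
  proof -
    have "(f has_field_derivative deriv f (c v)) (at (c v))"
      using that hol \<open>open S\<close> holomorphic_derivI by (auto simp: T_def)
    then have "(f has_derivative (\<lambda>h. deriv f (c v) * h)) (at (c v))"
      by (simp add: has_field_derivative_def)
    moreover have "(c has_derivative c) (at v)" "(d has_derivative d) (at (f (c v)))"
      using blc bld by (auto intro: bounded_linear_imp_has_derivative)
    ultimately have "(g has_derivative g' v) (at v)"
      unfolding g_def g'_def by (metis (no_types, lifting) comp_assoc comp_apply diff_chain_at)
    then show ?thesis by (rule has_derivative_at_withinI)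
  qed
  have injg: "inj_on g T"
    unfolding g_def inj_on_def
    by (metis T_def cd comp_apply dc inj inj_on_def vimageE)
  have img: "g ` T = c -` (f ` S)"
  proof (intro equalityI subsetI)
    fix v assume "v \<in> g ` T" then show "v \<in> c -` f ` S" by (auto simp: g_def cd T_def)
  next
    fix v assume "v \<in> c -` f ` S"
    then obtain z where z: "z \<in> S" "c v = f z" by auto
    have "g (d z) = d (c v)" by (simp add: g_def cd z)
    then have "v = g (d z)" "d z \<in> T" using z dc[of v] by (auto simp: cd T_def)
    then show "v \<in> g ` T" by blast
  qed
  have "g ` T = d ` (f ` S)"
  proof -
    have "c ` T = S"
      unfolding T_def using cd by (metis surj_def surj_image_vimage_eq)
    then show ?thesis unfolding g_def by (metis image_comp)
  qed
  then have bg: "bounded (g ` T)"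
    using bounded_linear_image[OF bdd bld] by simp
  have "open (f ` S)" using open_mapping_thm3[OF hol \<open>open S\<close> inj] .
  then have og: "open (g ` T)" unfolding img using contc by (simp add: open_vimage)
  have lm: "g ` T \<in> lmeasurable"
    using bg og by (simp add: bounded_set_imp_lmeasurable)
  \<comment> \<open>As a real matrix, multiplication by w has determinant |w|^2; \<open>c\<close>
    and \<open>d\<close> only identify \<open>real^2\<close> with the complex plane.\<close>
  have detg: "\<bar>det (matrix (g' v))\<bar> = (cmod (deriv f (c v)))\<^sup>2" for v
    unfolding cmod_power2 by (simp add: det_2 matrix_def g'_def c_def d_def axis_def power2_eq_square)
  have "((\<lambda>v. \<bar>det (matrix (g' v))\<bar>) has_integral measure lebesgue (g ` T)) T"
    using has_measure_differentiable_image[OF _ der injg, of "measure lebesgue (g ` T)"] lm openT by auto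
  then have "((\<lambda>v. (cmod (deriv f (c v)))\<^sup>2) has_integral measure lebesgue (g ` T)) T"
    by (simp add: detg)
  then have I: "integral\<^sup>N lborel (\<lambda>v. indicator T v * (cmod (deriv f (c v)))\<^sup>2) = measure lebesgue (g ` T)"
    by (intro nn_integral_has_integral_lebesgue) auto
  have "deriv f holomorphic_on S" using hol \<open>open S\<close> by (rule holomorphic_deriv)
  then have "continuous_on S (\<lambda>z. (cmod (deriv f z))\<^sup>2)"
    by (intro continuous_intros holomorphic_on_imp_continuous_on)
  then have mS: "(\<lambda>z. indicator S z * (cmod (deriv f z))\<^sup>2) \<in> borel_measurable borel"
    using \<open>open S\<close> borel_measurable_continuous_on_indicator[of S "\<lambda>z. (cmod (deriv f z))\<^sup>2"] by simp
  have mc: "c \<in> borel_measurable borel" using contc by (rule borel_measurable_continuous_onI)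
  let ?h = "\<lambda>z. ennreal (indicator S z * (cmod (deriv f z))\<^sup>2)"
  have mh: "?h \<in> borel_measurable borel" using mS by simp
  have mp: "(\<lambda>(x, y). vector [x, y] :: real^2) \<in> borel_measurable (lborel :: (real\<times>real) measure)"
  proof -
    have "(\<lambda>(x, y). vector [x, y] :: real^2) = d \<circ> (\<lambda>(x, y). Complex x y)"
      by (auto simp: d_def)
    moreover have "continuous_on UNIV (d \<circ> (\<lambda>(x, y). Complex x y))"
      by (intro continuous_on_compose continuous_on_subset[OF contd])
         (auto simp: Complex_eq case_prod_unfold intro!: continuous_intros)
    ultimately show ?thesis by (simp add: borel_measurable_continuous_onI)
  qed
  have mC: "(\<lambda>p. Complex (fst p) (snd p)) \<in> borel_measurable (borel :: (real\<times>real) measure)"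
    by (rule borel_measurable_continuous_onI) (auto simp: Complex_eq intro!: continuous_intros)
  \<comment> \<open>The change of variables formula lives on \<open>real^2\<close>, Fubini's theorem
    on a product measure; \<open>lborel_vec2\<close> passes from one to the other.\<close>
  have "integral\<^sup>N lborel (\<lambda>v. ?h (c v)) = integral\<^sup>N (distr lborel borel (\<lambda>(x, y). vector [x, y] :: real^2)) (\<lambda>v. ?h (c v))"
    by (simp add: lborel_vec2)
  also have "\<dots> = (\<integral>\<^sup>+p. ?h (c (case p of (x, y) \<Rightarrow> vector [x, y])) \<partial>lborel)"
    using mp mh mc by (subst nn_integral_distr) (auto intro: measurable_compose)
  also have "\<dots> = (\<integral>\<^sup>+p. ?h (Complex (fst p) (snd p)) \<partial>lborel)"
    by (intro nn_integral_cong) (auto simp: c_def)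
  also have "\<dots> = (\<integral>\<^sup>+p. ?h (Complex (fst p) (snd p)) \<partial>(lborel \<Otimes>\<^sub>M lborel))"
    by (simp add: lborel_prod)
  also have "\<dots> = (\<integral>\<^sup>+x. \<integral>\<^sup>+y. ?h (Complex x y) \<partial>lborel \<partial>lborel)"
  proof -
    have "(\<lambda>p. ?h (Complex (fst p) (snd p))) \<in> borel_measurable (lborel \<Otimes>\<^sub>M lborel)"
      using measurable_compose[OF mC mh] by (simp add: lborel_prod)
    from lborel.nn_integral_fst[OF this] show ?thesis by simp
  qed
  finally have "(\<integral>\<^sup>+x. \<integral>\<^sup>+y. ?h (Complex x y) \<partial>lborel \<partial>lborel) = measure lebesgue (g ` T)"
    using I by (simp add: T_def indicator_def vimage_def)
  then show ?thesis by simp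
qed


text \<open>The length-area method: the area is the integral over s of the energy of
  \<open>f\<close> on the vertical line at s, so these energies cannot all stay above
  \<open>\<kappa>\<close> on a half-line. On a line of energy at most \<open>\<kappa>\<close>,
  Cauchy-Schwarz bounds the displacement.\<close>

lemma short_vertical_segment:
  fixes f :: "complex \<Rightarrow> complex" and \<kappa> s0 :: real
  defines "S \<equiv> {z. 0 < Im z \<and> Im z < pi}"
  assumes hol: "f holomorphic_on S" and inj: "inj_on f S" and bdd: "bounded (f ` S)" and "\<kappa> > 0"
  obtains s where "s \<ge> s0"
    "\<And>a b. \<lbrakk>0 < a; a \<le> b; b < pi\<rbrakk> \<Longrightarrow> (cmod (f (Complex s b) - f (Complex s a)))\<^sup>2 \<le> \<kappa> * (b - a)"
proof -
  have S: "S = {z. 0 < Im z} \<inter> {z. Im z < pi}" by (auto simp: S_def)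
  have "open S" unfolding S by (intro open_Int open_halfspace_Im_gt open_halfspace_Im_lt)
  define A where "A = (\<lambda>x. \<integral>\<^sup>+y. ennreal (indicator S (Complex x y) * (cmod (deriv f (Complex x y)))\<^sup>2) \<partial>lborel)"
  have fin: "(\<integral>\<^sup>+x. A x \<partial>lborel) < \<infinity>"
    unfolding A_def by (rule area_finite_complex[OF \<open>open S\<close> hol inj bdd])
  have "\<exists>s\<ge>s0. A s \<le> ennreal \<kappa>"
  proof (rule ccontr)
    assume "\<not> ?thesis"
    then have "ennreal \<kappa> < A x" if "s0 \<le> x" for x
      using that not_le by blast
    then have le: "ennreal \<kappa> * indicator {s0..} x \<le> A x" for x
      by (cases "x \<ge> s0") (auto simp: indicator_def intro: less_imp_le)
    have "(\<integral>\<^sup>+x. ennreal \<kappa> * indicator {s0..} x \<partial>lborel) \<le> (\<integral>\<^sup>+x. A x \<partial>lborel)"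
      by (intro nn_integral_mono) (use le in auto)
    moreover have "(\<integral>\<^sup>+x. ennreal \<kappa> * indicator {s0..} x \<partial>lborel) = ennreal \<kappa> * emeasure lborel {s0..}"
      by (subst nn_integral_cmult_indicator) auto
    moreover have "emeasure lborel {s0..} = \<infinity>"
    proof (rule ccontr)
      assume "emeasure lborel {s0..} \<noteq> \<infinity>"
      then obtain r where r: "emeasure lborel {s0..} = ennreal r" "r \<ge> 0"
        by (cases "emeasure lborel {s0..}") auto
      have "emeasure lborel {s0..s0 + (r + 1)} \<le> emeasure lborel {s0..}"
        by (intro emeasure_mono) auto
      then show False using r by (auto simp: ennreal_le_iff2)
    qed
    ultimately show False using fin \<open>\<kappa> > 0\<close> by (auto simp: ennreal_mult_top top_unique)
  qed
  then obtain s where s: "s \<ge> s0" "A s \<le> ennreal \<kappa>" by auto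
  have "(cmod (f (Complex s b) - f (Complex s a)))\<^sup>2 \<le> \<kappa> * (b - a)" if ab: "0 < a" "a \<le> b" "b < pi" for a b
  proof (cases "a = b")
    case True then show ?thesis by simp
  next
    case False
    then have "a < b" using ab by simp
    define D where "D = (\<lambda>y. deriv f (Complex s y))"
    have inS: "Complex s y \<in> S" if "y \<in> {a..b}" for y using that ab by (auto simp: S_def)
    have "deriv f holomorphic_on S" using hol \<open>open S\<close> by (rule holomorphic_deriv)
    then have "continuous_on S (deriv f)" by (rule holomorphic_on_imp_continuous_on)
    moreover have "continuous_on {a..b} (Complex s)"
      by (auto simp: Complex_eq intro!: continuous_intros)
    ultimately have contD: "continuous_on {a..b} D"
      unfolding D_def using inS by (metis continuous_on_compose2 image_subsetI)
    have vd: "((\<lambda>y. f (Complex s y)) has_vector_derivative (\<i> * D y)) (at y within {a..b})" if "y \<in> {a..b}" for y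
    proof -
      have "(f has_field_derivative D y) (at (Complex s y))"
        unfolding D_def using inS[OF that] hol \<open>open S\<close> by (rule holomorphic_derivI[rotated 2])
      moreover have "(Complex s has_vector_derivative \<i>) (at y within {a..b})"
      proof -
        have "((\<lambda>y. of_real s + \<i> * of_real y) has_vector_derivative (\<i> * 1)) (at y within {a..b})"
          by (auto intro!: derivative_eq_intros)
        then show ?thesis by (simp add: Complex_eq[abs_def])
      qed
      ultimately show ?thesis
        using field_vector_diff_chain_within[of "Complex s" \<i> y "{a..b}" f "D y"]
        by (simp add: o_def mult.commute has_field_derivative_at_within)
    qed
    have ftc: "((\<lambda>y. \<i> * D y) has_integral (f (Complex s b) - f (Complex s a))) {a..b}"
      by (rule fundamental_theorem_of_calculus[OF ab(2) vd])
    define B where "B = integral {a..b} (\<lambda>y. (cmod (D y))\<^sup>2)"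
    have Bi: "((\<lambda>y. (cmod (D y))\<^sup>2) has_integral B) {a..b}"
      unfolding B_def by (intro integrable_integral integrable_continuous_real continuous_intros contD)
    have "ennreal B = (\<integral>\<^sup>+y. ennreal (indicator {a..b} y * (cmod (D y))\<^sup>2) \<partial>lborel)"
      using Bi by (subst nn_integral_has_integral_lebesgue) auto
    also have "\<dots> \<le> A s"
      unfolding A_def D_def using inS by (intro nn_integral_mono) (auto simp: indicator_def)
    finally have "B \<le> \<kappa>" using s(2) \<open>\<kappa> > 0\<close> by (metis order_trans ennreal_le_iff less_imp_le)
    \<comment> \<open>Cauchy-Schwarz in the form |D| <= k/2 + |D|^2/(2k); the \<open>k\<close>
      defined afterwards minimizes the sum of the two resulting terms.\<close>
    have le: "cmod (f (Complex s b) - f (Complex s a)) \<le> k / 2 * (b - a) + \<kappa> / (2 * k)" if "k > 0" for k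
    proof -
      have "((\<lambda>y. k / 2 + (1 / (2 * k)) * (cmod (D y))\<^sup>2) has_integral ((b - a) * (k / 2) + (1 / (2 * k)) * B)) {a..b}"
        using ab has_integral_const_real[of "k/2" a b] by (intro has_integral_add has_integral_mult_right Bi) auto
      moreover have "cmod (\<i> * D y) \<le> k / 2 + (1 / (2 * k)) * (cmod (D y))\<^sup>2" for y
      proof -
        have "0 \<le> (k - cmod (D y))\<^sup>2" by simp
        then show ?thesis using that by (simp add: norm_mult field_simps power2_eq_square)
      qed
      ultimately have "cmod (f (Complex s b) - f (Complex s a)) \<le> (b - a) * (k / 2) + (1 / (2 * k)) * B"
        using ftc by (metis (no_types, lifting) integral_norm_bound_integral has_integral_integrable integral_unique)
      also have "\<dots> \<le> (b - a) * (k / 2) + (1 / (2 * k)) * \<kappa>"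
        using \<open>B \<le> \<kappa>\<close> that by (intro add_left_mono mult_left_mono) auto
      finally show ?thesis by (simp add: algebra_simps)
    qed
    define k where "k = sqrt (\<kappa> / (b - a))"
    have "k > 0" using \<open>\<kappa> > 0\<close> \<open>a < b\<close> by (simp add: k_def)
    have k2: "k\<^sup>2 * (b - a) = \<kappa>" using \<open>\<kappa> > 0\<close> \<open>a < b\<close> by (simp add: k_def)
    have "k / 2 * (b - a) + \<kappa> / (2 * k) = k * (b - a)"
      using \<open>k > 0\<close> by (simp add: k2[symmetric] power2_eq_square field_simps)
    with le[OF \<open>k > 0\<close>] have "cmod (f (Complex s b) - f (Complex s a)) \<le> k * (b - a)" by simp
    then have "(cmod (f (Complex s b) - f (Complex s a)))\<^sup>2 \<le> (k * (b - a))\<^sup>2"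
      by (intro power_mono) auto
    also have "\<dots> = \<kappa> * (b - a)" by (simp add: k2[symmetric] power2_eq_square)
    finally show ?thesis .
  qed
  with s(1) that show ?thesis by blast
qed

text \<open>Nearby points of the curve correspond to nearby points of the circle, and the shorter
  arc between those stays within their distance of the first one; its image is \<open>K\<close>.
  Such a piece later closes up the image of a cross-cut.\<close>

lemma Jordan_curve_uniformly_locally_connected:
  fixes c :: "real \<Rightarrow> complex"
  assumes c: "simple_path c" "pathfinish c = pathstart c" and "e > 0"
  obtains d where "d > 0"
    "\<And>p q. \<lbrakk>p \<in> path_image c; q \<in> path_image c; dist p q < d\<rbrakk> \<Longrightarrow>
       \<exists>K. compact K \<and> connected K \<and> K \<subseteq> path_image c \<and> p \<in> K \<and> q \<in> K \<and> K \<subseteq> cball p e"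
proof -
  obtain h k where hk: "homeomorphism (sphere (0::complex) 1) (path_image c) h k"
    using homeomorphic_simple_path_image_circle[OF c, of 1 0] homeomorphic_sym
    unfolding homeomorphic_def by fastforce
  then have ch: "continuous_on (sphere 0 1) h" and ck: "continuous_on (path_image c) k"
    and him: "h ` sphere 0 1 = path_image c" and kim: "k ` path_image c = sphere 0 1"
    and hkid: "\<And>y. y \<in> path_image c \<Longrightarrow> h (k y) = y"
    by (auto simp: homeomorphism_def)
  have "compact (path_image c)" using c compact_simple_path_image by blast
  then have uk: "uniformly_continuous_on (path_image c) k" by (intro compact_uniformly_continuous ck)
  have uh: "uniformly_continuous_on (sphere 0 1) h" by (intro compact_uniformly_continuous ch) auto
  obtain d1 where d1: "d1 > 0" "\<And>x y. \<lbrakk>x \<in> sphere 0 1; y \<in> sphere 0 1; dist x y < d1\<rbrakk> \<Longrightarrow> dist (h x) (h y) < e"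
    using uh \<open>e > 0\<close> unfolding uniformly_continuous_on_def by (metis dist_commute)
  obtain d2 where d2: "d2 > 0" "\<And>x y. \<lbrakk>x \<in> path_image c; y \<in> path_image c; dist x y < d2\<rbrakk> \<Longrightarrow> dist (k x) (k y) < d1"
    using uk d1(1) unfolding uniformly_continuous_on_def by (metis dist_commute)
  have "\<exists>K. compact K \<and> connected K \<and> K \<subseteq> path_image c \<and> p \<in> K \<and> q \<in> K \<and> K \<subseteq> cball p e"
    if pq: "p \<in> path_image c" "q \<in> path_image c" "dist p q < d2" for p q
  proof -
    have u: "cmod (k p) = 1" "cmod (k q) = 1" using kim pq by (auto simp: set_eq_iff image_iff)
    \<comment> \<open>Since |t| <= pi, the points \<open>k p * cis (x * t)\<close> run along the
      shorter arc; their chord from \<open>k p\<close> has length 2 |sin (x t / 2)|, which does not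
      decrease with \<open>x\<close>.\<close>
    define t where "t = Arg (k q / k p)"
    have t: "- pi < t" "t \<le> pi" by (auto simp: t_def Arg_bounded)
    have kp0: "k p \<noteq> 0" using u by auto
    have "k q / k p = cis t"
      using u by (simp add: t_def cis_Arg norm_divide sgn_eq) (metis cis_Arg complex_sgn_def divide_eq_0_iff inverse_1 norm_divide norm_zero scaleR_one u zero_neq_one div_by_1)
    then have kq: "k q = k p * cis t" using kp0 by (simp add: field_simps)
    have nrm: "cmod (cis x - 1) = 2 * \<bar>sin (x / 2)\<bar>" for x
      using dist_exp_i_1[of x] by (simp add: cis_conv_exp)
    have close: "dist (k p) (k p * cis (x * t)) < d1" if "x \<in> {0..1}" for x
    proof -
      have xt: "\<bar>x * t / 2\<bar> \<le> \<bar>t / 2\<bar>" using that by (simp add: abs_mult mult_left_le_one_le)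
      then have "sin \<bar>x * t / 2\<bar> \<le> sin \<bar>t / 2\<bar>" using t xt by (intro sin_monotone_2pi_le) auto
      moreover have sabs: "sin \<bar>y\<bar> = \<bar>sin y\<bar>" if "\<bar>y\<bar> \<le> pi / 2" for y
        using that sin_ge_zero[of "\<bar>y\<bar>"] by (cases "y \<ge> 0") auto
      moreover have "\<bar>t / 2\<bar> \<le> pi / 2" using t by auto
      moreover have "\<bar>x * t / 2\<bar> \<le> pi / 2" using xt t by linarith
      ultimately have "\<bar>sin (x * t / 2)\<bar> \<le> \<bar>sin (t / 2)\<bar>" by metis
      then have "cmod (cis (x * t) - 1) \<le> cmod (cis t - 1)" by (simp add: nrm)
      moreover have "dist (k p) (k p * cis y) = cmod (cis y - 1)" for y
      proof -
        have "k p - k p * cis y = k p * (1 - cis y)" by (simp add: algebra_simps)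
        then show ?thesis using u by (simp add: dist_norm norm_mult norm_minus_commute)
      qed
      moreover have "dist (k p) (k p * cis t) < d1" using d2(2)[OF pq] kq by simp
      ultimately show ?thesis by simp
    qed
    define K where "K = (\<lambda>x. h (k p * cis (x * t))) ` {0..1::real}"
    have insph: "k p * cis (x * t) \<in> sphere 0 1" for x using u by (simp add: norm_mult)
    have cont: "continuous_on {0..1} (\<lambda>x. h (k p * cis (x * t)))"
      by (rule continuous_on_compose2[OF ch]) (use insph in \<open>auto intro!: continuous_intros\<close>)
    have "compact K" "connected K" unfolding K_def
      using cont by (auto intro: compact_continuous_image connected_continuous_image)
    moreover have "K \<subseteq> path_image c" unfolding K_def using him insph by auto
    moreover have "p \<in> K" unfolding K_def using hkid[OF pq(1)] by (intro image_eqI[of _ _ 0]) auto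
    moreover have "q \<in> K" unfolding K_def using hkid[OF pq(2)] kq by (intro image_eqI[of _ _ 1]) auto
    moreover have "K \<subseteq> cball p e"
    proof
      fix y assume "y \<in> K"
      then obtain x where x: "x \<in> {0..1}" "y = h (k p * cis (x * t))" by (auto simp: K_def)
      have "dist (h (k p)) y < e" unfolding x(2) using close[OF x(1)] insph[of x] insph[of 0] by (intro d1(2)) auto
      then show "y \<in> cball p e" using hkid[OF pq(1)] by simp
    qed
    ultimately show ?thesis by blast
  qed
  with d2(1) that show ?thesis by blast
qed

text \<open>A limit in the open image would be carried by the continuous inverse to a limit of
  \<open>X\<close> inside the disc.\<close>

lemma biholomorphic_boundary_limit:
  fixes f :: "complex \<Rightarrow> complex"
  assumes hol: "f holomorphic_on ball 0 1" and inj: "inj_on f (ball 0 1)"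
    and X: "\<And>n. X n \<in> ball 0 1" "X \<longlonglongrightarrow> x" "cmod x = 1" and l: "(\<lambda>n. f (X n)) \<longlonglongrightarrow> l"
  shows "l \<in> frontier (f ` ball 0 1)"
proof -
  have op: "open (f ` ball 0 1)" using open_mapping_thm3[OF hol _ inj] by simp
  obtain g where g: "g holomorphic_on (f ` ball 0 1)" "\<And>z. z \<in> ball 0 1 \<Longrightarrow> g (f z) = z"
    using holomorphic_has_inverse[OF hol _ inj] by (metis open_ball)
  have "l \<notin> f ` ball 0 1"
  proof
    assume lD: "l \<in> f ` ball 0 1"
    then have "isCont g l"
      using g(1) op by (metis continuous_on_eq_continuous_at holomorphic_on_imp_continuous_on)
    then have "(\<lambda>n. g (f (X n))) \<longlonglongrightarrow> g l" using l by (rule isCont_tendsto_compose)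
    then have "X \<longlonglongrightarrow> g l" using g(2) X(1) by simp
    then have "x = g l" using X(2) LIMSEQ_unique by blast
    then show False using lD g(2) X(3) by (auto simp: image_iff)
  qed
  moreover have "l \<in> closure (f ` ball 0 1)"
    using l X(1) by (auto simp: closure_sequential intro!: exI[of _ "\<lambda>n. f (X n)"])
  ultimately show ?thesis using op by (simp add: frontier_def interior_open)
qed

text \<open>The exponential maps the strip of height pi onto the upper half-plane, and the Cayley
  transform maps that onto the disc. The end where \<open>Re u\<close> tends to infinity goes to the
  boundary point 1, and vertical segments become circular cross-cuts around it.\<close>

definition strip_to_disc :: "complex \<Rightarrow> complex" where
  "strip_to_disc u = (exp u - \<i>) / (exp u + \<i>)"

lemma strip_to_disc_props:
  defines "S \<equiv> {z. 0 < Im z \<and> Im z < pi}"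
  shows "strip_to_disc holomorphic_on S" "inj_on strip_to_disc S" "strip_to_disc ` S = ball 0 1"
    and "\<And>z s. \<lbrakk>z \<in> ball 0 1; dist 1 z < min 1 (exp (- s))\<rbrakk> \<Longrightarrow> \<exists>u\<in>S. Re u > s \<and> strip_to_disc u = z"
proof -
  have ImE: "Im (exp u) > 0" if "u \<in> S" for u
    using that by (simp add: S_def Im_exp sin_gt_zero)
  have nz: "w + \<i> \<noteq> 0" if "Im w > 0" for w using that by (auto simp: complex_eq_iff)
  show "strip_to_disc holomorphic_on S"
    unfolding strip_to_disc_def[abs_def] using ImE nz by (intro holomorphic_intros) auto
  have exp_inj: "u = v" if "u \<in> S" "v \<in> S" "exp u = exp v" for u v
  proof -
    have "Re u = Re v" using that(3) by (metis norm_exp_eq_Re exp_inj_iff)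
    moreover have "\<bar>Im u - Im v\<bar> < 2 * pi" using that by (auto simp: S_def)
    ultimately show ?thesis using that(3) complex_eqI exp_complex_eqI by blast
  qed
  show "inj_on strip_to_disc S"
  proof (rule inj_onI)
    fix u v assume uv: "u \<in> S" "v \<in> S" "strip_to_disc u = strip_to_disc v"
    then have "(exp u - \<i>) * (exp v + \<i>) = (exp v - \<i>) * (exp u + \<i>)"
      using nz[OF ImE[OF uv(1)]] nz[OF ImE[OF uv(2)]] by (simp add: strip_to_disc_def field_simps)
    then have "2 * \<i> * (exp u - exp v) = 0" by (simp add: algebra_simps)
    then show "u = v" using exp_inj uv by simp
  qed
  \<comment> \<open>The inverse Cayley transform followed by \<open>Ln\<close>; the real part of
    this logarithm measures how close z is to 1.\<close>
  have inv: "\<exists>u\<in>S. Re u = ln (cmod (1 + z) / cmod (1 - z)) \<and> strip_to_disc u = z" if z: "z \<in> ball 0 1" for z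
  proof -
    have "z \<noteq> 1" using z by auto
    define w where "w = \<i> * (1 + z) / (1 - z)"
    have "w * (1 - z) = \<i> * (1 + z)" using \<open>z \<noteq> 1\<close> by (simp add: w_def)
    then have wz: "w - \<i> = z * (w + \<i>)" by (simp add: algebra_simps)
    have "Im w > 0"
    proof (rule ccontr)
      assume "\<not> Im w > 0"
      then have "cmod (w + \<i>) \<le> cmod (w - \<i>)"
        unfolding cmod_def by (intro real_sqrt_le_mono) (auto simp: power2_eq_square algebra_simps)
      moreover have "cmod (w - \<i>) = cmod z * cmod (w + \<i>)" by (simp add: wz norm_mult)
      moreover have "cmod z < 1" using z by simp
      ultimately have "cmod (w + \<i>) = 0"
        by (metis less_le_not_le mult_left_less_imp_less mult_less_cancel_right2 norm_not_less_zero order_less_le)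
      then have "w = - \<i>" by (simp add: eq_neg_iff_add_eq_0)
      then show False using wz by simp
    qed
    then have "w \<noteq> 0" by auto
    have "Ln w \<in> S" using Im_Ln_pos_lt[OF \<open>w \<noteq> 0\<close>] \<open>Im w > 0\<close> by (simp add: S_def)
    moreover have "Re (Ln w) = ln (cmod (1 + z) / cmod (1 - z))"
      using \<open>w \<noteq> 0\<close> by (simp add: w_def norm_divide norm_mult)
    moreover have "strip_to_disc (Ln w) = z"
      using \<open>w \<noteq> 0\<close> wz nz[OF \<open>Im w > 0\<close>] by (simp add: strip_to_disc_def)
    ultimately show ?thesis by blast
  qed
  have "strip_to_disc u \<in> ball 0 1" if "u \<in> S" for u
  proof -
    let ?w = "exp u"
    have "cmod (?w - \<i>) < cmod (?w + \<i>)"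
      unfolding cmod_def using ImE[OF that] by (intro real_sqrt_less_mono) (auto simp: power2_eq_square algebra_simps)
    then show ?thesis using nz[OF ImE[OF that]] by (simp add: strip_to_disc_def norm_divide)
  qed
  then show "strip_to_disc ` S = ball 0 1" using inv by (auto simp: image_iff) (metis mem_ball_0)
  fix z :: complex and s :: real
  assume z: "z \<in> ball 0 1" and d: "dist 1 z < min 1 (exp (- s))"
  have "cmod (1 - z) > 0" using z by auto
  have "cmod (1 + z) \<ge> 2 - cmod (1 - z)"
    using norm_triangle_ineq[of "1 + z" "1 - z"] by simp
  then have "cmod (1 + z) > 1" using d by (simp add: dist_norm)
  have "cmod (1 - z) * exp s < exp (- s) * exp s" using d by (intro mult_strict_right_mono) (auto simp: dist_norm)
  then have "exp s * cmod (1 - z) < cmod (1 + z)" using \<open>cmod (1 + z) > 1\<close> by (simp add: mult.commute exp_minus)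
  then have "exp s < cmod (1 + z) / cmod (1 - z)" using \<open>cmod (1 - z) > 0\<close> by (simp add: field_simps)
  then have "s < ln (cmod (1 + z) / cmod (1 - z))"
    by (metis exp_gt_zero ln_exp ln_less_cancel_iff order_less_trans)
  then show "\<exists>u\<in>S. Re u > s \<and> strip_to_disc u = z" using inv[OF z] by metis
qed

text \<open>A cross-cut near 1 has a short image ending at two points of the Jordan curve; closed up
  by a small piece of the curve, it becomes a compact set \<open>K\<close> in a small disc. Suppose
  a point beyond the cross-cut is mapped outside this disc. By Janiszewski's theorem
  \<open>K\<close> and the curve together do not separate its image from \<open>f 0\<close>, whereas
  the cross-cut alone already separates them within the domain. So everything beyond the cross-cut
  is mapped into the small disc.\<close>

lemma Caratheodory_cluster_at_1:
  fixes f :: "complex \<Rightarrow> complex"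
  assumes c: "simple_path c" "pathfinish c = pathstart c"
    and hol: "f holomorphic_on ball 0 1" and inj: "inj_on f (ball 0 1)"
    and img: "f ` ball 0 1 = inside (path_image c)" and "\<epsilon> > 0"
  obtains \<delta> where "\<delta> > 0"
    "\<And>z z'. \<lbrakk>z \<in> ball 0 1; z' \<in> ball 0 1; dist 1 z < \<delta>; dist 1 z' < \<delta>\<rbrakk> \<Longrightarrow> dist (f z) (f z') \<le> \<epsilon>"
proof -
  define S where "S = {z. 0 < Im z \<and> Im z < pi}"
  define J where "J = path_image c"
  define D where "D = inside J"
  note W = strip_to_disc_props[folded S_def]
  have Seq: "S = {z. 0 < Im z} \<inter> {z. Im z < pi}" by (auto simp: S_def)
  have openS: "open S" unfolding Seq by (intro open_Int open_halfspace_Im_gt open_halfspace_Im_lt)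
  define F where "F = f \<circ> strip_to_disc"
  have holF: "F holomorphic_on S" unfolding F_def using W(1,3) hol by (intro holomorphic_on_compose_gen[of _ _ _ "ball 0 1"]) auto
  have injF: "inj_on F S" unfolding F_def using W(2,3) inj by (intro comp_inj_on) auto
  have imF: "F ` S = D" unfolding F_def D_def J_def using W(3) img by (metis image_comp)
  have jd: "open D" "connected D" "bounded D" "frontier D = J" "D \<inter> J = {}" "closed J"
    using Jordan_inside_outside[OF c] closed_simple_path_image[OF c(1)] inside_no_overlap[of J]
    by (auto simp: D_def J_def)
  have b0D: "f 0 \<in> D" using img by (auto simp: D_def J_def)
  then obtain r0 where r0: "r0 > 0" "ball (f 0) r0 \<subseteq> D" using jd(1) by (meson openE)
  \<comment> \<open>The bound \<open>\<epsilon> / 4\<close> leaves room for a diameter of twice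
    \<open>\<eta>\<close>, and \<open>r0 / 2\<close> keeps \<open>f 0\<close> out of the disc of
    radius \<open>\<eta>\<close> around a point of the curve.\<close>
  define \<eta> where "\<eta> = min (\<epsilon> / 4) (r0 / 2)"
  have "\<eta> > 0" using r0 \<open>\<epsilon> > 0\<close> by (simp add: \<eta>_def)
  obtain \<mu> where \<mu>: "\<mu> > 0" "\<And>p q. \<lbrakk>p \<in> J; q \<in> J; dist p q < \<mu>\<rbrakk> \<Longrightarrow>
       \<exists>K. compact K \<and> connected K \<and> K \<subseteq> J \<and> p \<in> K \<and> q \<in> K \<and> K \<subseteq> cball p \<eta>"
    using Jordan_curve_uniformly_locally_connected[OF c \<open>\<eta> > 0\<close>] unfolding J_def by metis
  \<comment> \<open>The bound for the diameter of the image of the cross-cut: below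
    \<open>\<mu>\<close>, so that its ends can be joined within the curve, and at most
    \<open>\<eta>\<close>. As segments are shorter than pi, the energy bound \<open>\<kappa>\<close>
    gives squared displacement at most \<open>m\<^sup>2\<close>.\<close>
  define m where "m = min \<mu> \<eta> / 2"
  have m: "m > 0" "m < \<mu>" "m \<le> \<eta>" using \<mu>(1) \<open>\<eta> > 0\<close> by (auto simp: m_def)
  define \<kappa> where "\<kappa> = m\<^sup>2 / pi"
  have "\<kappa> > 0" using m by (simp add: \<kappa>_def)
  \<comment> \<open>A positive \<open>s\<close> leaves \<open>Complex 0 (pi/2)\<close>, the preimage
    of 0 in the strip, on the other side of the cross-cut.\<close>
  obtain s where s: "s \<ge> 1"
    and sh: "\<And>a b. \<lbrakk>0 < a; a \<le> b; b < pi\<rbrakk> \<Longrightarrow> (cmod (F (Complex s b) - F (Complex s a)))\<^sup>2 \<le> \<kappa> * (b - a)"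
    using short_vertical_segment[of F \<kappa> 1] holF injF imF jd(3) \<open>\<kappa> > 0\<close> unfolding S_def by metis
  define \<sigma> where "\<sigma> = (\<lambda>y. F (Complex s y))"
  have hoel: "(dist (\<sigma> a) (\<sigma> b))\<^sup>2 \<le> \<kappa> * dist a b" if "a \<in> {0<..<pi}" "b \<in> {0<..<pi}" for a b
  proof (cases "a \<le> b")
    case True then show ?thesis using sh[of a b] that by (simp add: \<sigma>_def dist_norm norm_minus_commute)
  next
    case False then show ?thesis using sh[of b a] that by (simp add: \<sigma>_def dist_norm norm_minus_commute)
  qed
  \<comment> \<open>Hoelder continuity with exponent 1/2 lets the image of the cross-cut extend to
    its two end points.\<close>
  have "uniformly_continuous_on {0<..<pi} \<sigma>"
    unfolding uniformly_continuous_on_def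
  proof (intro allI impI)
    fix e :: real assume "e > 0"
    show "\<exists>d>0. \<forall>x\<in>{0<..<pi}. \<forall>x'\<in>{0<..<pi}. dist x' x < d \<longrightarrow> dist (\<sigma> x') (\<sigma> x) < e"
    proof (intro exI[of _ "e\<^sup>2 / \<kappa>"] conjI ballI impI)
      show "0 < e\<^sup>2 / \<kappa>" using \<open>e > 0\<close> \<open>\<kappa> > 0\<close> by simp
      fix x x' assume x: "x \<in> {0<..<pi}" "x' \<in> {0<..<pi}" "dist x' x < e\<^sup>2 / \<kappa>"
      then have "\<kappa> * dist x' x < e\<^sup>2" using \<open>\<kappa> > 0\<close> by (simp add: field_simps)
      then have "(dist (\<sigma> x') (\<sigma> x))\<^sup>2 < e\<^sup>2" using hoel[OF x(2,1)] by linarith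
      then show "dist (\<sigma> x') (\<sigma> x) < e" using \<open>e > 0\<close> by (simp add: power2_less_imp_less)
    qed
  qed
  then obtain g where ug: "uniformly_continuous_on (closure {0<..<pi}) g"
    and g\<sigma>: "\<And>x. x \<in> {0<..<pi} \<Longrightarrow> \<sigma> x = g x"
    using uniformly_continuous_on_extension_on_closure by metis
  have cl: "closure {0<..<pi} = {0..pi}" using closure_greaterThanLessThan[of 0 pi] by simp
  then have cg: "continuous_on {0..pi} g" using ug uniformly_continuous_imp_continuous by fastforce
  have gdist: "dist (g a) (g b) \<le> m" if "a \<in> {0..pi}" "b \<in> {0..pi}" for a b
  proof -
    let ?h = "\<lambda>p. g (fst p) - g (snd p)"
    have "norm (?h (a, b)) \<le> m"
    proof (rule continuous_on_closure_norm_le[of "{0<..<pi} \<times> {0<..<pi}" ?h])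
      show "continuous_on (closure ({0<..<pi} \<times> {0<..<pi})) ?h"
        unfolding closure_Times cl
        by (intro continuous_intros continuous_on_compose2[OF cg]) auto
      show "\<forall>y\<in>{0<..<pi} \<times> {0<..<pi}. norm (g (fst y) - g (snd y)) \<le> m"
      proof clarsimp
        fix x y assume xy: "0 < x" "x < pi" "0 < y" "y < pi"
        have "(dist (g x) (g y))\<^sup>2 \<le> \<kappa> * dist x y" using hoel[of x y] g\<sigma> xy by simp
        also have "\<dots> \<le> \<kappa> * pi" using xy \<open>\<kappa> > 0\<close> by (intro mult_left_mono) (auto simp: dist_real_def)
        also have "\<dots> = m\<^sup>2" by (simp add: \<kappa>_def)
        finally show "cmod (g x - g y) \<le> m" using m by (metis dist_norm power2_le_imp_le less_imp_le)
      qed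
      show "(a, b) \<in> closure ({0<..<pi} \<times> {0<..<pi})" using that by (simp add: closure_Times cl)
    qed
    then show ?thesis by (simp add: dist_norm)
  qed
  have endpt: "g t \<in> J" if t: "t = 0 \<or> t = pi" for t
  proof -
    have "t \<in> closure {0<..<pi}" using t cl by auto
    then obtain Y where Y: "\<And>n. Y n \<in> {0<..<pi}" "Y \<longlonglongrightarrow> t"
      unfolding closure_sequential by blast
    have YS: "Complex s (Y n) \<in> S" for n using Y(1)[of n] by (auto simp: S_def)
    have ex: "Complex s t = of_real s + \<i> * of_real t" by (simp add: Complex_eq)
    \<comment> \<open>At both ends of the vertical segment the exponential is real, and the Cayley
      transform sends the real line to the unit circle.\<close>
    have ext: "exp (Complex s t) = of_real (exp s) \<or> exp (Complex s t) = of_real (- exp s)"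
      using t by (auto simp: exp_eq_polar complex_eq_iff)
    have nz: "exp (Complex s t) + \<i> \<noteq> 0" using ext by (auto simp: complex_eq_iff)
    have "g t \<in> frontier (f ` ball 0 1)"
    proof (rule biholomorphic_boundary_limit[OF hol inj, of "\<lambda>n. strip_to_disc (Complex s (Y n))" "strip_to_disc (Complex s t)"])
      show "strip_to_disc (Complex s (Y n)) \<in> ball 0 1" for n using W(3) YS by blast
      show "(\<lambda>n. strip_to_disc (Complex s (Y n))) \<longlonglongrightarrow> strip_to_disc (Complex s t)"
        unfolding strip_to_disc_def using Y(2) nz by (intro tendsto_intros tendsto_Complex) auto
      have "cmod (exp (Complex s t) - \<i>) = cmod (exp (Complex s t) + \<i>)"
        using ext by (auto simp: cmod_def)
      then show "cmod (strip_to_disc (Complex s t)) = 1" using nz by (simp add: strip_to_disc_def norm_divide)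
      have "(\<lambda>n. g (Y n)) \<longlonglongrightarrow> g t"
        using cg Y t unfolding continuous_on_sequentially by (auto simp: less_imp_le o_def)
      moreover have "g (Y n) = f (strip_to_disc (Complex s (Y n)))" for n
        using g\<sigma>[OF Y(1)[of n]] by (simp add: \<sigma>_def F_def)
      ultimately show "(\<lambda>n. f (strip_to_disc (Complex s (Y n)))) \<longlonglongrightarrow> g t" by simp
    qed
    then show ?thesis using img jd(4) by (simp add: D_def J_def)
  qed
  define p where "p = g 0"
  have "dist p (g pi) < \<mu>" using gdist[of 0 pi] m by (simp add: p_def)
  then obtain K1 where K1: "compact K1" "connected K1" "K1 \<subseteq> J" "p \<in> K1" "g pi \<in> K1" "K1 \<subseteq> cball p \<eta>"
    using \<mu>(2)[of p "g pi"] endpt unfolding p_def by blast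
  define K0 where "K0 = g ` {0..pi}"
  have "compact K0" unfolding K0_def using cg by (intro compact_continuous_image) auto
  have K0sub: "K0 \<subseteq> cball p \<eta>"
    unfolding K0_def p_def using order_trans[OF gdist[of 0] m(3)] by auto
  have \<sigma>D: "g y \<in> D" if "y \<in> {0<..<pi}" for y
  proof -
    have "Complex s y \<in> S" using that by (simp add: S_def)
    then show ?thesis using g\<sigma>[OF that] imF by (metis \<sigma>_def imageI)
  qed
  have K0J: "K0 \<inter> J \<subseteq> K1"
  proof
    fix x assume "x \<in> K0 \<inter> J"
    then obtain y where y: "y \<in> {0..pi}" "x = g y" "x \<in> J" by (auto simp: K0_def)
    then have "y \<notin> {0<..<pi}" using \<sigma>D jd(5) by blast
    then have "y = 0 \<or> y = pi" using y(1) by auto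
    then show "x \<in> K1" using K1 y(2) by (auto simp: p_def)
  qed
  define K where "K = K0 \<union> K1"
  have Kc: "compact K" using K1(1) \<open>compact K0\<close> by (simp add: K_def compact_Un)
  have Ksub: "K \<subseteq> cball p \<eta>" using K0sub K1(6) by (simp add: K_def)
  have KJ: "K \<inter> J = K1" using K0J K1(3) by (auto simp: K_def)
  have far0: "dist p (f 0) > \<eta>"
  proof -
    have "p \<notin> D" using endpt[of 0] jd(5) by (auto simp: p_def)
    then have "p \<notin> ball (f 0) r0" using r0 by auto
    then show ?thesis using r0(1) by (simp add: \<eta>_def dist_commute)
  qed
  have side: "dist p (F u) \<le> \<eta>" if u: "u \<in> S" "Re u > s" for u
  proof (rule ccontr)
    assume "\<not> ?thesis"
    then have far: "dist p (F u) > \<eta>" by simp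
    have "connected_component (- (K \<union> J)) (F u) (f 0)"
    proof (rule Janiszewski[OF Kc jd(6)])
      show "connected (K \<inter> J)" using KJ K1 by simp
      have "connected (- cball p \<eta>)" by (intro connected_complement_bounded_convex) auto
      moreover have "F u \<in> - cball p \<eta>" "f 0 \<in> - cball p \<eta>" using far far0 by auto
      ultimately show "connected_component (- K) (F u) (f 0)"
        using Ksub by (intro connected_component_of_subset[of "- cball p \<eta>" _ _ "- K"])
          (auto simp: connected_iff_connected_component)
      have "F u \<in> D" using u imF by blast
      then show "connected_component (- J) (F u) (f 0)"
        using jd(2,5) b0D by (intro connected_component_of_subset[of D _ _ "- J"])
          (auto simp: connected_iff_connected_component)
    qed
    then obtain C where C: "connected C" "C \<subseteq> - (K \<union> J)" "F u \<in> C" "f 0 \<in> C"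
      unfolding connected_component_def by blast
    have "C \<subseteq> D"
    proof (rule ccontr)
      assume "\<not> C \<subseteq> D"
      then have "C \<inter> frontier D \<noteq> {}" using C b0D by (intro connected_Int_frontier) auto
      then show False using C(2) jd(4) by auto
    qed
    \<comment> \<open>The cross-cut splits \<open>D\<close> into the images of the two half-strips;
      the connected set \<open>C\<close> avoids the cross-cut but meets both.\<close>
    let ?A = "F ` {v\<in>S. Re v > s}" and ?B = "F ` {v\<in>S. Re v < s}"
    have oA: "open {v\<in>S. Re v > s}" "open {v\<in>S. Re v < s}"
      using openS by (auto simp: Collect_conj_eq open_Int open_halfspace_Re_gt open_halfspace_Re_lt)
    have "open ?A" "open ?B"
      by (rule open_mapping_thm3[OF holomorphic_on_subset[OF holF] oA(1) inj_on_subset[OF injF]]; blast)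
         (rule open_mapping_thm3[OF holomorphic_on_subset[OF holF] oA(2) inj_on_subset[OF injF]]; blast)
    moreover have "C \<subseteq> ?A \<union> ?B"
    proof
      fix x assume "x \<in> C"
      then obtain v where v: "v \<in> S" "x = F v" using \<open>C \<subseteq> D\<close> imF by auto
      have "Re v \<noteq> s"
      proof
        assume "Re v = s"
        then have "v = Complex s (Im v)" by (simp add: complex_eq_iff)
        then have "x = g (Im v)" using g\<sigma>[of "Im v"] v by (auto simp: \<sigma>_def S_def)
        then have "x \<in> K" using v(1) by (auto simp: K_def K0_def S_def)
        then show False using \<open>x \<in> C\<close> C(2) by auto
      qed
      then show "x \<in> ?A \<union> ?B" using v by auto (metis (mono_tags, lifting) image_eqI linorder_neqE_linordered_idom mem_Collect_eq)
    qed
    moreover have "?A \<inter> ?B \<inter> C = {}"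
    proof -
      have "F v \<noteq> F w" if "v \<in> S" "w \<in> S" "Re v > s" "Re w < s" for v w
        using inj_onD[OF injF _ that(1,2)] that(3,4) by auto
      then show ?thesis by blast
    qed
    moreover have "?A \<inter> C \<noteq> {}" using u C(3) by blast
    moreover have "f 0 \<in> ?B"
    proof -
      let ?v = "Complex 0 (pi/2)"
      have "exp ?v = \<i>" by (simp add: exp_eq_polar complex_eq_iff)
      then have "strip_to_disc ?v = 0" by (simp add: strip_to_disc_def)
      moreover have "?v \<in> S" by (simp add: S_def)
      ultimately show ?thesis using s by (intro image_eqI[of _ _ ?v]) (auto simp: F_def)
    qed
    ultimately show False using connectedD[OF C(1), of ?A ?B] C(4) by blast
  qed
  have sd: "dist p (f z) \<le> \<eta>" if "z \<in> ball 0 1" "dist 1 z < min 1 (exp (- s))" for z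
    using W(4)[OF that] side by (auto simp: F_def)
  show ?thesis
  proof (rule that[of "min 1 (exp (- s))"])
    fix z z' :: complex
    assume z: "z \<in> ball 0 1" "z' \<in> ball 0 1" "dist 1 z < min 1 (exp (- s))" "dist 1 z' < min 1 (exp (- s))"
    have "dist p (f z) \<le> \<eta>" by (rule sd[OF z(1,3)])
    moreover have "dist p (f z') \<le> \<eta>" by (rule sd[OF z(2,4)])
    moreover have "\<eta> \<le> \<epsilon> / 4" by (simp add: \<eta>_def)
    moreover have "dist (f z) (f z') \<le> dist p (f z) + dist p (f z')" by (rule dist_triangle3)
    ultimately show "dist (f z) (f z') \<le> \<epsilon>" using \<open>\<epsilon> > 0\<close> by linarith
  qed simp
qed

text \<open>The product of \<open>f - p\<close> over finitely many rotations vanishes on the whole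
  circle once the rotated arcs cover it. By the maximum modulus principle it vanishes at 0, where it
  is a power of \<open>f 0 - p\<close>.\<close>

lemma holomorphic_constant_on_boundary_arc:
  fixes f :: "complex \<Rightarrow> complex"
  assumes cont: "continuous_on (cball 0 1) f" and hol: "f holomorphic_on ball 0 1"
    and "a < b" and arc: "\<And>t. a < t \<Longrightarrow> t < b \<Longrightarrow> f (cis t) = p"
  shows "f 0 = p"
proof -
  obtain N :: nat where N: "2 * pi / (b - a) < real N" using reals_Archimedean2 by blast
  have "N > 0" using N \<open>a < b\<close> by (auto intro!: gr0I simp: divide_less_0_iff)
  \<comment> \<open>A rotation step shorter than the arc, so that no point of the circle can jump
    over the arc.\<close>
  define \<delta> where "\<delta> = 2 * pi / real N"
  have \<delta>: "\<delta> > 0" "\<delta> < b - a" using N \<open>a < b\<close> \<open>N > 0\<close> by (auto simp: \<delta>_def field_simps)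
  define h where "h = (\<lambda>z. \<Prod>k<N. f (z * cis (\<delta> * real k)) - p)"
  have "norm (h 0) \<le> 0"
  proof (rule maximum_modulus_frontier[of h "ball 0 1"])
    show "h holomorphic_on interior (ball 0 1)"
      unfolding h_def interior_ball
      by (intro holomorphic_intros holomorphic_on_compose_gen[OF _ hol, unfolded o_def])
         (auto simp: norm_mult intro!: holomorphic_intros)
    show "continuous_on (closure (ball 0 1)) h"
      unfolding h_def by (intro continuous_intros continuous_on_compose2[OF cont]) (auto simp: norm_mult)
    fix z :: complex assume "z \<in> frontier (ball 0 1)"
    then have "cmod z = 1" by simp
    then have z: "z = cis (Arg z)" using cis_Arg[of z] by (metis div_by_1 norm_zero of_real_1 sgn_eq zero_neq_one)
    \<comment> \<open>The first multiple of \<open>\<delta>\<close> that carries the argument of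
      \<open>z\<close> past \<open>a\<close>; it lands before \<open>b\<close>. Reducing it modulo
      \<open>N\<close> gives the index of a vanishing factor.\<close>
    define j where "j = \<lfloor>(a - Arg z) / \<delta>\<rfloor> + 1"
    have "(a - Arg z) / \<delta> < of_int j" "of_int j \<le> (a - Arg z) / \<delta> + 1" unfolding j_def by linarith+
    then have j: "a < Arg z + \<delta> * of_int j" "Arg z + \<delta> * of_int j \<le> a + \<delta>"
      using \<delta>(1) by (auto simp: field_simps)
    define k where "k = nat (j mod int N)"
    have k: "k < N" using \<open>N > 0\<close> by (simp add: k_def nat_less_iff)
    have "j = int N * (j div int N) + int k" using \<open>N > 0\<close> by (simp add: k_def)
    then have "real_of_int j = real N * of_int (j div int N) + real k"
      by (metis of_int_add of_int_mult of_int_of_nat_eq)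
    then have "\<delta> * of_int j = 2 * pi * of_int (j div int N) + \<delta> * real k"
      using \<open>N > 0\<close> by (simp add: \<delta>_def field_simps)
    then have "cis (\<delta> * of_int j) = cis (\<delta> * real k)"
      by (simp add: cis_mult[symmetric] cis_multiple_2pi)
    then have "z * cis (\<delta> * real k) = cis (Arg z + \<delta> * of_int j)" using z by (metis cis_mult)
    then have "f (z * cis (\<delta> * real k)) = p" using arc j \<delta> by simp
    then have "h z = 0" unfolding h_def using k by (intro prod_zero) auto
    then show "norm (h z) \<le> 0" by simp
  qed auto
  then have "(f 0 - p) ^ N = 0" by (simp add: h_def)
  then show ?thesis by simp
qed

text \<open>The oscillation estimate at boundary points, continuity inside and compactness give
  uniform continuity on the open disc, hence the extension. For injectivity on the circle, suppose
  that two points have the same image p. The radii ending there map to a Jordan curve that lies in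
  \<open>D\<close> except for p. One of the two sectors between the radii is mapped inside this
  curve, so its boundary arc can only go to p; then \<open>g\<close> takes the value p at 0 as well,
  although p is not in \<open>D\<close>.\<close>

theorem Caratheodory_extension:
  fixes f :: "complex \<Rightarrow> complex"
  assumes c: "simple_path c" "pathfinish c = pathstart c"
    and hol: "f holomorphic_on ball 0 1" and inj: "inj_on f (ball 0 1)"
    and img: "f ` ball 0 1 = inside (path_image c)"
  obtains g where "continuous_on (cball 0 1) g" "inj_on g (cball 0 1)"
    "\<And>z. z \<in> ball 0 1 \<Longrightarrow> g z = f z" "g ` sphere 0 1 = path_image c"
proof -
  define J where "J = path_image c"
  define D where "D = inside J"
  have jd: "open D" "connected D" "bounded D" "frontier D = J" "D \<inter> J = {}" "closed J"
     "frontier (outside J) = J" "connected (outside J)" "\<not> bounded (outside J)" "D \<inter> outside J = {}"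
     "D \<union> outside J = - J"
    using Jordan_inside_outside[OF c] closed_simple_path_image[OF c(1)] inside_no_overlap[of J]
    by (auto simp: D_def J_def)
  have imD: "f ` ball 0 1 = D" using img by (simp add: D_def J_def)
  \<comment> \<open>The estimate at 1, transported by the rotation that takes 1 to
    \<open>\<zeta>\<close>.\<close>
  have bd: "\<exists>\<delta>>0. \<forall>z\<in>ball 0 1. \<forall>z'\<in>ball 0 1. dist \<zeta> z < \<delta> \<longrightarrow> dist \<zeta> z' < \<delta> \<longrightarrow> dist (f z) (f z') \<le> e"
    if "cmod \<zeta> = 1" "e > 0" for \<zeta> e
  proof -
    have rot: "(\<lambda>z. \<zeta> * z) ` ball 0 1 = ball 0 1"
    proof -
      have "z \<in> (\<lambda>z. \<zeta> * z) ` ball 0 1" if z: "z \<in> ball 0 1" for z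
        using z \<open>cmod \<zeta> = 1\<close> by (intro image_eqI[of _ _ "z / \<zeta>"]) (auto simp: norm_divide)
      then show ?thesis using \<open>cmod \<zeta> = 1\<close> by (auto simp: norm_mult)
    qed
    obtain \<delta> where \<delta>: "\<delta> > 0" "\<And>z z'. \<lbrakk>z \<in> ball 0 1; z' \<in> ball 0 1; dist 1 z < \<delta>; dist 1 z' < \<delta>\<rbrakk> \<Longrightarrow>
         dist (f (\<zeta> * z)) (f (\<zeta> * z')) \<le> e"
    proof (rule Caratheodory_cluster_at_1[OF c, of "\<lambda>z. f (\<zeta> * z)" e])
      show "(\<lambda>z. f (\<zeta> * z)) holomorphic_on ball 0 1"
        using holomorphic_on_compose_gen[of "\<lambda>z. \<zeta> * z" "ball 0 1" f "ball 0 1"] hol rot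
        by (auto simp: o_def intro!: holomorphic_intros)
      show "inj_on (\<lambda>z. f (\<zeta> * z)) (ball 0 1)"
      proof (rule inj_onI)
        fix x y assume xy: "x \<in> ball 0 1" "y \<in> ball 0 1" "f (\<zeta> * x) = f (\<zeta> * y)"
        moreover have "\<zeta> * x \<in> ball 0 1" "\<zeta> * y \<in> ball 0 1" using xy(1,2) rot by blast+
        ultimately have "\<zeta> * x = \<zeta> * y" using inj by (metis inj_onD)
        then show "x = y" using \<open>cmod \<zeta> = 1\<close> by auto
      qed
      show "(\<lambda>z. f (\<zeta> * z)) ` ball 0 1 = inside (path_image c)"
        using img rot by (metis image_image)
    qed (use \<open>e > 0\<close> in auto)
    have *: "\<exists>w\<in>ball 0 1. dist 1 w = dist \<zeta> z \<and> \<zeta> * w = z" if "z \<in> ball 0 1" for z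
    proof -
      obtain w where w: "w \<in> ball 0 1" "z = \<zeta> * w" using \<open>z \<in> ball 0 1\<close> rot by blast
      have "\<zeta> - \<zeta> * w = \<zeta> * (1 - w)" by (simp add: algebra_simps)
      then have "dist 1 w = dist \<zeta> z" using w(2) \<open>cmod \<zeta> = 1\<close> by (simp add: dist_norm norm_mult)
      then show ?thesis using w by auto
    qed
    show ?thesis using \<delta> * by metis
  qed
  have loc: "\<exists>\<delta>>0. \<forall>z\<in>ball 0 1. \<forall>z'\<in>ball 0 1. dist \<zeta> z < \<delta> \<longrightarrow> dist \<zeta> z' < \<delta> \<longrightarrow> dist (f z) (f z') \<le> e"
    if "\<zeta> \<in> cball 0 1" "e > 0" for \<zeta> e
  proof (cases "cmod \<zeta> = 1")
    case True then show ?thesis using bd that by blast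
  next
    case False
    then have "\<zeta> \<in> ball 0 1" using that by auto
    then have "isCont f \<zeta>"
      using hol by (metis continuous_on_eq_continuous_at holomorphic_on_imp_continuous_on open_ball)
    then obtain \<delta> where \<delta>: "\<delta> > 0" "\<And>z. dist z \<zeta> < \<delta> \<Longrightarrow> dist (f z) (f \<zeta>) < e / 2"
      using \<open>e > 0\<close> unfolding continuous_at_eps_delta by (metis half_gt_zero)
    have "dist (f z) (f z') \<le> e" if "dist \<zeta> z < \<delta>" "dist \<zeta> z' < \<delta>" for z z'
      using \<delta>(2)[of z] \<delta>(2)[of z'] that dist_triangle2[of "f z" "f z'" "f \<zeta>"] by (simp add: dist_commute)
    then show ?thesis using \<delta>(1) by blast
  qed
  have "uniformly_continuous_on (ball 0 1) f"
    unfolding uniformly_continuous_on_def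
  proof (intro allI impI)
    fix e :: real assume "e > 0"
    then have "\<forall>\<zeta>\<in>cball 0 1. \<exists>\<delta>>0. \<forall>z\<in>ball 0 1. \<forall>z'\<in>ball 0 1. dist \<zeta> z < \<delta> \<longrightarrow> dist \<zeta> z' < \<delta> \<longrightarrow> dist (f z) (f z') \<le> e / 2"
      using loc[of _ "e/2"] by simp
    then obtain \<delta> where \<delta>: "\<And>\<zeta>. \<zeta> \<in> cball 0 1 \<Longrightarrow> \<delta> \<zeta> > 0"
      "\<And>\<zeta> z z'. \<lbrakk>\<zeta> \<in> cball 0 1; z \<in> ball 0 1; z' \<in> ball 0 1; dist \<zeta> z < \<delta> \<zeta>; dist \<zeta> z' < \<delta> \<zeta>\<rbrakk> \<Longrightarrow> dist (f z) (f z') \<le> e / 2"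
      by metis
    \<comment> \<open>A Lebesgue number for the cover of the closed disc by balls on which
      \<open>f\<close> oscillates by at most e/2.\<close>
    obtain r where r: "r > 0" "\<And>x. x \<in> cball 0 1 \<Longrightarrow> \<exists>G\<in>(\<lambda>\<zeta>. ball \<zeta> (\<delta> \<zeta>)) ` cball 0 1. ball x r \<subseteq> G"
      by (rule Heine_Borel_lemma[of "cball (0::complex) 1" "(\<lambda>\<zeta>. ball \<zeta> (\<delta> \<zeta>)) ` cball 0 1"])
         (use \<delta>(1) in force)+
    show "\<exists>d>0. \<forall>x\<in>ball 0 1. \<forall>x'\<in>ball 0 1. dist x' x < d \<longrightarrow> dist (f x') (f x) < e"
    proof (intro exI[of _ r] conjI ballI impI)
      fix x x' :: complex assume x: "x \<in> ball 0 1" "x' \<in> ball 0 1" "dist x' x < r"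
      obtain \<zeta> where \<zeta>: "\<zeta> \<in> cball 0 1" "ball x r \<subseteq> ball \<zeta> (\<delta> \<zeta>)" using r(2)[of x] x(1) by auto
      have "x \<in> ball x r" "x' \<in> ball x r" using x(3) r(1) by (auto simp: dist_commute)
      then have "dist (f x') (f x) \<le> e / 2" using \<delta>(2)[OF \<zeta>(1) x(2,1)] \<zeta>(2) by (metis mem_ball subsetD)
      then show "dist (f x') (f x) < e" using \<open>e > 0\<close> by simp
    qed (use r in auto)
  qed
  then obtain g where ug: "uniformly_continuous_on (closure (ball 0 1)) g"
    and fg: "\<And>z. z \<in> ball 0 1 \<Longrightarrow> f z = g z"
    using uniformly_continuous_on_extension_on_closure by metis
  have cg: "continuous_on (cball 0 1) g" using ug uniformly_continuous_imp_continuous by fastforce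
  have gball: "g ` ball 0 1 = D" using imD fg by (metis (no_types, lifting) image_cong)
  have gJ: "g \<zeta> \<in> J" if z: "cmod \<zeta> = 1" for \<zeta>
  proof -
    have "\<zeta> \<in> closure (ball 0 1)" using z by simp
    then obtain X where X: "\<And>n. X n \<in> ball 0 1" "X \<longlonglongrightarrow> \<zeta>"
      unfolding closure_sequential by blast
    have "(\<lambda>n. g (X n)) \<longlonglongrightarrow> g \<zeta>"
      using cg X z unfolding continuous_on_sequentially by (auto simp: less_imp_le o_def)
    then have "(\<lambda>n. f (X n)) \<longlonglongrightarrow> g \<zeta>" using fg X by simp
    then show ?thesis
      using biholomorphic_boundary_limit[OF hol inj X(1) X(2) z] imD jd(4) by simp
  qed
  have "J \<subseteq> g ` sphere 0 1"
  proof
    fix x assume "x \<in> J"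
    then have "x \<in> closure D" using jd(4) by (auto simp: frontier_def)
    moreover have "closure D \<subseteq> g ` cball 0 1"
      using gball compact_continuous_image[OF cg] by (intro closure_minimal) (auto intro: compact_imp_closed)
    ultimately obtain z where z: "z \<in> cball 0 1" "x = g z" by blast
    have "z \<notin> ball 0 1" using z(2) \<open>x \<in> J\<close> gball jd(5) by blast
    then show "x \<in> g ` sphere 0 1" using z by (auto intro!: image_eqI[of _ _ z])
  qed
  then have gsph: "g ` sphere 0 1 = J" using gJ by auto
  have injb: "inj_on g (ball 0 1)" using inj fg by (metis (no_types, lifting) inj_on_cong)
  have bdry: "\<zeta>1 = \<zeta>2" if z: "cmod \<zeta>1 = 1" "cmod \<zeta>2 = 1" "g \<zeta>1 = g \<zeta>2" for \<zeta>1 \<zeta>2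
  proof (rule ccontr)
    assume ne: "\<zeta>1 \<noteq> \<zeta>2"
    define p where "p = g \<zeta>1"
    define q where "q = linepath \<zeta>1 0 +++ linepath 0 \<zeta>2"
    have z0: "\<zeta>1 \<noteq> 0" "\<zeta>2 \<noteq> 0" using z by auto
    have seg: "closed_segment \<zeta>1 0 \<inter> closed_segment 0 \<zeta>2 \<subseteq> {0}"
    proof
      fix x assume "x \<in> closed_segment \<zeta>1 0 \<inter> closed_segment 0 \<zeta>2"
      then obtain s t where st: "0 \<le> s" "s \<le> 1" "0 \<le> t" "t \<le> 1" "x = (1 - s) *\<^sub>R \<zeta>1" "x = t *\<^sub>R \<zeta>2"
        by (auto simp: in_segment)
      have "cmod x = 1 - s" unfolding st(5) using st(1,2) z by simp
      moreover have "cmod x = t" unfolding st(6) using st(3,4) z by simp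
      ultimately have "1 - s = t" by simp
      then show "x \<in> {0}" using st(5,6) ne by auto
    qed
    have arcq: "arc q" unfolding q_def using z0 seg by (intro arc_join) auto
    have qs: "pathstart q = \<zeta>1" "pathfinish q = \<zeta>2" by (auto simp: q_def)
    have qim: "path_image q = closed_segment \<zeta>1 0 \<union> closed_segment 0 \<zeta>2"
      by (simp add: q_def path_image_join)
    have qball: "path_image q - {\<zeta>1, \<zeta>2} \<subseteq> ball 0 1"
    proof
      fix x assume x: "x \<in> path_image q - {\<zeta>1, \<zeta>2}"
      then consider s where "0 \<le> s" "s \<le> 1" "x = (1 - s) *\<^sub>R \<zeta>1" | s where "0 \<le> s" "s \<le> 1" "x = s *\<^sub>R \<zeta>2"
        unfolding qim by (auto simp: in_segment)
      then show "x \<in> ball 0 1"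
      proof cases
        case 1
        then have "s \<noteq> 0" using x by auto
        then show ?thesis using 1 z by simp
      next
        case 2
        then have "s \<noteq> 1" using x by auto
        then show ?thesis using 2 z by simp
      qed
    qed
    have q01: "q x \<in> ball 0 1" if "x \<in> {0<..<1}" for x
    proof -
      have "inj_on q {0..1}" using arcq by (simp add: arc_def)
      then have "q x \<noteq> q 0" "q x \<noteq> q 1" using that by (auto dest: inj_onD[of q _ x])
      then have "q x \<in> path_image q - {\<zeta>1, \<zeta>2}" using qs that by (auto simp: path_image_def pathstart_def pathfinish_def)
      then show ?thesis using qball by blast
    qed
    have qc: "path_image q \<subseteq> cball 0 1" using qball z by auto
    define \<gamma> where "\<gamma> = g \<circ> q"
    have path\<gamma>: "path \<gamma>" unfolding \<gamma>_def using arcq cg qc by (intro path_continuous_image) (auto simp: arc_imp_path intro: continuous_on_subset)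
    have loop\<gamma>: "pathfinish \<gamma> = pathstart \<gamma>" using qs z by (simp add: \<gamma>_def pathfinish_compose pathstart_compose)
    \<comment> \<open>Inner points of \<open>q\<close> go to \<open>D\<close>, where
      \<open>g\<close> is injective, while the two ends share an image on the curve
      \<open>J\<close>.\<close>
    have "simple_path \<gamma>"
      unfolding simple_path_def loop_free_def
    proof (intro conjI path\<gamma> ballI impI)
      fix x y :: real assume xy: "x \<in> {0..1}" "y \<in> {0..1}" "\<gamma> x = \<gamma> y"
      show "x = y \<or> x = 0 \<and> y = 1 \<or> x = 1 \<and> y = 0"
      proof (cases "x \<in> {0<..<1} \<or> y \<in> {0<..<1}")
        case True
        have gl: "g u \<in> J" if "u \<in> cball 0 1" "u \<notin> ball 0 1" for u using gJ[of u] that by auto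
        have "q x \<in> cball 0 1" "q y \<in> cball 0 1" using qc xy unfolding path_image_def by blast+
        moreover have "g (q x) = g (q y)" using xy by (simp add: \<gamma>_def)
        moreover have "g (q x) \<in> D \<or> g (q y) \<in> D" using True q01 gball by blast
        ultimately have "q x \<in> ball 0 1" "q y \<in> ball 0 1" using gl jd(5) by (metis disjoint_iff)+
        then have "q x = q y" using injb xy(3) by (auto simp: \<gamma>_def dest: inj_onD)
        then show ?thesis using arcq xy by (auto simp: arc_def inj_on_def)
      next
        case False
        then show ?thesis using xy by auto
      qed
    qed
    define \<Gamma> where "\<Gamma> = path_image \<gamma>"
    have J\<Gamma>: "inside \<Gamma> \<noteq> {}" "open (inside \<Gamma>)" "frontier (inside \<Gamma>) = \<Gamma>" "inside \<Gamma> \<inter> \<Gamma> = {}"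
       "inside \<Gamma> \<inter> outside \<Gamma> = {}"
      using Jordan_inside_outside[OF \<open>simple_path \<gamma>\<close> loop\<gamma>] inside_no_overlap[of \<Gamma>] by (auto simp: \<Gamma>_def)
    have \<Gamma>q: "\<Gamma> = g ` path_image q" by (simp add: \<Gamma>_def \<gamma>_def path_image_compose)
    have \<Gamma>sub: "\<Gamma> \<subseteq> D \<union> {p}"
    proof
      fix x assume "x \<in> \<Gamma>"
      then obtain u where u: "u \<in> path_image q" "x = g u" by (auto simp: \<Gamma>q)
      then show "x \<in> D \<union> {p}" using qball gball z(3) by (cases "u = \<zeta>1 \<or> u = \<zeta>2") (auto simp: p_def)
    qed
    have pJ: "p \<in> J" using gJ z by (simp add: p_def)
    \<comment> \<open>Since \<open>\<Gamma>\<close> misses the connected unbounded set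
      \<open>outside J\<close>, that set lies outside \<open>\<Gamma>\<close>. The open set
      \<open>inside \<Gamma>\<close> therefore misses \<open>outside J\<close> and also its closure,
      which contains \<open>J\<close>; only \<open>D\<close> is left.\<close>
    have "\<Gamma> \<inter> outside J = {}" using \<Gamma>sub pJ jd(10,11) by blast
    then have "outside J \<subseteq> outside \<Gamma>"
    proof -
      assume disj: "\<Gamma> \<inter> outside J = {}"
      have "\<not> bounded (connected_component_set (- \<Gamma>) x)" if "x \<in> outside J" for x
        using connected_component_maximal[of x "outside J" "- \<Gamma>"] that disj jd(8,9) bounded_subset by blast
      then show ?thesis using disj unfolding outside_def[of \<Gamma>] by blast
    qed
    then have "inside \<Gamma> \<inter> outside J = {}" using J\<Gamma>(5) by blast
    moreover have "inside \<Gamma> \<inter> J = {}"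
    proof -
      have "inside \<Gamma> \<inter> closure (outside J) = {}"
        using calculation J\<Gamma>(2) by (simp add: open_Int_closure_eq_empty)
      then show ?thesis using jd(7) by (auto simp: frontier_def)
    qed
    ultimately have inD: "inside \<Gamma> \<subseteq> D" using jd(11) by blast
    define \<alpha> where "\<alpha> = Arg2pi (\<zeta>2 / \<zeta>1)"
    have z21: "\<zeta>2 = \<zeta>1 * cis \<alpha>"
      using Arg2pi[of "\<zeta>2 / \<zeta>1"] z z0 by (simp add: \<alpha>_def norm_divide is_Arg_def cis_conv_exp field_simps)
    have \<alpha>: "0 < \<alpha>" "\<alpha> < 2 * pi"
    proof -
      have "\<alpha> \<noteq> 0" using z21 ne by auto
      then show "0 < \<alpha>" "\<alpha> < 2 * pi" using Arg2pi_ge_0[of "\<zeta>2 / \<zeta>1"] Arg2pi_lt_2pi[of "\<zeta>2 / \<zeta>1"] by (auto simp: \<alpha>_def)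
    qed
    \<comment> \<open>The open sector of the disc with angles between \<open>a\<close> and
      \<open>b\<close>, measured from \<open>\<zeta>1\<close>.\<close>
    define E where "E = (\<lambda>a b. (\<lambda>(r, t). of_real r * \<zeta>1 * cis t) ` ({0<..<1::real} \<times> {a<..<b::real}))"
    have Eball: "E a b \<subseteq> ball 0 1" for a b using z by (auto simp: E_def norm_mult)
    have connE: "connected (E a b)" for a b
      unfolding E_def case_prod_unfold
      by (intro connected_continuous_image continuous_intros convex_connected convex_Times) auto
    have Eq: "E a b \<inter> path_image q = {}" if ab: "(a, b) = (0, \<alpha>) \<or> (a, b) = (\<alpha>, 2 * pi)" for a b
    proof (rule ccontr)
      assume "E a b \<inter> path_image q \<noteq> {}"
      then obtain r t where rt: "0 < r" "r < 1" "a < t" "t < b" "of_real r * \<zeta>1 * cis t \<in> path_image q"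
        by (auto simp: E_def)
      then obtain s \<tau> where s: "0 \<le> s" "of_real r * \<zeta>1 * cis t = of_real s * \<zeta>1 * cis \<tau>" "\<tau> = 0 \<or> \<tau> = \<alpha>"
      proof -
        from rt(5) consider s where "0 \<le> s" "s \<le> 1" "of_real r * \<zeta>1 * cis t = (1 - s) *\<^sub>R \<zeta>1" | s where "0 \<le> s" "s \<le> 1" "of_real r * \<zeta>1 * cis t = s *\<^sub>R \<zeta>2"
          unfolding qim by (auto simp: in_segment)
        then show thesis
        proof cases
          case 1 then show thesis using that[of "1 - s" 0] by (simp add: scaleR_conv_of_real)
        next
          case 2 then show thesis using that[of s \<alpha>] z21 by (simp add: scaleR_conv_of_real mult.assoc)
        qed
      qed
      have "r = s" using arg_cong[OF s(2), of cmod] z rt(1) s(1) by (simp add: norm_mult)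
      then have "cis t = cis \<tau>" using s(2) z0 rt(1) by simp
      then obtain n :: int where n: "t = \<tau> + 2 * pi * of_int n" 
      proof -
        have "exp (\<i> * complex_of_real t) = exp (\<i> * complex_of_real \<tau>)" using \<open>cis t = cis \<tau>\<close> by (simp add: cis_conv_exp)
        then obtain n :: int where "\<i> * complex_of_real t = \<i> * complex_of_real \<tau> + (of_int (2 * n) * pi) * \<i>"
          unfolding exp_eq by blast
        then have "t = \<tau> + 2 * pi * of_int n" by (simp add: complex_eq_iff)
        then show thesis using that by blast
      qed
      have "\<bar>t - \<tau>\<bar> < 2 * pi" "t \<noteq> \<tau>" using rt ab s(3) \<alpha> by auto
      then have "\<bar>of_int n :: real\<bar> < 1" using n pi_gt_zero by (simp add: abs_mult)
      then have "n = 0" by linarith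
      then show False using n \<open>t \<noteq> \<tau>\<close> by simp
    qed
    \<comment> \<open>A point inside \<open>\<Gamma>\<close> selects the sector: its preimage
      \<open>w\<close> lies off both radii.\<close>
    obtain x where x: "x \<in> inside \<Gamma>" using J\<Gamma>(1) by blast
    then obtain w where w: "w \<in> ball 0 1" "x = g w" using inD gball by blast
    have "w \<notin> path_image q" using w(2) x J\<Gamma>(4) unfolding \<Gamma>q by blast
    then have "w \<noteq> 0" unfolding qim by auto
    define t where "t = Arg2pi (w / \<zeta>1)"
    have wt: "of_real (cmod w) * \<zeta>1 * cis t = w"
      using Arg2pi[of "w / \<zeta>1"] z z0 by (simp add: t_def norm_divide is_Arg_def cis_conv_exp field_simps)
    have t02: "0 \<le> t" "t < 2 * pi" using Arg2pi_ge_0 Arg2pi_lt_2pi by (auto simp: t_def)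
    have "t \<noteq> 0"
    proof
      assume "t = 0"
      then have "w = (1 - (1 - cmod w)) *\<^sub>R \<zeta>1 + (1 - cmod w) *\<^sub>R 0" using wt by (simp add: scaleR_conv_of_real)
      moreover have "0 \<le> 1 - cmod w" "1 - cmod w \<le> 1" using w(1) by auto
      ultimately have "w \<in> closed_segment \<zeta>1 0" unfolding in_segment by blast
      then show False using \<open>w \<notin> path_image q\<close> qim by blast
    qed
    moreover have "t \<noteq> \<alpha>"
    proof
      assume "t = \<alpha>"
      then have "w = (1 - cmod w) *\<^sub>R 0 + cmod w *\<^sub>R \<zeta>2" using wt z21 by (simp add: scaleR_conv_of_real mult.assoc)
      moreover have "0 \<le> cmod w" "cmod w \<le> 1" using w(1) by auto
      ultimately have "w \<in> closed_segment 0 \<zeta>2" unfolding in_segment by blast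
      then show False using \<open>w \<notin> path_image q\<close> qim by blast
    qed
    ultimately obtain a b where ab: "(a, b) = (0, \<alpha>) \<or> (a, b) = (\<alpha>, 2 * pi)" "a < t" "t < b"
      using t02 by (metis linorder_neqE_linordered_idom order_le_less)
    have "a < b" using ab by simp
    have "w \<in> E a b" unfolding E_def using wt ab w(1) \<open>w \<noteq> 0\<close> by (intro image_eqI[of _ _ "(cmod w, t)"]) auto
    have gE\<Gamma>: "g ` E a b \<inter> \<Gamma> = {}"
    proof (rule ccontr)
      assume "g ` E a b \<inter> \<Gamma> \<noteq> {}"
      then obtain u v where uv: "u \<in> E a b" "v \<in> path_image q" "g u = g v" by (auto simp: \<Gamma>q)
      have "g u \<in> D" using uv(1) Eball gball by blast
      have "v \<in> ball 0 1"
      proof (rule ccontr)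
        assume "v \<notin> ball 0 1"
        then have "g v \<in> J" using gJ qc uv(2) by fastforce
        then show False using \<open>g u \<in> D\<close> uv(3) jd(5) by auto
      qed
      then have "u = v" using injb uv Eball by (meson inj_onD subsetD)
      then show False using Eq[OF ab(1)] uv by blast
    qed
    have Ecb: "E a b \<subseteq> cball 0 1" using Eball ball_subset_cball by (rule order_trans)
    have gEc: "connected (g ` E a b)"
      by (rule connected_continuous_image[OF continuous_on_subset[OF cg Ecb] connE])
    have gE: "g ` E a b \<subseteq> inside \<Gamma>"
    proof (rule ccontr)
      assume "\<not> ?thesis"
      then have "g ` E a b - inside \<Gamma> \<noteq> {}" by blast
      moreover have "g ` E a b \<inter> inside \<Gamma> \<noteq> {}" using x w(2) \<open>w \<in> E a b\<close> by blast
      ultimately have "g ` E a b \<inter> frontier (inside \<Gamma>) \<noteq> {}" by (intro connected_Int_frontier gEc)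
      then show False using gE\<Gamma> J\<Gamma>(3) by simp
    qed
    \<comment> \<open>Boundary values on the arc are limits of the image of the sector, so they lie
      in \<open>inside \<Gamma> \<union> \<Gamma>\<close>; they also lie on \<open>J\<close>. These
      two sets share only \<open>p\<close>.\<close>
    have con: "g (\<zeta>1 * cis \<tau>) = p" if \<tau>: "a < \<tau>" "\<tau> < b" for \<tau>
    proof -
      have "\<zeta>1 * cis \<tau> \<in> closure (E a b)"
        unfolding closure_sequential
      proof (intro exI[of _ "\<lambda>n. of_real (1 - 1 / (real n + 2)) * \<zeta>1 * cis \<tau>"] conjI allI)
        show "of_real (1 - 1 / (real n + 2)) * \<zeta>1 * cis \<tau> \<in> E a b" for n
          unfolding E_def using \<tau> by (intro image_eqI[of _ _ "(1 - 1 / (real n + 2), \<tau>)"]) (auto simp: field_simps)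
        have "(\<lambda>n. 1 - 1 / (real n + 2)) \<longlonglongrightarrow> 1" by real_asymp
        then have "(\<lambda>n. of_real (1 - 1 / (real n + 2)) * (\<zeta>1 * cis \<tau>)) \<longlonglongrightarrow> of_real 1 * (\<zeta>1 * cis \<tau>)"
          by (intro tendsto_intros)
        then show "(\<lambda>n. of_real (1 - 1 / (real n + 2)) * \<zeta>1 * cis \<tau>) \<longlonglongrightarrow> \<zeta>1 * cis \<tau>"
          by (simp add: mult.assoc)
      qed
      moreover have "closure (E a b) \<subseteq> cball 0 1" using Ecb by (intro closure_minimal) auto
      ultimately have "g (\<zeta>1 * cis \<tau>) \<in> closure (g ` E a b)"
        using image_closure_subset[of "E a b" g "closure (g ` E a b)"] cg closure_subset
        by (metis closed_closure continuous_on_subset imageI subsetD)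
      also have "\<dots> \<subseteq> closure (inside \<Gamma>)" using gE by (rule closure_mono)
      also have "\<dots> \<subseteq> inside \<Gamma> \<union> \<Gamma>" using J\<Gamma>(3) closure_Un_frontier by blast
      also have "\<dots> \<subseteq> D \<union> {p}" using inD \<Gamma>sub by auto
      finally have "g (\<zeta>1 * cis \<tau>) \<in> D \<union> {p}" .
      moreover have "cmod (\<zeta>1 * cis \<tau>) = 1" using z(1) by (simp add: norm_mult)
      then have "g (\<zeta>1 * cis \<tau>) \<in> J" by (rule gJ)
      then have "g (\<zeta>1 * cis \<tau>) \<notin> D" using jd(5) by (meson disjoint_iff)
      ultimately show ?thesis by simp
    qed
    have "g 0 = p"
    proof -
      have 1: "continuous_on (cball 0 1) (\<lambda>z. g (\<zeta>1 * z))"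
      proof (rule continuous_on_compose2[OF cg])
        show "continuous_on (cball 0 1) (\<lambda>z. \<zeta>1 * z)" by (rule continuous_on_mult_left[OF continuous_on_id])
        show "(\<lambda>z. \<zeta>1 * z) ` cball 0 1 \<subseteq> cball 0 1" using z(1) by (simp add: norm_mult image_subset_iff)
      qed
      have gh: "g holomorphic_on ball 0 1" by (rule holomorphic_transform[OF hol fg])
      have 2: "(*) \<zeta>1 holomorphic_on ball 0 1" by (intro holomorphic_intros)
      have 3: "(*) \<zeta>1 ` ball 0 1 \<subseteq> ball 0 1" using z(1) by (simp add: norm_mult image_subset_iff)
      have "(g \<circ> (*) \<zeta>1) holomorphic_on ball 0 1"
        by (rule holomorphic_on_compose_gen[OF 2 gh 3])
      then have "(\<lambda>z. g (\<zeta>1 * z)) holomorphic_on ball 0 1" by (simp add: o_def)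
      then have "(\<lambda>z. g (\<zeta>1 * z)) 0 = p"
        using holomorphic_constant_on_boundary_arc[of "\<lambda>z. g (\<zeta>1 * z)" a b p] 1 \<open>a < b\<close> con by blast
      then show ?thesis by simp
    qed
    then have "p \<in> D" using gball by (metis centre_in_ball imageI zero_less_one)
    then show False using pJ jd(5) by blast
  qed
  have "inj_on g (cball 0 1)"
  proof (rule inj_onI)
    fix x y assume xy: "x \<in> cball 0 1" "y \<in> cball 0 1" "g x = g y"
    have ball: "u \<in> ball 0 1 \<longleftrightarrow> g u \<in> D" if "u \<in> cball 0 1" for u
    proof
      assume "g u \<in> D" then show "u \<in> ball 0 1" using gJ[of u] jd(5) that by fastforce
    qed (use gball in blast)
    show "x = y"
    proof (cases "g x \<in> D")
      case True then show ?thesis using ball xy injb by (metis inj_onD)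
    next
      case False
      then have "x \<notin> ball 0 1" "y \<notin> ball 0 1" using ball xy by auto
      then show ?thesis using bdry[of x y] xy by auto
    qed
  qed
  then show ?thesis using that[of g] cg fg gsph J_def by simp
qed


section \<open>Jordan curves around the origin\<close>

text \<open>The ray from x away from the origin is unbounded, and all its other points have modulus
  greater than \<open>r\<close>.\<close>

lemma max_modulus_point_outside:
  fixes J :: "complex set"
  assumes "\<And>z. z \<in> J \<Longrightarrow> cmod z \<le> r" "cmod x \<ge> r" "x \<notin> J" "x \<noteq> 0"
  shows "x \<in> outside J"
proof -
  define R where "R = (\<lambda>t. of_real t * x) ` {1..}"
  have "connected R"
    unfolding R_def by (intro connected_continuous_image continuous_intros) auto
  moreover have "R \<subseteq> - J"
  proof
    fix y assume "y \<in> R"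
    then obtain t where t: "t \<ge> 1" "y = of_real t * x" by (auto simp: R_def)
    show "y \<in> - J"
    proof (cases "t = 1")
      case False
      then have "1 * cmod x < t * cmod x" using t(1) assms(4) by (intro mult_strict_right_mono) auto
      then have "cmod y > r" using t assms(2) by (simp add: norm_mult)
      then show ?thesis using assms(1) by fastforce
    qed (use t assms in auto)
  qed
  moreover have "x \<in> R" unfolding R_def by (rule image_eqI[of _ _ 1]) auto
  ultimately have "R \<subseteq> connected_component_set (- J) x" by (intro connected_component_maximal)
  moreover have "\<not> bounded R"
  proof
    assume "bounded R"
    then obtain B where B: "\<And>y. y \<in> R \<Longrightarrow> cmod y \<le> B" by (auto simp: bounded_iff)
    define t where "t = 1 + \<bar>B\<bar> / cmod x"
    have "of_real t * x \<in> R" unfolding R_def by (intro imageI) (simp add: t_def)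
    moreover have "cmod (of_real t * x) = cmod x + \<bar>B\<bar>"
      using assms(4) by (simp add: t_def norm_mult abs_of_nonneg add_nonneg_nonneg algebra_simps del: of_real_add)
    ultimately show False using B[of "of_real t * x"] assms(4) zero_less_norm_iff[of x] by linarith
  qed
  ultimately show ?thesis using assms(3) bounded_subset by (auto simp: outside_def)
qed

text \<open>The segment from 0 to x meets only smaller moduli before it reaches x.\<close>

lemma min_modulus_point_inside:
  fixes J :: "complex set"
  assumes "\<And>z. z \<in> J \<Longrightarrow> cmod z \<ge> cmod x" "x \<notin> J" "0 \<in> inside J"
  shows "x \<in> inside J"
proof -
  have "closed_segment 0 x \<subseteq> - J"
  proof
    fix y assume "y \<in> closed_segment 0 x"
    then obtain t where t: "0 \<le> t" "t \<le> 1" "y = t *\<^sub>R x" by (auto simp: in_segment)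
    show "y \<in> - J"
    proof (cases "t = 1 \<or> x = 0")
      case False
      then have "cmod y < cmod x" using t by simp
      then show ?thesis using assms(1) by fastforce
    qed (use t assms in auto)
  qed
  then have "connected_component (- J) 0 x"
    by (meson connected_component_def connected_segment ends_in_segment)
  then show ?thesis using inside_same_component assms(3) by blast
qed

lemma connected_subset_Jordan_side:
  assumes "connected A" "A \<inter> J = {}" "a \<in> A" "a \<in> inside J" "open (inside J)" "open (outside J)"
  shows "A \<subseteq> inside J"
proof -
  have "A \<inter> outside J = {}"
    using connectedD[OF assms(1,5,6)] assms(2-4) inside_Int_outside[of J] inside_Un_outside[of J] by blast
  then show ?thesis using inside_Un_outside[of J] assms(2) by blast
qed

text \<open>The nearest point of \<open>\<omega>J\<close> to the origin lies inside \<open>J\<close>, the farthest one outside.\<close>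

lemma rotated_Jordan_curve_meets:
  fixes c :: "real \<Rightarrow> complex"
  assumes c: "simple_path c" "pathfinish c = pathstart c" and 0: "0 \<in> inside (path_image c)"
    and "cmod \<omega> = 1"
  obtains x y where "x \<in> path_image c" "y \<in> path_image c" "\<omega> * x = y"
proof (rule ccontr)
  define J where "J = path_image c"
  assume "\<not> thesis"
  then have disj: "x \<in> J \<Longrightarrow> \<omega> * x \<notin> J" for x using that by (auto simp: J_def)
  have cJ: "compact J" "J \<noteq> {}" using c by (auto simp: J_def compact_simple_path_image)
  have nJ: "continuous_on J cmod" by (intro continuous_intros)
  obtain w where w: "w \<in> J" "\<And>z. z \<in> J \<Longrightarrow> cmod w \<le> cmod z"
    using continuous_attains_inf[OF cJ nJ] by blast
  obtain W where W: "W \<in> J" "\<And>z. z \<in> J \<Longrightarrow> cmod z \<le> cmod W"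
    using continuous_attains_sup[OF cJ nJ] by blast
  have "0 \<notin> J" using 0 unfolding J_def by (metis inside_no_overlap disjoint_iff)
  have nrm: "cmod (\<omega> * z) = cmod z" for z using assms by (simp add: norm_mult)
  have op: "open (inside J)" "open (outside J)"
    using Jordan_inside_outside[OF c] by (auto simp: J_def)
  have "\<omega> * w \<in> inside J"
    by (rule min_modulus_point_inside) (use w disj 0 nrm in \<open>auto simp: J_def\<close>)
  moreover have "\<omega> * W \<in> outside J"
  proof (rule max_modulus_point_outside[of _ "cmod W"])
    show "\<omega> * W \<noteq> 0" using W(1) \<open>0 \<notin> J\<close> assms by auto
  qed (use W disj nrm in auto)
  moreover have "(\<lambda>z. \<omega> * z) ` J \<subseteq> inside J"
  proof (rule connected_subset_Jordan_side[OF _ _ _ _ op])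
    show "connected ((\<lambda>z. \<omega> * z) ` J)"
      using connected_simple_path_image[OF c(1)] unfolding J_def
      by (intro connected_continuous_image continuous_on_mult_left continuous_on_id)
    show "(\<lambda>z. \<omega> * z) ` J \<inter> J = {}" using disj by auto
    show "\<omega> * w \<in> (\<lambda>z. \<omega> * z) ` J" using w by blast
  qed fact
  ultimately show False using W(1) inside_Int_outside[of J] by blast
qed

text \<open>If the scaled inside met the curve, the curve expanded by 1/s would meet the inside.
  Being connected and disjoint from the curve, it would lie inside altogether, although its farthest
  point is outside. So the scaled inside misses the curve; it is connected and contains 0.\<close>

lemma scaled_inside_subset:
  fixes c :: "real \<Rightarrow> complex" and s :: real
  assumes c: "simple_path c" "pathfinish c = pathstart c" and 0: "0 \<in> inside (path_image c)"
    and s: "0 < s" "s < 1"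
    and disj: "\<And>x. x \<in> path_image c \<Longrightarrow> of_real s * x \<notin> path_image c"
  shows "(\<lambda>z. of_real s * z) ` inside (path_image c) \<subseteq> inside (path_image c)"
proof -
  define J where "J = path_image c"
  define D where "D = inside J"
  have jd: "open D" "open (outside J)" "connected D" "connected J"
    using Jordan_inside_outside[OF c] connected_simple_path_image[OF c(1)] by (auto simp: J_def D_def)
  have cJ: "compact J" "J \<noteq> {}" using c by (auto simp: J_def compact_simple_path_image)
  have nJ: "continuous_on J cmod" by (intro continuous_intros)
  obtain W where W: "W \<in> J" "\<And>z. z \<in> J \<Longrightarrow> cmod z \<le> cmod W"
    using continuous_attains_sup[OF cJ nJ] by blast
  have "0 \<notin> J" using 0 unfolding J_def by (metis inside_no_overlap disjoint_iff)
  have sub: "(\<lambda>z. of_real s * z) ` D \<inter> J = {}"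
  proof (rule ccontr)
    assume "(\<lambda>z. of_real s * z) ` D \<inter> J \<noteq> {}"
    then obtain z where z: "z \<in> D" "of_real s * z \<in> J" by auto
    let ?L = "(\<lambda>z. of_real (1 / s) * z) ` J"
    have "?L \<subseteq> D" unfolding D_def
    proof (rule connected_subset_Jordan_side)
      show "connected ?L" using jd(4) by (intro connected_continuous_image continuous_on_mult_left continuous_on_id)
      show "?L \<inter> J = {}"
      proof (rule ccontr)
        assume "?L \<inter> J \<noteq> {}"
        then obtain x where "x \<in> J" "of_real (1 / s) * x \<in> J" by auto
        then show False using disj[of "of_real (1 / s) * x"] s by (simp add: J_def)
      qed
      show "z \<in> ?L" using z(2) s by (intro image_eqI[of _ _ "of_real s * z"]) auto
    qed (use z jd in \<open>auto simp: D_def\<close>)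
    then have inD: "of_real (1 / s) * W \<in> D" using W(1) by blast
    have "of_real (1 / s) * W \<in> outside J"
    proof (rule max_modulus_point_outside[OF W(2)])
      have "cmod W * 1 \<le> cmod W * (1 / s)" using s by (intro mult_left_mono) auto
      then show "cmod W \<le> cmod (of_real (1 / s) * W)" using s by (simp add: norm_mult norm_divide)
      show "of_real (1 / s) * W \<notin> J" using inD unfolding D_def by (metis inside_no_overlap disjoint_iff)
      show "of_real (1 / s) * W \<noteq> 0" using W(1) \<open>0 \<notin> J\<close> s by auto
    qed
    then show False using inD unfolding D_def by (metis inside_Int_outside disjoint_iff)
  qed
  have "0 \<in> D" using 0 by (simp add: D_def J_def)
  have "(\<lambda>z. of_real s * z) ` D \<subseteq> D" unfolding D_def
  proof (rule connected_subset_Jordan_side[where a = 0])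
    show "connected ((\<lambda>z. of_real s * z) ` inside J)"
      using jd(3) unfolding D_def by (intro connected_continuous_image continuous_on_mult_left continuous_on_id)
    show "0 \<in> (\<lambda>z. of_real s * z) ` inside J" using \<open>0 \<in> D\<close> by (force simp: D_def)
  qed (use sub jd \<open>0 \<in> D\<close> in \<open>auto simp: D_def\<close>)
  then show ?thesis by (simp add: D_def J_def)
qed

text \<open>A Moebius transformation of the disc moves the preimage of 0 to 0, which is the
  normalization required by the Schwarz lemma.\<close>

lemma Riemann_map_at_0:
  assumes "open D" "simply_connected D" "bounded D" "0 \<in> D"
  obtains f g where "f holomorphic_on ball 0 1" "g holomorphic_on D" "f 0 = 0"
    "\<And>z. z \<in> ball 0 1 \<Longrightarrow> f z \<in> D \<and> g (f z) = z" "\<And>w. w \<in> D \<Longrightarrow> g w \<in> ball 0 1 \<and> f (g w) = w"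
proof -
  have "D \<noteq> UNIV" "D \<noteq> {}" using assms not_bounded_UNIV by auto
  then obtain h k where hk: "h holomorphic_on D" "k holomorphic_on ball 0 1"
     "\<And>z. z \<in> D \<Longrightarrow> h z \<in> ball 0 1 \<and> k (h z) = z" "\<And>z. z \<in> ball 0 1 \<Longrightarrow> k z \<in> D \<and> h (k z) = z"
    using Riemann_mapping_theorem[of D] assms by metis
  define a where "a = h 0"
  have a: "cmod a < 1" using hk(3)[OF assms(4)] by (simp add: a_def)
  define m where "m = Moebius_function 0 a"
  define n where "n = Moebius_function 0 (- a)"
  have mb: "m z \<in> ball 0 1" "n z \<in> ball 0 1" if "z \<in> ball 0 1" for z
    using Moebius_function_norm_lt_1 that a by (auto simp: m_def n_def)
  have mn: "m (n z) = z" "n (m z) = z" if "z \<in> ball 0 1" for z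
    using Moebius_function_compose that a by (auto simp: m_def n_def)
  have hol: "m holomorphic_on ball 0 1" "n holomorphic_on ball 0 1"
    using Moebius_function_holomorphic a by (auto simp: m_def n_def)
  have n0: "n 0 = a" by (simp add: n_def Moebius_function_of_zero)
  show ?thesis
  proof (rule that[of "k \<circ> n" "m \<circ> h"])
    show "k \<circ> n holomorphic_on ball 0 1"
      by (rule holomorphic_on_compose_gen[OF hol(2) hk(2)]) (use mb in blast)
    show "m \<circ> h holomorphic_on D"
      by (rule holomorphic_on_compose_gen[OF hk(1) hol(1)]) (use hk(3) in blast)
    show "(k \<circ> n) 0 = 0" using hk(3)[OF assms(4)] by (simp add: n0 a_def)
  qed (use hk mb mn in \<open>auto simp del: mem_ball\<close>)
qed

text \<open>By the Schwarz lemma \<open>z \<mapsto> f\<^sup>-\<^sup>1(s f(z))\<close> cannot preserve any modulus unless it is a rotation.\<close>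

lemma Schwarz_scaled_disjoint:
  fixes f g :: "complex \<Rightarrow> complex" and s :: real
  assumes hol: "f holomorphic_on ball 0 1" "g holomorphic_on D" and f0: "f 0 = 0"
    and fg: "\<And>z. z \<in> ball 0 1 \<Longrightarrow> f z \<in> D \<and> g (f z) = z" "\<And>w. w \<in> D \<Longrightarrow> g w \<in> ball 0 1 \<and> f (g w) = w"
    and s: "0 < s" "s < 1" and sD: "(\<lambda>z. of_real s * z) ` D \<subseteq> D"
    and z: "cmod z = r" "cmod w = r" "0 < r" "r < 1"
  shows "f z \<noteq> of_real s * f w"
proof
  assume eq: "f z = of_real s * f w"
  define \<psi> where "\<psi> = g \<circ> ((\<lambda>z. of_real s * z) \<circ> f)"
  have h1: "((\<lambda>z. of_real s * z) \<circ> f) holomorphic_on ball 0 1"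
    unfolding o_def using hol(1) by (intro holomorphic_intros)
  have "\<psi> holomorphic_on ball 0 1" unfolding \<psi>_def
    by (rule holomorphic_on_compose_gen[OF h1 hol(2)]) (use fg(1) sD in \<open>auto simp: image_subset_iff simp del: mem_ball\<close>)
  moreover have "\<psi> 0 = 0" using fg(1)[of 0] f0 by (simp add: \<psi>_def)
  moreover have \<psi>b: "cmod (\<psi> u) < 1" "f (\<psi> u) = of_real s * f u" if "cmod u < 1" for u
  proof -
    have "of_real s * f u \<in> D" using that fg(1)[of u] sD by auto
    then show "cmod (\<psi> u) < 1" "f (\<psi> u) = of_real s * f u" using fg(2) by (auto simp: \<psi>_def)
  qed
  moreover have "\<psi> w = z"
  proof -
    have "\<psi> w = g (f z)" by (simp add: \<psi>_def eq[symmetric])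
    then show ?thesis using fg(1)[of z] z by simp
  qed
  then have "\<exists>z. cmod z < 1 \<and> z \<noteq> 0 \<and> cmod (\<psi> z) = cmod z"
    using z by (intro exI[of _ w]) auto
  ultimately obtain \<alpha> where \<alpha>: "\<And>u. cmod u < 1 \<Longrightarrow> \<psi> u = \<alpha> * u" "cmod \<alpha> = 1"
    using Schwarz_Lemma(3)[of \<psi> 0] by auto
  \<comment> \<open>As \<open>\<psi>\<close> is a rotation, f(\<alpha> u) = s f(u) on the disc.
    Comparing derivatives at 0 gives \<alpha> = s, whose modulus is less than 1.\<close>
  have df: "(f has_field_derivative deriv f 0) (at 0)"
    using hol(1) by (intro holomorphic_derivI[of _ "ball 0 1"]) auto
  have "inj_on f (ball 0 1)" using fg(1) by (metis inj_onI)
  then have "deriv f 0 \<noteq> 0" using holomorphic_injective_imp_regular[OF hol(1)] by simp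
  have "((\<lambda>u. f (\<alpha> * u)) has_field_derivative deriv f 0 * \<alpha>) (at 0)"
  proof -
    have 1: "(f has_field_derivative deriv f 0) (at (\<alpha> * 0))" using df by simp
    have 2: "((\<lambda>u. \<alpha> * u) has_field_derivative \<alpha>) (at 0)" by (rule DERIV_cmult_Id)
    show ?thesis using DERIV_chain2[OF 1 2] .
  qed
  moreover have "((\<lambda>u. of_real s * f u) has_field_derivative of_real s * deriv f 0) (at 0)"
    using df by (rule DERIV_cmult)
  then have "((\<lambda>u. f (\<alpha> * u)) has_field_derivative of_real s * deriv f 0) (at 0)"
    by (rule has_field_derivative_transform_within_open[of _ _ _ "ball 0 1"])
       (use \<psi>b(2) \<alpha>(1) in auto)
  ultimately have "deriv f 0 * \<alpha> = of_real s * deriv f 0" by (rule DERIV_unique)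
  then have "\<alpha> = of_real s" using \<open>deriv f 0 \<noteq> 0\<close> by simp
  then show False using \<alpha>(2) s by simp
qed


section \<open>Simple closed curves on the torus\<close>

lemma embedding_map_circle_iff:
  assumes "Hausdorff_space X"
  shows "embedding_map circle X \<gamma> \<longleftrightarrow> continuous_map circle X \<gamma> \<and> inj_on \<gamma> (sphere 0 1)"
proof
  assume "embedding_map circle X \<gamma>"
  then show "continuous_map circle X \<gamma> \<and> inj_on \<gamma> (sphere 0 1)"
    using continuous_map_in_subtopology homeomorphic_imp_continuous_map homeomorphic_imp_injective_map
    unfolding embedding_map_def by fastforce
next
  assume R: "continuous_map circle X \<gamma> \<and> inj_on \<gamma> (sphere 0 1)"
  have "compact_space circle" by (simp add: compact_space_subtopology)
  then have "closed_map circle X \<gamma>" using R assms continuous_imp_closed_map by blast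
  then show "embedding_map circle X \<gamma>" using R by (simp add: injective_closed_imp_embedding_map)
qed

lemma embedding_map_cong:
  assumes "\<And>x. x \<in> topspace X \<Longrightarrow> f x = g x"
  shows "embedding_map X Y f \<longleftrightarrow> embedding_map X Y g"
proof -
  have im: "f ` topspace X = g ` topspace X" using assms by auto
  have "homeomorphic_map X Z f \<longleftrightarrow> homeomorphic_map X Z g" for Z
    using homeomorphic_map_eq[of X Z f g] homeomorphic_map_eq[of X Z g f] assms by auto
  then show ?thesis unfolding embedding_map_def im by blast
qed

lemma homeomorphic_imp_embedding_map: "homeomorphic_map X Y f \<Longrightarrow> embedding_map X Y f"
  by (simp add: embedding_map_def homeomorphic_imp_surjective_map)

text \<open>In terms of \<open>homotopic_with\<close>, restricted to embeddings, symmetry,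
  concatenation and composition come from the general theory of homotopies.\<close>

lemma isotopic_curves_iff_homotopic_with:
  "(C, C') \<in> isotopic_curves X \<longleftrightarrow>
     (\<exists>p q. homotopic_with (embedding_map circle X) circle X p q \<and> C = p ` sphere 0 1 \<and> C' = q ` sphere 0 1)"
proof
  assume "(C, C') \<in> isotopic_curves X"
  then obtain H where H: "continuous_map (prod_topology interval_space circle) X H"
      "\<forall>t\<in>{0..1}. embedding_map circle X (\<lambda>z. H (t, z))"
      "C = (\<lambda>z. H (0, z)) ` sphere 0 1" "C' = (\<lambda>z. H (1, z)) ` sphere 0 1"
    unfolding isotopic_curves_def by blast
  then have "homotopic_with (embedding_map circle X) circle X (\<lambda>z. H (0, z)) (\<lambda>z. H (1, z))"
    unfolding homotopic_with_def by blast
  then show "\<exists>p q. homotopic_with (embedding_map circle X) circle X p q \<and> C = p ` sphere 0 1 \<and> C' = q ` sphere 0 1"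
    using H(3,4) by blast
next
  assume "\<exists>p q. homotopic_with (embedding_map circle X) circle X p q \<and> C = p ` sphere 0 1 \<and> C' = q ` sphere 0 1"
  then obtain p q where pq: "homotopic_with (embedding_map circle X) circle X p q"
      "C = p ` sphere 0 1" "C' = q ` sphere 0 1" by blast
  obtain H where H: "continuous_map (prod_topology interval_space circle) X H"
      "\<forall>x. H (0, x) = p x" "\<forall>x. H (1, x) = q x" "\<forall>t\<in>{0..1}. embedding_map circle X (\<lambda>z. H (t, z))"
    using pq(1) unfolding homotopic_with_def by blast
  have "C = (\<lambda>z. H (0, z)) ` sphere 0 1" "C' = (\<lambda>z. H (1, z)) ` sphere 0 1"
    unfolding pq(2,3) using H(2,3) by simp_all
  then show "(C, C') \<in> isotopic_curves X" unfolding isotopic_curves_def using H(1,4) by blast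
qed

lemma isotopic_curves_sym: "(C, C') \<in> isotopic_curves X \<Longrightarrow> (C', C) \<in> isotopic_curves X"
  using homotopic_with_symD unfolding isotopic_curves_iff_homotopic_with by blast

lemma isotopic_curves_refl:
  assumes "embedding_map circle X \<gamma>"
  shows "(\<gamma> ` sphere 0 1, \<gamma> ` sphere 0 1) \<in> isotopic_curves X"
proof -
  have "continuous_map circle X \<gamma>"
    using assms continuous_map_in_subtopology homeomorphic_imp_continuous_map unfolding embedding_map_def by blast
  then show ?thesis unfolding isotopic_curves_iff_homotopic_with using assms by (metis homotopic_with_refl)
qed

text \<open>\<open>isotopic_curves\<close> remembers images only. To concatenate two isotopies that
  meet in the same image with different parametrizations, one of them is reparametrized by this
  \<open>\<sigma>\<close>.\<close>

lemma embedding_reparametrization: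
  assumes p: "embedding_map circle X p" and q: "embedding_map circle X q"
    and im: "p ` sphere 0 1 = q ` sphere 0 1"
  obtains \<sigma> where "homeomorphic_map circle circle \<sigma>" "\<And>z. z \<in> sphere 0 1 \<Longrightarrow> p (\<sigma> z) = q z"
proof -
  let ?Y = "subtopology X (p ` sphere 0 1)"
  have hp: "homeomorphic_map circle ?Y p" and hq: "homeomorphic_map circle ?Y q"
    using p q im by (auto simp: embedding_map_def)
  obtain r where r: "homeomorphic_maps circle ?Y p r"
    using hp homeomorphic_map_maps by blast
  have "homeomorphic_map ?Y circle r" using r homeomorphic_maps_map by blast
  then have "homeomorphic_map circle circle (r \<circ> q)" using hq homeomorphic_map_compose by blast
  moreover have "p ((r \<circ> q) z) = q z" if "z \<in> sphere 0 1" for z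
  proof -
    have "q z \<in> topspace ?Y" using homeomorphic_imp_surjective_map[OF hq] that by (metis imageI topspace_euclidean_subtopology)
    then show ?thesis using r by (simp add: homeomorphic_maps_def)
  qed
  ultimately show ?thesis using that by blast
qed

lemma isotopic_curves_trans:
  assumes "(C1, C2) \<in> isotopic_curves X" "(C2, C3) \<in> isotopic_curves X"
  shows "(C1, C3) \<in> isotopic_curves X"
proof -
  let ?P = "embedding_map circle X"
  obtain p q where pq: "homotopic_with ?P circle X p q" "C1 = p ` sphere 0 1" "C2 = q ` sphere 0 1"
    using assms(1) unfolding isotopic_curves_iff_homotopic_with by blast
  obtain p' q' where pq': "homotopic_with ?P circle X p' q'" "C2 = p' ` sphere 0 1" "C3 = q' ` sphere 0 1"
    using assms(2) unfolding isotopic_curves_iff_homotopic_with by blast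
  have emb: "?P q" "?P p'" using pq(1) pq'(1) homotopic_with_imp_property by blast+
  obtain \<sigma> where \<sigma>: "homeomorphic_map circle circle \<sigma>" "\<And>z. z \<in> sphere 0 1 \<Longrightarrow> p' (\<sigma> z) = q z"
    using embedding_reparametrization[OF emb(2,1)] pq(3) pq'(2) by metis
  have "?P (f \<circ> \<sigma>)" if "?P f" for f
  proof -
    have "embedding_map circle circle \<sigma>" using \<sigma>(1) homeomorphic_imp_embedding_map by blast
    then show ?thesis using that embedding_map_compose by blast
  qed
  then have "homotopic_with ?P circle X (p' \<circ> \<sigma>) (q' \<circ> \<sigma>)"
    using homotopic_with_compose_continuous_map_right[OF pq'(1)] \<sigma>(1) homeomorphic_imp_continuous_map by blast
  then have "homotopic_with ?P circle X q (q' \<circ> \<sigma>)"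
  proof (rule homotopic_with_eq)
    show "?P h \<longleftrightarrow> ?P k" if "\<And>x. x \<in> topspace circle \<Longrightarrow> h x = k x" for h k
      using that by (rule embedding_map_cong)
  qed (use \<sigma>(2) in auto)
  then have "homotopic_with ?P circle X p (q' \<circ> \<sigma>)" using pq(1) homotopic_with_trans by blast
  moreover have "\<sigma> ` sphere 0 1 = sphere 0 1" using homeomorphic_imp_surjective_map[OF \<sigma>(1)] by simp
  then have "(q' \<circ> \<sigma>) ` sphere 0 1 = C3" using pq'(3) by (metis image_comp)
  ultimately show ?thesis using pq(2) unfolding isotopic_curves_iff_homotopic_with by blast
qed

lemma isotopic_curves_homeomorphic_image:
  assumes "(C, C') \<in> isotopic_curves X" and h: "homeomorphic_map X Y h"
  shows "(h ` C, h ` C') \<in> isotopic_curves Y"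
proof -
  obtain p q where pq: "homotopic_with (embedding_map circle X) circle X p q" "C = p ` sphere 0 1" "C' = q ` sphere 0 1"
    using assms(1) unfolding isotopic_curves_iff_homotopic_with by blast
  have "embedding_map circle Y (h \<circ> f)" if "embedding_map circle X f" for f
    using that h homeomorphic_imp_embedding_map embedding_map_compose by blast
  then have "homotopic_with (embedding_map circle Y) circle Y (h \<circ> p) (h \<circ> q)"
    using homotopic_with_compose_continuous_map_left[OF pq(1)] h homeomorphic_imp_continuous_map by blast
  then show ?thesis unfolding isotopic_curves_iff_homotopic_with pq(2,3) by (metis image_comp)
qed

section \<open>Universal cover of the torus, lifts and winding of closed curves\<close>

definition torus_cover :: "complex \<Rightarrow> complex \<times> complex" where
  "torus_cover u = (cis (2 * pi * Re u), cis (2 * pi * Im u))"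

lemma torus_eq: "torus = top_of_set (sphere 0 1 \<times> sphere 0 1)" by simp

lemma cis_2pi_eq_iff: "cis (2 * pi * x) = cis (2 * pi * y) \<longleftrightarrow> (\<exists>n::int. x = y + of_int n)"
proof
  assume "cis (2 * pi * x) = cis (2 * pi * y)"
  then have "exp (\<i> * complex_of_real (2 * pi * x)) = exp (\<i> * complex_of_real (2 * pi * y))" by (simp only: cis_conv_exp)
  then obtain n :: int where "\<i> * complex_of_real (2 * pi * x) = \<i> * complex_of_real (2 * pi * y) + (of_int (2 * n) * pi) * \<i>"
    unfolding exp_eq by blast
  then have "2 * pi * x = 2 * pi * y + 2 * pi * of_int n" by (simp add: complex_eq_iff)
  then have "2 * pi * x = 2 * pi * (y + of_int n)" by (simp add: algebra_simps)
  then show "\<exists>n::int. x = y + of_int n" using pi_neq_zero by (metis mult_cancel_left mult_eq_0_iff zero_neq_numeral)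
next
  assume "\<exists>n::int. x = y + of_int n"
  then show "cis (2 * pi * x) = cis (2 * pi * y)"
    by (auto simp: distrib_left simp flip: cis_mult)
qed

lemma torus_cover_eq_iff:
  "torus_cover u = torus_cover v \<longleftrightarrow> (\<exists>m n :: int. u = v + Complex (of_int m) (of_int n))"
proof -
  have "torus_cover u = torus_cover v \<longleftrightarrow>
      (\<exists>m::int. Re u = Re v + of_int m) \<and> (\<exists>n::int. Im u = Im v + of_int n)"
    unfolding torus_cover_def prod.inject cis_2pi_eq_iff ..
  then show ?thesis by (simp add: complex_eq_iff)
qed

lemma continuous_torus_cover: "continuous_on S torus_cover"
  unfolding torus_cover_def[abs_def] by (intro continuous_intros)

lemma torus_cover_in_torus: "torus_cover u \<in> sphere 0 1 \<times> sphere 0 1"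
  by (simp add: torus_cover_def)

definition curve_lift :: "(complex \<Rightarrow> complex \<times> complex) \<Rightarrow> (real \<Rightarrow> complex) \<Rightarrow> bool" where
  "curve_lift \<gamma> p \<longleftrightarrow> continuous_on {0..1} p \<and> (\<forall>t\<in>{0..1}. \<gamma> (cis (2 * pi * t)) = torus_cover (p t))"

text \<open>A relation, realized by the displacement of a lift. That \<open>m\<close> and
  \<open>n\<close> are determined by the curve comes out of homology, through
  \<open>gen_classes_independent\<close>.\<close>

definition winding :: "(complex \<Rightarrow> complex \<times> complex) \<Rightarrow> int \<Rightarrow> int \<Rightarrow> bool" where
  "winding \<gamma> m n \<longleftrightarrow> (\<exists>p. curve_lift \<gamma> p \<and> p 1 - p 0 = Complex (of_int m) (of_int n))"

lemma circle_path_lift: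
  fixes g :: "real \<Rightarrow> complex"
  assumes "continuous_on {0..1} g" "\<And>t. t \<in> {0..1} \<Longrightarrow> cmod (g t) = 1"
  obtains p where "continuous_on {0..1} p" "\<And>t. t \<in> {0..1} \<Longrightarrow> g t = cis (2 * pi * p t)"
proof -
  have "g t \<noteq> 0" if "t \<in> {0..1}" for t using assms(2)[OF that] by auto
  then obtain k where k: "continuous_on {0..1} k" "\<And>t. t \<in> {0..1} \<Longrightarrow> g t = exp (k t)"
    using continuous_logarithm_on_contractible[OF assms(1)] convex_imp_contractible[of "{0..1::real}"] by auto
  show ?thesis
  proof (rule that[of "\<lambda>t. Im (k t) / (2 * pi)"])
    show "continuous_on {0..1} (\<lambda>t. Im (k t) / (2 * pi))" using k(1) by (intro continuous_intros) auto
    fix t :: real assume t: "t \<in> {0..1}"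
    have "exp (Re (k t)) = 1" using assms(2)[OF t] k(2)[OF t] by simp
    then have "Re (k t) = 0" by simp
    then show "g t = cis (2 * pi * (Im (k t) / (2 * pi)))" using k(2)[OF t] by (simp add: exp_eq_polar)
  qed
qed

lemma torus_path_lift:
  fixes g :: "real \<Rightarrow> complex \<times> complex"
  assumes "continuous_on {0..1} g" "g ` {0..1} \<subseteq> sphere 0 1 \<times> sphere 0 1"
  obtains p where "continuous_on {0..1} p" "\<And>t. t \<in> {0..1} \<Longrightarrow> g t = torus_cover (p t)"
proof -
  have 1: "cmod (fst (g t)) = 1" "cmod (snd (g t)) = 1" if "t \<in> {0..1}" for t
    using assms(2) that by (auto simp: image_subset_iff mem_Times_iff)
  obtain a where a: "continuous_on {0..1} a" "\<And>t. t \<in> {0..1} \<Longrightarrow> fst (g t) = cis (2 * pi * a t)"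
    using circle_path_lift[of "\<lambda>t. fst (g t)"] 1 assms(1) continuous_on_fst by metis
  obtain b where b: "continuous_on {0..1} b" "\<And>t. t \<in> {0..1} \<Longrightarrow> snd (g t) = cis (2 * pi * b t)"
    using circle_path_lift[of "\<lambda>t. snd (g t)"] 1 assms(1) continuous_on_snd by metis
  show ?thesis
  proof (rule that[of "\<lambda>t. Complex (a t) (b t)"])
    show "continuous_on {0..1} (\<lambda>t. Complex (a t) (b t))"
      using a(1) b(1) by (intro continuous_intros)
    show "g t = torus_cover (Complex (a t) (b t))" if "t \<in> {0..1}" for t
      using a(2)[OF that] b(2)[OF that] by (simp add: torus_cover_def prod_eq_iff)
  qed
qed

lemma curve_lift_exists:
  assumes "continuous_map circle torus \<gamma>"
  obtains p where "curve_lift \<gamma> p"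
proof -
  have c: "continuous_on (sphere 0 1) \<gamma>" "\<gamma> ` sphere 0 1 \<subseteq> sphere 0 1 \<times> sphere 0 1"
    using assms by (auto simp: image_subset_iff_funcset)
  have "continuous_on {0..1} (\<lambda>t. \<gamma> (cis (2 * pi * t)))"
    by (rule continuous_on_compose2[OF c(1)]) (auto intro!: continuous_intros)
  moreover have "(\<lambda>t. \<gamma> (cis (2 * pi * t))) ` {0..1} \<subseteq> sphere 0 1 \<times> sphere 0 1"
    using c(2) by (auto simp: image_subset_iff)
  ultimately show ?thesis using torus_path_lift that unfolding curve_lift_def by metis
qed

lemma winding_exists:
  assumes "continuous_map circle torus \<gamma>"
  obtains m n where "winding \<gamma> m n"
proof -
  obtain p where p: "curve_lift \<gamma> p" using curve_lift_exists[OF assms] .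
  have "torus_cover (p 1) = torus_cover (p 0)"
    using p[unfolded curve_lift_def, THEN conjunct2, THEN bspec, of 0]
      p[unfolded curve_lift_def, THEN conjunct2, THEN bspec, of 1] by simp
  then obtain m n :: int where "p 1 = p 0 + Complex (of_int m) (of_int n)" unfolding torus_cover_eq_iff by blast
  then have "winding \<gamma> m n" using p by (auto simp: winding_def)
  then show ?thesis using that by blast
qed

lemma curve_lift_inj:
  assumes p: "curve_lift \<gamma> p" and inj: "inj_on \<gamma> (sphere 0 1)" and st: "s \<in> {0..1}" "t \<in> {0..1}"
    and eq: "torus_cover (p s) = torus_cover (p t)"
  shows "s = t \<or> s = 0 \<and> t = 1 \<or> s = 1 \<and> t = 0"
proof -
  have "\<gamma> (cis (2 * pi * s)) = \<gamma> (cis (2 * pi * t))" using p st eq by (auto simp: curve_lift_def)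
  then have "cis (2 * pi * s) = cis (2 * pi * t)" using inj by (auto dest: inj_onD)
  then obtain n :: int where n: "s = t + of_int n" unfolding cis_2pi_eq_iff by blast
  then have "\<bar>of_int n :: real\<bar> \<le> 1" using st by auto
  then have "n = 0 \<or> n = 1 \<or> n = -1" by linarith
  then show ?thesis using n st by auto
qed

lemma curve_lift_image:
  assumes "curve_lift \<gamma> p"
  shows "\<gamma> ` sphere 0 1 = (\<lambda>t. torus_cover (p t)) ` {0..1}"
proof -
  have "sphere 0 1 = (\<lambda>t. cis (2 * pi * t)) ` {0..1}"
  proof
    show "sphere 0 1 \<subseteq> (\<lambda>t. cis (2 * pi * t)) ` {0..1}"
    proof
      fix z :: complex assume "z \<in> sphere 0 1"
      then have "z = cis (Arg2pi z)" using Arg2pi[of z] by (simp add: is_Arg_def cis_conv_exp)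
      then show "z \<in> (\<lambda>t. cis (2 * pi * t)) ` {0..1}"
        using Arg2pi[of z] by (intro image_eqI[of _ _ "Arg2pi z / (2 * pi)"]) (auto simp: field_simps)
    qed
  qed auto
  then have "\<gamma> ` sphere 0 1 = (\<lambda>t. \<gamma> (cis (2 * pi * t))) ` {0..1}" by (simp add: image_image)
  also have "\<dots> = (\<lambda>t. torus_cover (p t)) ` {0..1}"
    using assms by (intro image_cong) (auto simp: curve_lift_def)
  finally show ?thesis .
qed

text \<open>A lift without displacement is a loop in the plane, which contracts linearly to its base
  point.\<close>

lemma winding_0_nullhomotopic:
  assumes "winding \<gamma> 0 0" and cont: "continuous_map circle torus \<gamma>"
  shows "\<exists>c. homotopic_with (\<lambda>_. True) circle torus \<gamma> (\<lambda>_. c)"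
proof -
  obtain p where p: "curve_lift \<gamma> p" "p 1 - p 0 = 0"
    using assms(1) by (auto simp: winding_def zero_complex.code)
  define T where "T = sphere (0::complex) 1 \<times> sphere (0::complex) 1"
  define h where "h = (\<lambda>(s::real, t). torus_cover ((1 - s) *\<^sub>R p t + s *\<^sub>R p 0))"
  have "homotopic_loops T (\<lambda>t. \<gamma> (cis (2 * pi * t))) (\<lambda>t. torus_cover (p 0))"
    unfolding homotopic_loops
  proof (intro exI[of _ h] conjI ballI)
    have "continuous_on {0..1} p" using p(1) by (simp add: curve_lift_def)
    then have cp: "continuous_on ({0..1::real} \<times> {0..1}) (\<lambda>x. p (snd x))"
      by (rule continuous_on_compose2[OF _ continuous_on_snd[OF continuous_on_id]]) auto
    have "continuous_on ({0..1} \<times> {0..1}) (\<lambda>x. (1 - fst x) *\<^sub>R p (snd x) + fst x *\<^sub>R p 0)"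
      by (intro continuous_on_add continuous_on_scaleR continuous_on_diff continuous_on_const
          continuous_on_fst continuous_on_id cp)
    then show "continuous_on ({0..1} \<times> {0..1}) h"
      unfolding h_def case_prod_unfold
      by (rule continuous_on_compose2[OF continuous_torus_cover[of UNIV]]) auto
    show "h \<in> {0..1} \<times> {0..1} \<rightarrow> T" unfolding T_def h_def using torus_cover_in_torus by auto
    show "h (0, x) = \<gamma> (cis (2 * pi * x))" if "x \<in> {0..1}" for x
      using p(1) that by (simp add: h_def curve_lift_def)
    show "pathfinish (h \<circ> Pair t) = pathstart (h \<circ> Pair t)" for t
      using p(2) by (simp add: h_def pathfinish_def pathstart_def)
  qed (simp add: h_def)
  from homotopic_loops_imp_homotopic_circlemaps[OF this]
  have "homotopic_with_canon (\<lambda>h. True) (sphere 0 1) T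
      (\<lambda>z. \<gamma> (cis (2 * pi * (Arg2pi z / (2 * pi))))) (\<lambda>z. torus_cover (p 0))"
    by (simp add: o_def)
  moreover have "cis (2 * pi * (Arg2pi z / (2 * pi))) = z" if "z \<in> sphere 0 1" for z
    using Arg2pi[of z] that by (simp add: is_Arg_def cis_conv_exp)
  ultimately have "homotopic_with_canon (\<lambda>h. True) (sphere 0 1) T \<gamma> (\<lambda>z. torus_cover (p 0))"
    by (elim homotopic_with_eq) auto
  then show ?thesis unfolding torus_eq T_def by blast
qed

text \<open>The torus as the quotient of the punctured plane by \<open>z \<mapsto> exp (2 * pi) * z\<close>.\<close>

definition plane_to_torus :: "complex \<Rightarrow> complex \<times> complex" where
  "plane_to_torus z = (z / of_real (cmod z), cis (ln (cmod z)))"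

text \<open>The conjugate makes the modulus grow with \<open>Im u\<close>, so that angle and
  logarithm of the modulus carry the same signs as the two coordinates of
  \<open>torus_cover\<close>.\<close>

lemma plane_to_torus_exp: "plane_to_torus (exp (2 * pi * \<i> * cnj u)) = torus_cover u"
proof -
  have "exp (2 * pi * \<i> * cnj u) = of_real (exp (2 * pi * Im u)) * cis (2 * pi * Re u)"
    by (simp add: exp_eq_polar)
  then show ?thesis by (simp add: plane_to_torus_def torus_cover_def norm_mult)
qed

lemma plane_to_torus_eq:
  assumes "z \<noteq> 0" "w \<noteq> 0" "plane_to_torus z = plane_to_torus w"
  obtains k :: int where "z = of_real (exp (2 * pi * of_int k)) * w"
proof -
  have 1: "z / of_real (cmod z) = w / of_real (cmod w)" and 2: "cis (ln (cmod z)) = cis (ln (cmod w))"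
    using assms(3) by (auto simp: plane_to_torus_def)
  have "cis (2 * pi * (ln (cmod z) / (2 * pi))) = cis (2 * pi * (ln (cmod w) / (2 * pi)))"
    using 2 by simp
  then obtain k :: int where "ln (cmod z) / (2 * pi) = ln (cmod w) / (2 * pi) + of_int k"
    unfolding cis_2pi_eq_iff by blast
  then have "ln (cmod z) = ln (cmod w) + 2 * pi * of_int k" by (simp add: field_simps)
  then have "cmod z = cmod w * exp (2 * pi * of_int k)"
    using assms(1,2) by (metis exp_add exp_ln zero_less_norm_iff)
  moreover have "z = of_real (cmod z) * (w / of_real (cmod w))" using 1 assms(1) by (simp add: field_simps)
  ultimately have "z = of_real (exp (2 * pi * of_int k)) * w" using assms(2) by (simp add: field_simps)
  then show ?thesis using that by blast
qed

text \<open>Points with the same image differ by a power of one scaling. Exchanging them reduces to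
  a factor less than 1, the case that the Schwarz lemma handles.\<close>

lemma plane_to_torus_inj_on:
  assumes nz: "0 \<notin> C"
    and disj: "\<And>k x y. 0 < (k::nat) \<Longrightarrow> x \<in> C \<Longrightarrow> y \<in> C \<Longrightarrow> x \<noteq> of_real (exp (- 2 * pi * real k)) * y"
  shows "inj_on plane_to_torus C"
proof (rule inj_onI)
  fix z w assume zw: "z \<in> C" "w \<in> C" "plane_to_torus z = plane_to_torus w"
  then obtain k :: int where k: "z = of_real (exp (2 * pi * of_int k)) * w"
    using plane_to_torus_eq nz by metis
  consider "k = 0" | "k < 0" | "k > 0" by linarith
  then show "z = w"
  proof cases
    case 2
    obtain n where n: "k = - int n" "n > 0" using 2 by (metis minus_minus nat_0_le neg_0_le_iff_le neg_less_0_iff_less less_le of_nat_0_less_iff)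
    then have "z = of_real (exp (- 2 * pi * real n)) * w" using k by simp
    then show ?thesis using disj[OF n(2) zw(1,2)] by blast
  next
    case 3
    obtain n where n: "k = int n" "n > 0" using 3 by (metis zero_less_imp_eq_int)
    then have "z = of_real (exp (2 * pi * real n)) * w" using k by simp
    then have "w = of_real (exp (- 2 * pi * real n)) * z"
      by (simp add: exp_minus field_simps)
    then show ?thesis using disj[OF n(2) zw(2,1)] by blast
  qed (use k in simp)
qed

lemma continuous_plane_to_torus: "continuous_on (- {0}) plane_to_torus"
  unfolding plane_to_torus_def[abs_def] by (intro continuous_intros) auto

lemma plane_to_torus_in_torus: "z \<noteq> 0 \<Longrightarrow> plane_to_torus z \<in> sphere 0 1 \<times> sphere 0 1"
  by (simp add: plane_to_torus_def norm_divide)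

lemma Hausdorff_torus: "Hausdorff_space torus"
  unfolding torus_eq by (simp add: Hausdorff_space_subtopology)

text \<open>Dividing by \<open>d\<close> takes a d-th root of the lift to the punctured plane. The
  exponent grows by 2 pi i along it, so the loop winds once around 0 and 0 cannot be outside. As the
  d-th power of \<open>c\<close> determines the point of the torus, \<open>c\<close> is as injective
  as \<open>\<gamma>\<close>.\<close>

lemma exp_lift_Jordan_curve:
  fixes p :: "real \<Rightarrow> complex" and d :: nat
  assumes p: "curve_lift \<gamma> p" "p 1 - p 0 = of_nat d" and inj: "inj_on \<gamma> (sphere 0 1)" and "d > 0"
  defines "c \<equiv> \<lambda>t. exp (2 * pi * \<i> * cnj (p t) / of_nat d)"
  shows "simple_path c" "pathfinish c = pathstart c" "0 \<in> inside (path_image c)"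
    "\<And>s t. \<lbrakk>s \<in> {0..1}; t \<in> {0..1}; torus_cover (p s) = torus_cover (p t)\<rbrakk> \<Longrightarrow> c s = c t"
proof -
  have cp: "continuous_on {0..1} p" using p(1) by (simp add: curve_lift_def)
  define q where "q = (\<lambda>t. 2 * pi * \<i> * cnj (p t) / of_nat d)"
  have c: "c = exp \<circ> q" by (auto simp: c_def q_def)
  have pq: "path q" unfolding path_def q_def using cp \<open>d > 0\<close> by (intro continuous_intros) auto
  then have pc: "path c" unfolding c path_def by (intro continuous_on_compose continuous_intros) auto
  have "q 1 - q 0 = 2 * pi * \<i> * cnj (p 1 - p 0) / of_nat d"
    by (simp add: q_def algebra_simps diff_divide_distrib)
  then have q1: "q 1 - q 0 = 2 * pi * \<i>" using p(2) \<open>d > 0\<close> by simp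
  then have "q 1 = q 0 + 2 * of_real pi * \<i>" by (simp add: algebra_simps)
  then have "exp (q 1) = exp (q 0)" by (simp only: exp_add exp_two_pi_i mult_1_right)
  then show loop: "pathfinish c = pathstart c" by (simp add: c pathfinish_def pathstart_def)
  show cst: "c s = c t" if "s \<in> {0..1}" "t \<in> {0..1}" "torus_cover (p s) = torus_cover (p t)" for s t
    using curve_lift_inj[OF p(1) inj that] loop by (auto simp: pathfinish_def pathstart_def)
  show "simple_path c"
    unfolding simple_path_def loop_free_def
  proof (intro conjI pc ballI impI)
    fix s t :: real assume st: "s \<in> {0..1}" "t \<in> {0..1}" "c s = c t"
    have "(c u) ^ d = exp (2 * pi * \<i> * cnj (p u))" for u
      using \<open>d > 0\<close> by (simp add: c_def flip: exp_of_nat_mult)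
    then have "exp (2 * pi * \<i> * cnj (p s)) = exp (2 * pi * \<i> * cnj (p t))" using st(3) by metis
    then have "torus_cover (p s) = torus_cover (p t)" by (metis plane_to_torus_exp)
    then show "s = t \<or> s = 0 \<and> t = 1 \<or> s = 1 \<and> t = 0" by (rule curve_lift_inj[OF p(1) inj st(1,2)])
  qed
  have "winding_number c 0 = 1"
    unfolding c using winding_number_compose_exp[OF pq] q1 by (simp add: pathfinish_def pathstart_def)
  then have "0 \<notin> outside (path_image c)" using winding_number_zero_in_outside[OF pc loop] by auto
  moreover have "0 \<notin> path_image c" by (auto simp: c_def path_image_def)
  ultimately show "0 \<in> inside (path_image c)" using inside_Un_outside[of "path_image c"] by blast
qed

text \<open>Rotation by a d-th root of unity keeps d-th powers, hence points of the torus. At a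
  common point of the curve and its rotated copy, the two parameters thus give the same point of
  \<open>c\<close>, which forces the root of unity to be 1.\<close>

lemma no_multiple_winding:
  assumes emb: "embedding_map circle torus \<gamma>" and w: "winding \<gamma> (int d) 0"
  shows "d \<le> 1"
proof (rule ccontr)
  assume "\<not> d \<le> 1"
  then have "d > 1" by simp
  obtain p where p: "curve_lift \<gamma> p" "p 1 - p 0 = of_nat d"
    using w by (auto simp: winding_def complex_eq_iff)
  have inj: "inj_on \<gamma> (sphere 0 1)" using emb embedding_map_circle_iff[OF Hausdorff_torus] by blast
  define c where "c = (\<lambda>t. exp (2 * pi * \<i> * cnj (p t) / of_nat d))"
  have "d > 0" using \<open>d > 1\<close> by simp
  note cc = exp_lift_Jordan_curve[OF p inj \<open>d > 0\<close>]
  note c = cc(1-3)[folded c_def]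
  have c4: "c s = c t" if "s \<in> {0..1}" "t \<in> {0..1}" "torus_cover (p s) = torus_cover (p t)" for s t
    unfolding c_def by (rule cc(4)[OF that])
  define \<omega> where "\<omega> = cis (2 * pi * (1 / real d))"
  obtain x y where xy: "x \<in> path_image c" "y \<in> path_image c" "\<omega> * x = y"
    using rotated_Jordan_curve_meets[OF c, of \<omega>] by (auto simp: \<omega>_def)
  then obtain s t where st: "s \<in> {0..1}" "t \<in> {0..1}" "\<omega> * c s = c t" by (auto simp: path_image_def)
  have "(c u) ^ d = exp (2 * pi * \<i> * cnj (p u))" for u
    using \<open>d > 1\<close> by (simp add: c_def flip: exp_of_nat_mult)
  moreover have "\<omega> ^ d = cis (real d * (2 * pi * (1 / real d)))" unfolding \<omega>_def by (rule Complex.DeMoivre)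
  then have "\<omega> ^ d = 1" using \<open>d > 1\<close> by simp
  ultimately have "exp (2 * pi * \<i> * cnj (p s)) = exp (2 * pi * \<i> * cnj (p t))"
    using st(3) by (metis mult_1 power_mult_distrib)
  then have "torus_cover (p s) = torus_cover (p t)" by (metis plane_to_torus_exp)
  then have "c s = c t" by (rule c4[OF st(1,2)])
  then have "\<omega> = 1" using st(3) by (simp add: c_def)
  then have "cis (2 * pi * (1 / real d)) = cis (2 * pi * 0)" by (simp add: \<omega>_def)
  then obtain n :: int where "1 / real d = 0 + of_int n" unfolding cis_2pi_eq_iff by blast
  then have "real_of_int (n * int d) = 1" using \<open>d > 1\<close> by (simp add: field_simps)
  then have "n * int d = 1" by linarith
  then show False using \<open>d > 1\<close> by (simp add: zmult_eq_1_iff)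
qed

lemma isotopic_rotated_longitude:
  "(sphere 0 1 \<times> {cis a}, sphere 0 1 \<times> {1}) \<in> isotopic_curves torus"
proof -
  define H where "H = (\<lambda>(t::real, z::complex). (z, cis ((1 - t) * a)))"
  have "continuous_map (prod_topology interval_space circle) torus H"
    unfolding torus_eq prod_topology_subtopology_eu
    by (auto simp: H_def case_prod_unfold intro!: continuous_intros)
  moreover have "embedding_map circle torus (\<lambda>z. H (t, z))" for t
  proof -
    have "continuous_map circle torus (\<lambda>z. H (t, z))"
      unfolding torus_eq by (auto simp: H_def intro!: continuous_intros)
    then show ?thesis unfolding embedding_map_circle_iff[OF Hausdorff_torus]
      by (auto simp: H_def inj_on_def)
  qed
  moreover have "sphere 0 1 \<times> {cis a} = (\<lambda>z. H (0, z)) ` sphere 0 1" "sphere 0 1 \<times> {1} = (\<lambda>z. H (1, z)) ` sphere 0 1"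
    by (auto simp: H_def)
  ultimately show ?thesis unfolding isotopic_curves_def by blast
qed

text \<open>The level curves of a Riemann map of the disc bounded by the lifted curve, rescaled so that they
  shrink to a round circle, project to simple closed curves of the torus by the Schwarz lemma.\<close>

theorem isotopic_to_longitude:
  assumes emb: "embedding_map circle torus \<gamma>" and w: "winding \<gamma> 1 0"
  shows "(\<gamma> ` sphere 0 1, sphere 0 1 \<times> {1}) \<in> isotopic_curves torus"
proof -
  obtain p where p: "curve_lift \<gamma> p" "p 1 - p 0 = of_nat 1"
    using w by (auto simp: winding_def complex_eq_iff)
  have inj: "inj_on \<gamma> (sphere 0 1)" using emb embedding_map_circle_iff[OF Hausdorff_torus] by blast
  define c where "c = (\<lambda>t. exp (2 * pi * \<i> * cnj (p t) / of_nat 1))"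
  note cc = exp_lift_Jordan_curve[OF p inj zero_less_one]
  note c = cc(1-3)[folded c_def]
  have c_inj: "c s = c t" if "s \<in> {0..1}" "t \<in> {0..1}" "torus_cover (p s) = torus_cover (p t)" for s t
    unfolding c_def by (rule cc(4)[OF that])
  define J where "J = path_image c"
  define D where "D = inside J"
  have "0 \<notin> J" by (auto simp: J_def c_def path_image_def)
  have qc: "plane_to_torus (c t) = torus_cover (p t)" for t
    unfolding plane_to_torus_exp[symmetric] by (simp add: c_def)
  have qJ: "plane_to_torus ` J = \<gamma> ` sphere 0 1"
    unfolding curve_lift_image[OF p(1)] J_def path_image_def by (simp add: image_image qc)
  have q_injJ: "inj_on plane_to_torus J"
  proof (rule inj_onI)
    fix x y assume xy: "x \<in> J" "y \<in> J" "plane_to_torus x = plane_to_torus y"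
    then obtain s t where "s \<in> {0..1}" "x = c s" "t \<in> {0..1}" "y = c t" by (auto simp: J_def path_image_def)
    then show "x = y" using c_inj[of s t] xy(3) by (simp add: qc)
  qed
  define s where "s = (\<lambda>k::nat. exp (- 2 * pi * k))"
  have s01: "0 < s k" "s k < 1" if "k > 0" for k using that by (auto simp: s_def)
  have qs: "plane_to_torus (of_real (s k) * z) = plane_to_torus z" if "z \<noteq> 0" for k z
  proof -
    have "ln (cmod (of_real (s k) * z)) = - 2 * pi * k + ln (cmod z)"
      using that by (simp add: norm_mult s_def ln_mult)
    moreover have "cis (- 2 * pi * k + ln (cmod z)) = cis (ln (cmod z))"
    proof -
      have "cis (2 * pi * (ln (cmod z) / (2 * pi) + of_int (- int k))) = cis (2 * pi * (ln (cmod z) / (2 * pi)))"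
        unfolding cis_2pi_eq_iff by blast
      then show ?thesis by (simp add: algebra_simps)
    qed
    ultimately show ?thesis using that s01[of k] by (simp add: plane_to_torus_def norm_mult s_def)
  qed
  \<comment> \<open>\<open>J\<close> is embedded in the torus, while scaling by \<open>s k\<close>
    does not change the point of the torus.\<close>
  have J_disj: "of_real (s k) * x \<notin> J" if "k > 0" "x \<in> J" for k x
  proof
    assume "of_real (s k) * x \<in> J"
    moreover have "x \<noteq> 0" using that \<open>0 \<notin> J\<close> by auto
    ultimately have "of_real (s k) * x = x" using qs q_injJ that by (meson inj_onD)
    then show False using \<open>x \<noteq> 0\<close> s01(2)[OF that(1)] by simp
  qed
  have jd: "open D" "bounded D" "D \<inter> J = {}" "0 \<in> D" "simply_connected D"
    using Jordan_inside_outside[OF c(1,2)] inside_no_overlap[of J] c(3) simply_connected_inside_simple_path[OF c(1)]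
    by (auto simp: D_def J_def)
  obtain f g where fg: "f holomorphic_on ball 0 1" "g holomorphic_on D" "f 0 = 0"
    "\<And>z. z \<in> ball 0 1 \<Longrightarrow> f z \<in> D \<and> g (f z) = z" "\<And>w. w \<in> D \<Longrightarrow> g w \<in> ball 0 1 \<and> f (g w) = w"
    using Riemann_map_at_0[OF jd(1,5,2,4)] by metis
  have injf: "inj_on f (ball 0 1)" using fg(4) by (metis inj_onI)
  have imf: "f ` ball 0 1 = inside (path_image c)"
  proof
    show "f ` ball 0 1 \<subseteq> inside (path_image c)" using fg(4) by (auto simp: D_def J_def simp del: mem_ball)
    show "inside (path_image c) \<subseteq> f ` ball 0 1" using fg(5) unfolding D_def J_def by (metis imageI subsetI)
  qed
  obtain \<Phi> where \<Phi>: "continuous_on (cball 0 1) \<Phi>" "inj_on \<Phi> (cball 0 1)"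
    "\<And>z. z \<in> ball 0 1 \<Longrightarrow> \<Phi> z = f z" "\<Phi> ` sphere 0 1 = J"
    using Caratheodory_extension[OF c(1,2) fg(1) injf imf] unfolding J_def by metis
  have \<Phi>0: "\<Phi> 0 = 0" using \<Phi>(3)[of 0] fg(3) by simp
  have \<Phi>nz: "\<Phi> z \<noteq> 0" if "z \<in> cball 0 1" "z \<noteq> 0" for z
    using inj_onD[OF \<Phi>(2), of z 0] \<Phi>0 that by auto
  define A where "A = deriv f 0"
  have "A \<noteq> 0" unfolding A_def using holomorphic_injective_imp_regular[OF fg(1) _ injf] by simp
  have df: "(f has_field_derivative A) (at 0)"
    unfolding A_def using fg(1) by (intro holomorphic_derivI[of _ "ball 0 1"]) auto
  \<comment> \<open>The quotient \<open>\<Phi> w / w\<close> with its removable singularity filled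
    in. So \<open>h (r, z)\<close>, which is \<Phi>(r z)/r for r > 0, extends continuously to r = 0,
    where it is the round circle A z.\<close>
  define K where "K = (\<lambda>w. if w = 0 then A else \<Phi> w / w)"
  have cK: "continuous_on (cball 0 1) K"
    unfolding continuous_on_eq_continuous_within
  proof
    fix w :: complex assume w: "w \<in> cball 0 1"
    show "continuous (at w within cball 0 1) K"
    proof (cases "w = 0")
      case True
      have "((\<lambda>h. (f (0 + h) - f 0) / h) \<longlongrightarrow> A) (at 0)" using df by (simp add: DERIV_def)
      then have "((\<lambda>h. f h / h) \<longlongrightarrow> A) (at 0)" using fg(3) by simp
      then have "(K \<longlongrightarrow> A) (at 0)"
        by (rule Lim_transform_within_open[of _ _ _ _ "ball 0 1"]) (auto simp: K_def \<Phi>(3))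
      then show ?thesis using True
        by (simp add: continuous_within K_def tendsto_within_subset[of _ _ _ UNIV])
    next
      case False
      have "((\<lambda>w. \<Phi> w / w) \<longlongrightarrow> \<Phi> w / w) (at w within cball 0 1)"
        using \<Phi>(1) w False by (intro tendsto_intros) (auto simp: continuous_on)
      then have "(K \<longlongrightarrow> \<Phi> w / w) (at w within cball 0 1)"
        by (rule Lim_transform_within[of _ _ _ _ "cmod w"]) (use False in \<open>auto simp: K_def dist_norm\<close>)
      then show ?thesis using False by (simp add: continuous_within K_def)
    qed
  qed
  have Knz: "K w \<noteq> 0" if "w \<in> cball 0 1" for w using \<Phi>nz[OF that] \<open>A \<noteq> 0\<close> by (simp add: K_def)
  define h where "h = (\<lambda>(r::real, z). z * K (of_real r * z))"
  have rz: "of_real r * z \<in> cball 0 1" if "r \<in> {0..1}" "cmod z = 1" for r z using that by (simp add: norm_mult)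
  have hnz: "h (r, z) \<noteq> 0" if "r \<in> {0..1}" "cmod z = 1" for r z
    using Knz[OF rz[OF that]] that by (auto simp: h_def)
  have ch: "continuous_on ({0..1} \<times> sphere 0 1) h"
  proof -
    have "continuous_on ({0..1} \<times> sphere 0 1) (\<lambda>x. complex_of_real (fst x) * snd x)"
      by (intro continuous_intros)
    then have "continuous_on ({0..1} \<times> sphere 0 1) (\<lambda>x. K (complex_of_real (fst x) * snd x))"
      by (rule continuous_on_compose2[OF cK]) (auto simp: norm_mult)
    then show ?thesis unfolding h_def case_prod_unfold by (intro continuous_on_mult continuous_on_snd continuous_on_id)
  qed
  have hr: "h (r, z) = \<Phi> (of_real r * z) / of_real r" if "r > 0" "cmod z = 1" for r z
    using that by (auto simp: h_def K_def)
  define H where "H = plane_to_torus \<circ> h"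
  have hinj: "inj_on (\<lambda>z. h (r, z)) (sphere 0 1)" if r: "r \<in> {0..1}" for r
  proof (cases "r = 0")
    case True
    then show ?thesis using \<open>A \<noteq> 0\<close> by (auto simp: h_def K_def inj_on_def)
  next
    case False
    show ?thesis
    proof (rule inj_onI)
      fix z w :: complex assume zw: "z \<in> sphere 0 1" "w \<in> sphere 0 1" "h (r, z) = h (r, w)"
      then have "\<Phi> (of_real r * z) = \<Phi> (of_real r * w)" using hr[of r z] hr[of r w] r False by simp
      then have "of_real r * z = of_real r * w"
        using inj_onD[OF \<Phi>(2) _ rz[OF r] rz[OF r]] zw(1,2) by simp
      then show "z = w" using False by simp
    qed
  qed
  \<comment> \<open>Three reasons why a level curve misses its scaled copies: different moduli at r
    = 0, the Schwarz lemma for 0 < r < 1, and embeddedness of \<open>\<gamma>\<close> at r =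
    1.\<close>
  have h_disj: "h (r, z) \<noteq> of_real (s k) * h (r, w)" if r: "r \<in> {0..1}" and zw: "cmod z = 1" "cmod w = 1" and "k > 0" for r z w k
  proof -
    consider "r = 0" | "0 < r" "r < 1" | "r = 1" using r by fastforce
    then show ?thesis
    proof cases
      case 1
      have "cmod (h (r, z)) = cmod A" "cmod (of_real (s k) * h (r, w)) = s k * cmod A"
        using 1 zw s01[OF \<open>k > 0\<close>] by (auto simp: h_def K_def norm_mult)
      moreover have "s k * cmod A < 1 * cmod A" using s01[OF \<open>k > 0\<close>] \<open>A \<noteq> 0\<close> by (intro mult_strict_right_mono) auto
      ultimately show ?thesis by force
    next
      case 2
      have sD: "(\<lambda>z. of_real (s k) * z) ` D \<subseteq> D"
        using scaled_inside_subset[OF c s01[OF \<open>k > 0\<close>]] J_disj[OF \<open>k > 0\<close>] by (simp add: D_def J_def)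
      have "f (of_real r * z) \<noteq> of_real (s k) * f (of_real r * w)"
        using zw 2 by (intro Schwarz_scaled_disjoint[OF fg(1,2,3) _ _ s01[OF \<open>k > 0\<close>] sD, of _ r])
          (use fg(4,5) in \<open>auto simp: norm_mult\<close>)
      moreover have "\<Phi> (of_real r * z) = f (of_real r * z)" "\<Phi> (of_real r * w) = f (of_real r * w)"
        using 2 zw by (auto intro!: \<Phi>(3) simp: norm_mult)
      ultimately show ?thesis using hr[of r z] hr[of r w] 2 zw by simp
    next
      case 3
      have "h (r, z) = \<Phi> z" "h (r, w) = \<Phi> w" using hr[of 1 z] hr[of 1 w] 3 zw by auto
      moreover have "\<Phi> z \<in> J" "\<Phi> w \<in> J" using \<Phi>(4) zw by auto
      ultimately show ?thesis using J_disj[OF \<open>k > 0\<close>] by metis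
    qed
  qed
  have q_inj: "inj_on plane_to_torus ((\<lambda>z. h (r, z)) ` sphere 0 1)" if r: "r \<in> {0..1}" for r
  proof (rule plane_to_torus_inj_on)
    show "0 \<notin> (\<lambda>z. h (r, z)) ` sphere 0 1" using hnz[OF r] by (metis (no_types, lifting) image_iff mem_sphere_0)
    show "x \<noteq> of_real (exp (- 2 * pi * real k)) * y"
      if "0 < k" "x \<in> (\<lambda>z. h (r, z)) ` sphere 0 1" "y \<in> (\<lambda>z. h (r, z)) ` sphere 0 1" for k :: nat and x y
      using that h_disj[OF r _ _ that(1)] unfolding s_def by auto
  qed
  have cH: "continuous_on ({0..1} \<times> sphere 0 1) H"
    unfolding H_def
    by (rule continuous_on_compose[OF ch continuous_on_subset[OF continuous_plane_to_torus]]) (use hnz in auto)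
  have imH: "H (r, z) \<in> sphere 0 1 \<times> sphere 0 1" if "r \<in> {0..1}" "cmod z = 1" for r z
    unfolding H_def o_def by (rule plane_to_torus_in_torus[OF hnz[OF that]])
  have contH: "continuous_map (prod_topology interval_space circle) torus H"
    unfolding torus_eq prod_topology_subtopology_eu using cH imH by auto
  have "embedding_map circle torus (\<lambda>z. H (r, z))" if r: "r \<in> {0..1}" for r
  proof -
    have "continuous_on (sphere 0 1) (\<lambda>z. H (r, z))"
      by (rule continuous_on_compose2[OF cH]) (use r in \<open>auto intro!: continuous_intros\<close>)
    then have "continuous_map circle torus (\<lambda>z. H (r, z))" unfolding torus_eq using imH[OF r] by auto
    moreover have "inj_on (\<lambda>z. H (r, z)) (sphere 0 1)"
      using comp_inj_on[OF hinj[OF r] q_inj[OF r]] by (simp add: H_def o_def)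
    ultimately show ?thesis unfolding embedding_map_circle_iff[OF Hausdorff_torus] by blast
  qed
  then have iso: "((\<lambda>z. H (0, z)) ` sphere 0 1, (\<lambda>z. H (1, z)) ` sphere 0 1) \<in> isotopic_curves torus"
    using contH unfolding isotopic_curves_def by blast
  have "(\<lambda>z. H (1, z)) ` sphere 0 1 = plane_to_torus ` (\<Phi> ` sphere 0 1)"
    unfolding image_image using hr[of 1] by (intro image_cong) (auto simp: H_def)
  then have H1: "(\<lambda>z. H (1, z)) ` sphere 0 1 = \<gamma> ` sphere 0 1" using \<Phi>(4) qJ by simp
  \<comment> \<open>The circle of radius |A| projects to the longitude whose second coordinate has
    angle ln |A|; a rotation of the second factor then takes it to the standard one.\<close>
  have "(\<lambda>z. H (0, z)) ` sphere 0 1 = sphere 0 1 \<times> {cis (ln (cmod A))}"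
  proof -
    have H0: "H (0, z) = (z * (A / of_real (cmod A)), cis (ln (cmod A)))" if "cmod z = 1" for z
      using that by (simp add: H_def h_def K_def plane_to_torus_def norm_mult)
    have "x \<in> (\<lambda>z. H (0, z)) ` sphere 0 1" if x: "x \<in> sphere 0 1 \<times> {cis (ln (cmod A))}" for x
    proof -
      let ?z = "fst x * (of_real (cmod A) / A)"
      have "cmod ?z = 1" using x \<open>A \<noteq> 0\<close> by (auto simp: norm_mult norm_divide)
      moreover have "x = H (0, ?z)" unfolding H0[OF \<open>cmod ?z = 1\<close>] using x \<open>A \<noteq> 0\<close> by auto
      ultimately show ?thesis by auto
    qed
    moreover have "H (0, z) \<in> sphere 0 1 \<times> {cis (ln (cmod A))}" if "cmod z = 1" for z
      unfolding H0[OF that] using that \<open>A \<noteq> 0\<close> by (auto simp: norm_mult norm_divide)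
    then have "(\<lambda>z. H (0, z)) ` sphere 0 1 \<subseteq> sphere 0 1 \<times> {cis (ln (cmod A))}"
      unfolding image_subset_iff mem_sphere_0 dist_0_norm by simp
    ultimately show ?thesis by blast
  qed
  then have "(sphere 0 1 \<times> {cis (ln (cmod A))}, \<gamma> ` sphere 0 1) \<in> isotopic_curves torus"
    using iso H1 by simp
  then show ?thesis using isotopic_curves_trans[OF isotopic_curves_sym isotopic_rotated_longitude] by blast
qed

section \<open>Linear automorphisms of the torus and curves in primitive classes\<close>

definition torus_linear :: "int \<Rightarrow> int \<Rightarrow> int \<Rightarrow> int \<Rightarrow> complex \<times> complex \<Rightarrow> complex \<times> complex" where
  "torus_linear a b c d = (\<lambda>(z, w). (z powi a * w powi b, z powi c * w powi d))"

lemma torus_linear_cover: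
  "torus_linear a b c d (torus_cover u) =
     torus_cover (Complex (of_int a * Re u + of_int b * Im u) (of_int c * Re u + of_int d * Im u))"
  by (simp add: torus_linear_def torus_cover_def cis_power_int cis_mult algebra_simps)

lemma torus_cover_surj: "x \<in> sphere 0 1 \<times> sphere 0 1 \<Longrightarrow> \<exists>u. x = torus_cover u"
proof -
  assume x: "x \<in> sphere 0 1 \<times> sphere 0 1"
  have "z = cis (2 * pi * (Arg2pi z / (2 * pi)))" if "z \<in> sphere 0 1" for z
    using Arg2pi[of z] that by (simp add: is_Arg_def cis_conv_exp)
  then have "x = torus_cover (Complex (Arg2pi (fst x) / (2 * pi)) (Arg2pi (snd x) / (2 * pi)))"
    using x by (auto simp: torus_cover_def)
  then show ?thesis by blast
qed

lemma torus_linear_continuous_map: "continuous_map torus torus (torus_linear a b c d)"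
proof -
  have "continuous_on (sphere 0 1 \<times> sphere 0 1) (torus_linear a b c d)"
    unfolding torus_linear_def case_prod_unfold by (intro continuous_intros) auto
  moreover have "torus_linear a b c d ` (sphere 0 1 \<times> sphere 0 1) \<subseteq> sphere 0 1 \<times> sphere 0 1"
  proof
    fix y assume "y \<in> torus_linear a b c d ` (sphere 0 1 \<times> sphere 0 1)"
    then obtain x where x: "x \<in> sphere 0 1 \<times> sphere 0 1" "y = torus_linear a b c d x" by blast
    obtain u where "x = torus_cover u" using torus_cover_surj[OF x(1)] by blast
    then show "y \<in> sphere 0 1 \<times> sphere 0 1" unfolding x(2) by (simp only: torus_linear_cover torus_cover_in_torus)
  qed
  ultimately show ?thesis unfolding torus_eq by (simp add: image_subset_iff_funcset)
qed

lemma torus_linear_inverse: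
  assumes "a * d - b * c = 1" "x \<in> sphere 0 1 \<times> sphere 0 1"
  shows "torus_linear d (- b) (- c) a (torus_linear a b c d x) = x"
proof -
  obtain u where u: "x = torus_cover u" using torus_cover_surj[OF assms(2)] by blast
  have 1: "real_of_int a * real_of_int d - real_of_int b * real_of_int c = 1"
    using assms(1) by (metis of_int_1 of_int_diff of_int_mult)
  have "real_of_int d * (real_of_int a * Re u + real_of_int b * Im u) - real_of_int b * (real_of_int c * Re u + real_of_int d * Im u)
      = (real_of_int a * real_of_int d - real_of_int b * real_of_int c) * Re u" by (simp add: algebra_simps)
  moreover have "- real_of_int c * (real_of_int a * Re u + real_of_int b * Im u) + real_of_int a * (real_of_int c * Re u + real_of_int d * Im u)
      = (real_of_int a * real_of_int d - real_of_int b * real_of_int c) * Im u" by (simp add: algebra_simps)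
  ultimately show ?thesis unfolding u torus_linear_cover using 1 by simp
qed

lemma torus_linear_homeomorphic_map:
  assumes "a * d - b * c = 1"
  shows "homeomorphic_map torus torus (torus_linear a b c d)"
proof -
  have "homeomorphic_maps torus torus (torus_linear a b c d) (torus_linear d (- b) (- c) a)"
    unfolding homeomorphic_maps_def
    using torus_linear_continuous_map torus_linear_inverse[OF assms] torus_linear_inverse[of d a "- b" "- c"] assms
    by (auto simp: mult.commute)
  then show ?thesis using homeomorphic_maps_map by blast
qed

lemma winding_torus_linear:
  assumes "winding \<gamma> m n"
  shows "winding (torus_linear a b c d \<circ> \<gamma>) (a * m + b * n) (c * m + d * n)"
proof -
  obtain p where p: "curve_lift \<gamma> p" "p 1 - p 0 = Complex (of_int m) (of_int n)"
    using assms by (auto simp: winding_def)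
  define q where "q = (\<lambda>t. Complex (of_int a * Re (p t) + of_int b * Im (p t)) (of_int c * Re (p t) + of_int d * Im (p t)))"
  have "curve_lift (torus_linear a b c d \<circ> \<gamma>) q"
    using p(1) unfolding curve_lift_def q_def by (auto simp: torus_linear_cover intro!: continuous_intros)
  moreover have "Re (p 1) = Re (p 0) + of_int m" "Im (p 1) = Im (p 0) + of_int n"
    using p(2) by (auto simp: complex_eq_iff)
  then have "q 1 - q 0 = Complex (of_int (a * m + b * n)) (of_int (c * m + d * n))"
    by (simp add: q_def complex_eq_iff algebra_simps)
  ultimately show ?thesis unfolding winding_def by blast
qed

text \<open>Bezout coefficients form the first row. The second row is the primitive vector
  orthogonal to (m, n), and the Bezout identity says that the determinant is 1.\<close>

lemma gcd_matrix:
  fixes m n :: int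
  assumes "(m, n) \<noteq> (0, 0)"
  obtains a b c d where "a * d - b * c = 1" "a * m + b * n = gcd m n" "c * m + d * n = 0"
proof -
  obtain a b where ab: "a * m + b * n = gcd m n" using bezout_int[of m n] by metis
  define g where "g = gcd m n"
  have "g \<noteq> 0" using assms by (simp add: g_def)
  obtain m' n' where mn: "m = g * m'" "n = g * n'"
    by (metis g_def gcd_dvd1 gcd_dvd2 dvdE)
  have "a * (g * m') + b * (g * n') = g" using ab mn by (metis g_def)
  then have "g * (a * m' + b * n') = g" by (simp add: algebra_simps)
  then have "a * m' + b * n' = 1" using \<open>g \<noteq> 0\<close> by simp
  then have "a * m' - b * (- n') = 1" by simp
  moreover have "- n' * m + m' * n = 0" by (simp add: mn)
  ultimately show ?thesis using that ab by blast
qed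

lemma embedding_torus_linear:
  assumes "embedding_map circle torus \<gamma>" "a * d - b * c = 1"
  shows "embedding_map circle torus (torus_linear a b c d \<circ> \<gamma>)"
  using assms embedding_map_compose homeomorphic_imp_embedding_map torus_linear_homeomorphic_map by blast

text \<open>A matrix of determinant 1 moves the winding to (gcd, 0), where
  \<open>no_multiple_winding\<close> applies.\<close>

lemma simple_closed_curve_primitive:
  assumes emb: "embedding_map circle torus \<gamma>" and w: "winding \<gamma> m n" and nz: "(m, n) \<noteq> (0, 0)"
  shows "gcd m n = 1"
proof -
  obtain a b c d where A: "a * d - b * c = 1" "a * m + b * n = gcd m n" "c * m + d * n = 0"
    using gcd_matrix[OF nz] by metis
  have "winding (torus_linear a b c d \<circ> \<gamma>) (int (nat (gcd m n))) 0"
    using winding_torus_linear[OF w, of a b c d] A by simp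
  then have "nat (gcd m n) \<le> 1" using no_multiple_winding embedding_torus_linear[OF emb A(1)] by blast
  moreover have "gcd m n > 0" using nz by auto
  ultimately show ?thesis by linarith
qed

text \<open>By primitivity, one and the same automorphism sends both curves to winding (1, 0), so
  both become isotopic to the longitude; the inverse automorphism brings the isotopy back.\<close>

theorem isotopic_if_same_winding:
  assumes emb: "embedding_map circle torus \<gamma>" "embedding_map circle torus \<delta>"
    and w: "winding \<gamma> m n" "winding \<delta> m n" and nz: "(m, n) \<noteq> (0, 0)"
  shows "(\<gamma> ` sphere 0 1, \<delta> ` sphere 0 1) \<in> isotopic_curves torus"
proof -
  obtain a b c d where A: "a * d - b * c = 1" "a * m + b * n = gcd m n" "c * m + d * n = 0"
    using gcd_matrix[OF nz] by metis
  have g: "gcd m n = 1" using simple_closed_curve_primitive[OF emb(1) w(1) nz] .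
  let ?A = "torus_linear a b c d"
  have "((?A \<circ> \<gamma>) ` sphere 0 1, sphere 0 1 \<times> {1}) \<in> isotopic_curves torus"
    using winding_torus_linear[OF w(1), of a b c d] A g
    by (intro isotopic_to_longitude embedding_torus_linear[OF emb(1) A(1)]) auto
  moreover have "((?A \<circ> \<delta>) ` sphere 0 1, sphere 0 1 \<times> {1}) \<in> isotopic_curves torus"
    using winding_torus_linear[OF w(2), of a b c d] A g
    by (intro isotopic_to_longitude embedding_torus_linear[OF emb(2) A(1)]) auto
  ultimately have "(?A ` \<gamma> ` sphere 0 1, ?A ` \<delta> ` sphere 0 1) \<in> isotopic_curves torus"
    unfolding image_comp using isotopic_curves_trans isotopic_curves_sym by blast
  moreover have "homeomorphic_map torus torus (torus_linear d (- b) (- c) a)"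
    using A(1) by (intro torus_linear_homeomorphic_map) (simp add: mult.commute)
  ultimately have 1: "(torus_linear d (- b) (- c) a ` ?A ` \<gamma> ` sphere 0 1, torus_linear d (- b) (- c) a ` ?A ` \<delta> ` sphere 0 1) \<in> isotopic_curves torus"
    by (rule isotopic_curves_homeomorphic_image)
  have "torus_linear d (- b) (- c) a ` ?A ` \<eta> ` sphere 0 1 = \<eta> ` sphere 0 1" if "embedding_map circle torus \<eta>" for \<eta>
  proof -
    have "continuous_map circle torus \<eta>" using that embedding_map_circle_iff[OF Hausdorff_torus] by blast
    then have "\<eta> ` sphere 0 1 \<subseteq> sphere 0 1 \<times> sphere 0 1" unfolding torus_eq by (simp add: image_subset_iff_funcset)
    then have "torus_linear d (- b) (- c) a (?A (\<eta> z)) = \<eta> z" if "z \<in> sphere 0 1" for z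
      using torus_linear_inverse[OF A(1)] that by blast
    then show ?thesis unfolding image_image by (intro image_cong) auto
  qed
  then show ?thesis using 1 emb by simp
qed

text \<open>Conjugation reverses a curve and keeps its image. It accounts for the sign of the
  homology class of an unoriented slope.\<close>

lemma winding_cnj:
  assumes "winding \<gamma> m n"
  shows "winding (\<gamma> \<circ> cnj) (- m) (- n)"
proof -
  obtain p where p: "curve_lift \<gamma> p" "p 1 - p 0 = Complex (of_int m) (of_int n)"
    using assms by (auto simp: winding_def)
  have "curve_lift (\<gamma> \<circ> cnj) (\<lambda>t. p (1 - t))"
    unfolding curve_lift_def
  proof (intro conjI ballI)
    have "continuous_on {0..1} p" using p(1) by (simp add: curve_lift_def)
    then show "continuous_on {0..1::real} (\<lambda>t. p (1 - t))"
      by (rule continuous_on_compose2) (auto intro!: continuous_intros)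
    fix t :: real assume "t \<in> {0..1}"
    then have "\<gamma> (cis (2 * pi * (1 - t))) = torus_cover (p (1 - t))" using p(1) by (simp add: curve_lift_def)
    moreover have "cis (2 * pi * (1 - t)) = cnj (cis (2 * pi * t))"
    proof -
      have "cis (2 * pi * (1 - t)) = cis (2 * pi * (- t))" unfolding cis_2pi_eq_iff by (rule exI[of _ 1]) simp
      then show ?thesis by (simp add: cis_cnj)
    qed
    ultimately show "(\<gamma> \<circ> cnj) (cis (2 * pi * t)) = torus_cover (p (1 - t))" by simp
  qed
  moreover have "p (1 - 1) - p (1 - 0) = Complex (of_int (- m)) (of_int (- n))"
    using p(2) by (simp add: complex_eq_iff)
  ultimately show ?thesis unfolding winding_def by (intro exI[of _ "\<lambda>t. p (1 - t)"]) simp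
qed

lemma embedding_cnj:
  assumes "embedding_map circle X \<gamma>"
  shows "embedding_map circle X (\<gamma> \<circ> cnj)" "(\<gamma> \<circ> cnj) ` sphere 0 1 = \<gamma> ` sphere 0 1"
proof -
  have im: "cnj ` sphere 0 1 = sphere 0 1"
    by (auto intro!: image_eqI[of _ _ "cnj _"])
  have "homeomorphic_maps circle circle cnj cnj"
    by (auto simp: homeomorphic_maps_def intro!: continuous_intros)
  then have "homeomorphic_map circle circle cnj" using homeomorphic_maps_map by blast
  then show "embedding_map circle X (\<gamma> \<circ> cnj)"
    using assms embedding_map_compose homeomorphic_imp_embedding_map by blast
  show "(\<gamma> \<circ> cnj) ` sphere 0 1 = \<gamma> ` sphere 0 1" using im by (metis image_comp)
qed


section \<open>The first homology group of the torus\<close>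

definition path_simplex :: "(real \<Rightarrow> 'a) \<Rightarrow> (nat \<Rightarrow> real) \<Rightarrow> 'a" where
  "path_simplex r = restrict (\<lambda>x. r (x 1)) (standard_simplex 1)"

definition point_simplex :: "'a \<Rightarrow> (nat \<Rightarrow> real) \<Rightarrow> 'a" where
  "point_simplex a = restrict (\<lambda>x. a) (standard_simplex 0)"

lemma powertop_real_eq_euclidean: "powertop_real UNIV = (euclidean :: (nat \<Rightarrow> real) topology)"
  using euclidean_product_topology .

lemma continuous_on_coordinate: "continuous_on S (\<lambda>x::nat \<Rightarrow> real. x i)"
  by (rule continuous_on_subset[OF continuous_on_product_coordinates]) auto

lemma singular_simplex_eucl:
  "singular_simplex p (top_of_set S) f \<longleftrightarrow>
     continuous_on (standard_simplex p) f \<and> f ` standard_simplex p \<subseteq> S \<and> f \<in> extensional (standard_simplex p)"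
  unfolding singular_simplex_def powertop_real_eq_euclidean by (auto simp: image_subset_iff_funcset)

lemma restrict_eqI: "A = B \<Longrightarrow> (\<And>x. x \<in> A \<Longrightarrow> f x = g x) \<Longrightarrow> restrict f A = restrict g B"
  by auto

lemma path_simplex_eq_iff:
  assumes "\<And>t. t \<in> {0..1} \<Longrightarrow> r t = s t"
  shows "path_simplex r = path_simplex s"
  unfolding path_simplex_def using assms by (intro restrict_ext) (auto simp: standard_simplex_def)

lemma continuous_on_restrict_iff: "continuous_on S (restrict f S) \<longleftrightarrow> continuous_on S f"
  by (rule continuous_on_cong) auto

lemma singular_simplex_path_simplex:
  assumes "continuous_on {0..1} r" "r ` {0..1} \<subseteq> S"
  shows "singular_simplex 1 (top_of_set S) (path_simplex r)"
proof -
  have sub: "(\<lambda>x. x 1) ` standard_simplex 1 \<subseteq> {0..1::real}" by (auto simp: standard_simplex_def)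
  then have "continuous_on (standard_simplex 1) (\<lambda>x. r (x 1))"
    by (intro continuous_on_compose2[OF assms(1) continuous_on_coordinate])
  then show ?thesis unfolding singular_simplex_eucl path_simplex_def continuous_on_restrict_iff
    using sub assms(2) by (auto simp: image_subset_iff)
qed

lemma point_coord: "(\<lambda>i. if i = (k::nat) then 1 else 0) \<in> standard_simplex p" if "k \<le> p"
  using that by (auto simp: standard_simplex_def)

lemma standard_simplex_0: "x \<in> standard_simplex 0 \<Longrightarrow> x = (\<lambda>i. if i = 0 then 1 else 0)"
  by (auto simp: standard_simplex_def fun_eq_iff)

text \<open>The parameter of the path is the coordinate \<open>x 1\<close>, and face 0 omits the
  vertex where it is 0; so face 0 is the end point.\<close>

lemma chain_boundary_path_simplex:
  "chain_boundary 1 (frag_of (path_simplex r)) = frag_of (point_simplex (r 1)) - frag_of (point_simplex (r 0))"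
proof -
  have "singular_face 1 0 (path_simplex r) = point_simplex (r 1)"
    unfolding singular_face_def point_simplex_def
  proof (rule restrict_eqI)
    fix x :: "nat \<Rightarrow> real" assume x: "x \<in> standard_simplex (1 - Suc 0)"
    then have "x = (\<lambda>i. if i = 0 then 1 else 0)" by (simp add: standard_simplex_0)
    then show "(path_simplex r \<circ> simplical_face 0) x = r 1"
      using simplical_face_in_standard_simplex[of 1 0 x] x by (simp add: path_simplex_def simplical_face_def)
  qed simp
  moreover have "singular_face 1 1 (path_simplex r) = point_simplex (r 0)"
    unfolding singular_face_def point_simplex_def
  proof (rule restrict_eqI)
    fix x :: "nat \<Rightarrow> real" assume x: "x \<in> standard_simplex (1 - Suc 0)"
    then have "x = (\<lambda>i. if i = 0 then 1 else 0)" by (simp add: standard_simplex_0)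
    then show "(path_simplex r \<circ> simplical_face 1) x = r 0"
      using simplical_face_in_standard_simplex[of 1 1 x] x by (simp add: path_simplex_def simplical_face_def)
  qed simp
  ultimately show ?thesis by (simp add: chain_boundary_of)
qed

definition line_simplex :: "complex \<Rightarrow> (nat \<Rightarrow> real) \<Rightarrow> complex \<times> complex" where
  "line_simplex a = path_simplex (\<lambda>t. torus_cover (t *\<^sub>R a))"

text \<open>The cone from the origin over a path in the universal cover.\<close>

lemma homologous_cone:
  assumes p: "continuous_on {0..1} p"
  shows "homologous_rel 1 torus {} (frag_of (path_simplex (\<lambda>t. torus_cover (p t))))
           (frag_of (line_simplex (p 1)) - frag_of (line_simplex (p 0)))"
proof -
  \<comment> \<open>A constant extension beyond [0, 1], so that the path stays bounded and
    continuous at all arguments that the quotient in the cone formula may take.\<close>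
  define q where "q = (\<lambda>t. p (max 0 (min 1 t)))"
  have cq: "continuous_on UNIV q" unfolding q_def
    by (rule continuous_on_compose2[OF p]) (auto intro!: continuous_intros)
  have "compact (p ` {0..1})" using p by (intro compact_continuous_image) auto
  then have "bounded (p ` {0..1})" by (rule compact_imp_bounded)
  then obtain B where "\<forall>x\<in>p ` {0..1}. cmod x \<le> B" unfolding bounded_iff ..
  then have B: "\<And>t. t \<in> {0..1} \<Longrightarrow> cmod (p t) \<le> B" by simp
  then have Bq: "cmod (q t) \<le> B" for t unfolding q_def by (intro B) auto
  \<comment> \<open>Here \<open>u\<close> is the barycentric weight \<open>x 0\<close> of the apex
    0, \<open>v\<close> is \<open>x 2\<close>, and v / (1 - u) is the parameter on the opposite
    side. Boundedness of \<open>q\<close> gives continuity at the apex u = 1. The faces 0, 1, 2 are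
    the path, the line to \<open>p 1\<close> and the line to \<open>p 0\<close>.\<close>
  define g where "g = (\<lambda>(u, v). (1 - u) *\<^sub>R q (v / (1 - u)))"
  have g: "isCont g (u, v)" for u v :: real
  proof (cases "u = 1")
    case False
    have "continuous_on {x::real\<times>real. fst x \<noteq> 1} g"
      unfolding g_def case_prod_unfold
      by (intro continuous_intros continuous_on_compose2[OF cq]) auto
    moreover have "open {x::real\<times>real. fst x \<noteq> 1}"
      by (intro open_Collect_neq continuous_intros)
    ultimately show ?thesis using False by (auto simp: continuous_on_eq_continuous_at)
  next
    case True
    have "((\<lambda>x. \<bar>1 - fst x\<bar> * B) \<longlongrightarrow> \<bar>1 - fst (u, v)\<bar> * B) (at (u, v))" by (intro tendsto_intros)
    then have lim: "((\<lambda>x. \<bar>1 - fst x\<bar> * B) \<longlongrightarrow> 0) (at (u, v))" using True by simp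
    have "(g \<longlongrightarrow> 0) (at (u, v))"
      by (rule Lim_null_comparison[OF _ lim]) (auto simp: g_def case_prod_unfold mult_left_mono Bq)
    then show ?thesis using True by (simp add: isCont_def g_def)
  qed
  define D where "D = restrict (\<lambda>x::nat \<Rightarrow> real. torus_cover (g (x 0, x 2))) (standard_simplex 2)"
  have "continuous_on UNIV g" using g by (simp add: continuous_at_imp_continuous_on)
  then have "continuous_on (standard_simplex 2) (\<lambda>x. g (x 0, x 2))"
    by (rule continuous_on_compose2) (auto intro!: continuous_on_Pair continuous_on_coordinate)
  then have "continuous_on (standard_simplex 2) (\<lambda>x. torus_cover (g (x 0, x 2)))"
    by (rule continuous_on_compose2[OF continuous_torus_cover[of UNIV]]) auto
  then have sD: "singular_simplex 2 torus D"
    unfolding torus_eq singular_simplex_eucl D_def continuous_on_restrict_iff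
    by (simp add: image_subset_iff torus_cover_in_torus del: mem_Times_iff)
  have std1: "x 0 + x 1 = 1 \<and> 0 \<le> x 0 \<and> x 0 \<le> 1 \<and> 0 \<le> x 1 \<and> x 1 \<le> 1" if "x \<in> standard_simplex 1" for x
    using that by (auto simp: standard_simplex_def)
  have sf: "simplical_face k x \<in> standard_simplex 2" if "x \<in> standard_simplex 1" "k \<le> 2" for x :: "nat \<Rightarrow> real" and k
    using simplical_face_in_standard_simplex[of 2 k x] that by (simp add: numeral_2_eq_2)
  have f0: "singular_face 2 0 D = path_simplex (\<lambda>t. torus_cover (p t))"
    unfolding singular_face_def path_simplex_def
  proof (rule restrict_eqI)
    fix x :: "nat \<Rightarrow> real" assume x: "x \<in> standard_simplex (2 - Suc 0)"
    then show "(D \<circ> simplical_face 0) x = torus_cover (p (x 1))"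
      using sf[of x 0] std1[of x] by (simp add: D_def simplical_face_def g_def q_def)
  qed simp
  have f1: "singular_face 2 1 D = line_simplex (p 1)"
    unfolding singular_face_def path_simplex_def line_simplex_def
  proof (rule restrict_eqI)
    fix x :: "nat \<Rightarrow> real" assume x: "x \<in> standard_simplex (2 - Suc 0)"
    then have e: "x 0 = 1 - x 1" using std1[of x] by simp
    then have "g (x 0, x 1) = x 1 *\<^sub>R p 1" using e by (cases "x 1 = 0") (auto simp: g_def q_def)
    then show "(D \<circ> simplical_face 1) x = torus_cover (x 1 *\<^sub>R p 1)"
      using sf[of x 1] x by (simp add: D_def simplical_face_def)
  qed simp
  have f2: "singular_face 2 2 D = line_simplex (p 0)"
    unfolding singular_face_def path_simplex_def line_simplex_def
  proof (rule restrict_eqI)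
    fix x :: "nat \<Rightarrow> real" assume x: "x \<in> standard_simplex (2 - Suc 0)"
    then have e: "1 - x 0 = x 1" using std1[of x] by simp
    show "(D \<circ> simplical_face 2) x = torus_cover (x 1 *\<^sub>R p 0)"
      using sf[of x 2] x by (simp add: D_def simplical_face_def g_def q_def e)
  qed simp
  have "chain_boundary 2 (frag_of D) = frag_of (path_simplex (\<lambda>t. torus_cover (p t))) - frag_of (line_simplex (p 1)) + frag_of (line_simplex (p 0))"
    using f0 f1 f2 by (simp add: chain_boundary_of numeral_2_eq_2)
  moreover have "singular_chain 2 torus (frag_of D)" using sD by (simp add: singular_chain_of)
  ultimately have "singular_relboundary 1 torus {} (frag_of (path_simplex (\<lambda>t. torus_cover (p t))) - frag_of (line_simplex (p 1)) + frag_of (line_simplex (p 0)))"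
    unfolding singular_boundary by (auto simp: numeral_2_eq_2)
  then show ?thesis unfolding homologous_rel_def by (simp add: algebra_simps)
qed

definition lattice_point :: "int \<Rightarrow> int \<Rightarrow> complex" where
  "lattice_point m n = Complex (of_int m) (of_int n)"

lemma torus_cover_lattice: "torus_cover (u + lattice_point m n) = torus_cover u"
  unfolding torus_cover_eq_iff lattice_point_def by blast

abbreviation hom1 :: "(complex \<times> complex) chain \<Rightarrow> (complex \<times> complex) chain \<Rightarrow> bool" where
  "hom1 \<equiv> homologous_rel 1 torus {}"

lemma homologous_rel_cong_left:
  "homologous_rel p X S a a' \<Longrightarrow> homologous_rel p X S a b \<longleftrightarrow> homologous_rel p X S a' b"
  using homologous_rel_eq[of p X S a a'] by simp

text \<open>A straight path starting at a lattice point projects to the same simplex as its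
  translate starting at 0; the cone formula for this path is the claim.\<close>

lemma homologous_line_add:
  "hom1 (frag_of (line_simplex (lattice_point m n + a)))
     (frag_of (line_simplex (lattice_point m n)) + frag_of (line_simplex a))"
proof -
  have "continuous_on {0..1} (\<lambda>t::real. lattice_point m n + t *\<^sub>R a)" by (intro continuous_intros)
  from homologous_cone[OF this]
  have "hom1 (frag_of (path_simplex (\<lambda>t. torus_cover (lattice_point m n + t *\<^sub>R a))))
      (frag_of (line_simplex (lattice_point m n + a)) - frag_of (line_simplex (lattice_point m n)))" by simp
  moreover have "path_simplex (\<lambda>t. torus_cover (lattice_point m n + t *\<^sub>R a)) = line_simplex a"
    unfolding line_simplex_def using torus_cover_lattice by (metis add.commute)
  ultimately have "hom1 (frag_of (line_simplex a)) (frag_of (line_simplex (lattice_point m n + a)) - frag_of (line_simplex (lattice_point m n)))"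
    by simp
  from homologous_rel_add[OF homologous_rel_refl[of 1 torus "{}" "frag_of (line_simplex (lattice_point m n))"] this]
  show ?thesis by (simp add: homologous_rel_sym)
qed

lemma homologous_lattice_line:
  "hom1 (frag_of (line_simplex (lattice_point m n)))
     (frag_cmul m (frag_of (line_simplex 1)) + frag_cmul n (frag_of (line_simplex \<i>)))"
proof -
  define P where "P = (\<lambda>m n. hom1 (frag_of (line_simplex (lattice_point m n)))
     (frag_cmul m (frag_of (line_simplex 1)) + frag_cmul n (frag_of (line_simplex \<i>))))"
  have lp: "lattice_point 1 0 = 1" "lattice_point 0 1 = \<i>" "lattice_point 0 0 = 0"
    by (auto simp: lattice_point_def complex_eq_iff)
  have add: "lattice_point a b + lattice_point c d = lattice_point (a + c) (b + d)" for a b c d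
    by (auto simp: lattice_point_def complex_eq_iff)
  have step: "hom1 (frag_of (line_simplex (lattice_point (a + c) (b + d))))
     (frag_of (line_simplex (lattice_point a b)) + frag_of (line_simplex (lattice_point c d)))" for a b c d
    using homologous_line_add[of a b "lattice_point c d"] by (simp add: add)
  \<comment> \<open>Adding 0 to 0 shows that \<open>line_simplex 0\<close> is homologous to twice
    itself, hence a boundary.\<close>
  have P00: "P 0 0"
  proof -
    have "singular_relboundary 1 torus {} (- frag_of (line_simplex 0))"
      using homologous_line_add[of 0 0 0] by (simp add: homologous_rel_def lp)
    then have "singular_relboundary 1 torus {} (frag_of (line_simplex 0))"
      by (simp only: singular_relboundary_minus)
    then show ?thesis by (simp add: P_def lp homologous_rel_def)
  qed
  \<comment> \<open>An equivalence, since the induction over the integers runs in both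
    directions.\<close>
  have Pa: "P (a + 1) b \<longleftrightarrow> P a b" for a b
  proof -
    have e: "frag_cmul (a + 1) (frag_of (line_simplex 1)) = frag_cmul a (frag_of (line_simplex 1)) + frag_of (line_simplex 1)"
      by (simp add: frag_cmul_distrib)
    have s: "hom1 (frag_of (line_simplex (lattice_point (a + 1) b))) (frag_of (line_simplex (lattice_point a b)) + frag_of (line_simplex 1))"
      using step[of a 1 b 0] by (simp add: lp)
    let ?X = "frag_of (line_simplex (lattice_point a b))" and ?A = "frag_cmul a (frag_of (line_simplex 1))"
      and ?B = "frag_cmul b (frag_of (line_simplex \<i>))" and ?l = "frag_of (line_simplex 1)"
    have "P (a + 1) b \<longleftrightarrow> hom1 (?X + ?l) (?A + ?l + ?B)"
      unfolding P_def e by (rule homologous_rel_cong_left[OF s])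
    also have "?X + ?l - (?A + ?l + ?B) = ?X - (?A + ?B)" by (simp add: algebra_simps)
    then have "hom1 (?X + ?l) (?A + ?l + ?B) \<longleftrightarrow> P a b" unfolding P_def homologous_rel_def by (rule arg_cong)
    finally show ?thesis .
  qed
  have Pb: "P a (b + 1) \<longleftrightarrow> P a b" for a b
  proof -
    have e: "frag_cmul (b + 1) (frag_of (line_simplex \<i>)) = frag_cmul b (frag_of (line_simplex \<i>)) + frag_of (line_simplex \<i>)"
      by (simp add: frag_cmul_distrib)
    have s: "hom1 (frag_of (line_simplex (lattice_point a (b + 1)))) (frag_of (line_simplex (lattice_point a b)) + frag_of (line_simplex \<i>))"
      using step[of a 0 b 1] by (simp add: lp)
    let ?X = "frag_of (line_simplex (lattice_point a b))" and ?A = "frag_cmul a (frag_of (line_simplex 1))"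
      and ?B = "frag_cmul b (frag_of (line_simplex \<i>))" and ?l = "frag_of (line_simplex \<i>)"
    have "P a (b + 1) \<longleftrightarrow> hom1 (?X + ?l) (?A + (?B + ?l))"
      unfolding P_def e by (rule homologous_rel_cong_left[OF s])
    also have "?X + ?l - (?A + (?B + ?l)) = ?X - (?A + ?B)" by (simp add: algebra_simps)
    then have "hom1 (?X + ?l) (?A + (?B + ?l)) \<longleftrightarrow> P a b" unfolding P_def homologous_rel_def by (rule arg_cong)
    finally show ?thesis .
  qed
  have "P a 0" for a
    by (induction a rule: int_induct[where k = 0]) (use P00 Pa[of _ 0] Pa[of "_ - 1" 0] in auto)
  then have "P a b" for a b
    by (induction b rule: int_induct[where k = 0]) (use Pb[of a] Pb[of a "_ - 1"] in auto)
  then show ?thesis by (simp add: P_def)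
qed

text \<open>The cone formula with both ends split into a lattice part, which contributes to the
  coefficients, and a remainder. When remainders are fixed lifts of points of the torus, their
  contribution is a function of the boundary of the simplex.\<close>

lemma homologous_lifted_path:
  assumes p: "continuous_on {0..1} p" "p 1 = lattice_point m n + a" "p 0 = lattice_point m' n' + b"
  shows "hom1 (frag_of (path_simplex (\<lambda>t. torus_cover (p t))))
    (frag_cmul (m - m') (frag_of (line_simplex 1)) + frag_cmul (n - n') (frag_of (line_simplex \<i>))
      + (frag_of (line_simplex a) - frag_of (line_simplex b)))"
proof -
  let ?L = "\<lambda>a. frag_of (line_simplex a)"
  let ?G = "\<lambda>m n. frag_cmul m (?L 1) + frag_cmul n (?L \<i>)"
  have 1: "hom1 (?L (lattice_point m n + a)) (?G m n + ?L a)" for m n a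
    by (rule homologous_rel_trans[OF _ homologous_line_add]) (intro homologous_rel_add homologous_lattice_line homologous_rel_refl)
  have "hom1 (frag_of (path_simplex (\<lambda>t. torus_cover (p t)))) (?L (p 1) - ?L (p 0))"
    by (rule homologous_cone[OF p(1)])
  moreover have "hom1 (?L (p 1) - ?L (p 0)) ((?G m n + ?L a) - (?G m' n' + ?L b))"
    unfolding p(2,3) by (intro homologous_rel_diff 1)
  moreover have "(?G m n + ?L a) - (?G m' n' + ?L b) = ?G (m - m') (n - n') + (?L a - ?L b)"
    by (simp add: frag_cmul_diff_distrib algebra_simps) 
  ultimately show ?thesis using homologous_rel_trans[of 1 torus "{}"] by simp
qed

lemma singular_1_simplex_as_path:
  assumes "singular_simplex 1 X f"
  shows "f = path_simplex (\<lambda>t. f (\<lambda>i. if i = 0 then 1 - t else if i = 1 then t else 0))"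
proof
  fix x
  show "f x = path_simplex (\<lambda>t. f (\<lambda>i. if i = 0 then 1 - t else if i = 1 then t else 0)) x"
  proof (cases "x \<in> standard_simplex 1")
    case True
    then have "x 0 + x 1 = 1" "\<And>i. i > 1 \<Longrightarrow> x i = 0" by (auto simp: standard_simplex_def)
    then have "x = (\<lambda>i. if i = 0 then 1 - x 1 else if i = 1 then x 1 else 0)"
      by (auto simp: fun_eq_iff)
    then show ?thesis using True unfolding path_simplex_def by simp
  next
    case False
    then show ?thesis using assms by (simp add: path_simplex_def singular_simplex_def extensional_def)
  qed
qed

text \<open>The last term only depends on \<open>chain_boundary 1 c\<close>, hence vanishes for cycles.\<close>

lemma homologous_torus_chain:
  assumes "singular_chain 1 torus c"
  shows "\<exists>m n. hom1 c (frag_cmul m (frag_of (line_simplex 1)) + frag_cmul n (frag_of (line_simplex \<i>))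
     + frag_extend (\<lambda>\<tau>. frag_of (line_simplex (SOME u. torus_cover u = \<tau> (\<lambda>i. if i = 0 then 1 else 0)))) (chain_boundary 1 c))"
proof -
  let ?L = "\<lambda>a. frag_of (line_simplex a)"
  \<comment> \<open>An arbitrary, discontinuous section of the covering, applied to vertices of
    simplices; \<open>K\<close> replaces each vertex by the line to its chosen lift.\<close>
  define s where "s = (\<lambda>x. SOME u. torus_cover u = x)"
  define K where "K = frag_extend (\<lambda>\<tau>. ?L (s (\<tau> (\<lambda>i::nat. if i = 0 then 1 else (0::real)))))"
  have "\<exists>m n. hom1 c (frag_cmul m (?L 1) + frag_cmul n (?L \<i>) + K (chain_boundary 1 c))"
    using assms unfolding singular_chain_def
  proof (induction c rule: frag_induction)
    case zero
    have "hom1 0 (frag_cmul 0 (?L 1) + frag_cmul 0 (?L \<i>) + K (chain_boundary 1 0))" by (simp add: K_def)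
    then show ?case by blast
  next
    case (one f)
    then have f: "singular_simplex 1 torus f" by simp
    define r where "r = (\<lambda>t. f (\<lambda>i. if i = 0 then 1 - t else if i = 1 then t else 0))"
    have fr: "f = path_simplex r" unfolding r_def by (rule singular_1_simplex_as_path[OF f])
    have cf: "continuous_on (standard_simplex 1) f" "f ` standard_simplex 1 \<subseteq> sphere 0 1 \<times> sphere 0 1"
      using f unfolding torus_eq singular_simplex_eucl by auto
    have std: "(\<lambda>i. if i = 0 then 1 - t else if i = 1 then t else 0) \<in> standard_simplex 1" if "t \<in> {0..1}" for t :: real
      using that by (auto simp: standard_simplex_def)
    have "continuous_on {0..1} (\<lambda>t::real. (\<lambda>i::nat. if i = 0 then 1 - t else if i = 1 then t else 0))"
    proof (rule continuous_on_coordinatewise_then_product)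
      show "continuous_on {0..1} (\<lambda>t::real. if i = 0 then 1 - t else if i = 1 then t else 0)" for i :: nat
        by (cases "i = 0"; cases "i = 1") (auto intro!: continuous_intros)
    qed
    then have "continuous_on {0..1} r" unfolding r_def
      by (rule continuous_on_compose2[OF cf(1)]) (use std in blast)
    moreover have "r ` {0..1} \<subseteq> sphere 0 1 \<times> sphere 0 1" using cf(2) std unfolding r_def by blast
    ultimately obtain p where p: "continuous_on {0..1} p" "\<And>t. t \<in> {0..1} \<Longrightarrow> r t = torus_cover (p t)"
      using torus_path_lift by metis
    have fp: "f = path_simplex (\<lambda>t. torus_cover (p t))" unfolding fr using p(2) by (rule path_simplex_eq_iff)
    have sx: "torus_cover (s (torus_cover u)) = torus_cover u" for u
      unfolding s_def by (rule someI) simp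
    have lift: "\<exists>m n. u = lattice_point m n + s (torus_cover u)" for u
      using sx[of u, symmetric, unfolded torus_cover_eq_iff] unfolding lattice_point_def by (metis add.commute)
    obtain m n where mn: "p 1 = lattice_point m n + s (r 1)" using lift[of "p 1"] p(2)[of 1] by auto
    obtain m' n' where mn': "p 0 = lattice_point m' n' + s (r 0)" using lift[of "p 0"] p(2)[of 0] by auto
    have "K (chain_boundary 1 (frag_of f)) = ?L (s (r 1)) - ?L (s (r 0))"
      unfolding fr chain_boundary_path_simplex K_def
      by (simp add: frag_extend_diff point_simplex_def point_coord)
    then show ?case using homologous_lifted_path[OF p(1) mn mn'] unfolding fp[symmetric]
      by (intro exI[of _ "m - m'"] exI[of _ "n - n'"]) simp
  next
    case (diff a b)
    then obtain m n m' n' where 1: "hom1 a (frag_cmul m (?L 1) + frag_cmul n (?L \<i>) + K (chain_boundary 1 a))"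
      "hom1 b (frag_cmul m' (?L 1) + frag_cmul n' (?L \<i>) + K (chain_boundary 1 b))" by blast
    have "K (chain_boundary 1 (a - b)) = K (chain_boundary 1 a) - K (chain_boundary 1 b)"
      by (simp add: K_def frag_extend_diff chain_boundary_diff)
    then have "(frag_cmul m (?L 1) + frag_cmul n (?L \<i>) + K (chain_boundary 1 a)) - (frag_cmul m' (?L 1) + frag_cmul n' (?L \<i>) + K (chain_boundary 1 b))
       = frag_cmul (m - m') (?L 1) + frag_cmul (n - n') (?L \<i>) + K (chain_boundary 1 (a - b))"
      by (simp add: frag_cmul_diff_distrib algebra_simps)
    then show ?case using homologous_rel_diff[OF 1] by metis
  qed
  then show ?thesis unfolding K_def s_def .
qed

section \<open>From chains to homology groups: generators for the torus and the circle\<close>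

declare prod_topology_subtopology_eu [simp del] One_nat_def [simp del]

abbreviation H1 :: "'a topology \<Rightarrow> 'a chain set monoid" where
  "H1 X \<equiv> homology_group 1 X"

abbreviation hclass :: "'a topology \<Rightarrow> 'a chain \<Rightarrow> 'a chain set" where
  "hclass X c \<equiv> homologous_rel_set 1 X {} c"

lemma hclass_add:
  assumes "singular_relcycle 1 X {} a" "singular_relcycle 1 X {} b"
  shows "hclass X (a + b) = hclass X a \<otimes>\<^bsub>H1 X\<^esub> hclass X b"
proof -
  have "(\<lambda>a. {b. homologous_rel 1 X {} a b}) \<in> hom (relcycle_group 1 X {}) (homology_group (int 1) X)"
    using normal.r_coset_hom_Mod[OF normal_subgroup_singular_relboundary_relcycle[of 1 X "{}"]]
    unfolding right_coset_singular_relboundary nontrivial_relative_homology_group .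
  then show ?thesis using assms by (auto simp: hom_def Pi_iff)
qed

lemma hclass_carrier: "singular_relcycle 1 X {} a \<Longrightarrow> hclass X a \<in> carrier (H1 X)"
  using carrier_relative_homology_group[of 1 X "{}"] by auto

lemma hclass_cmul:
  assumes a: "singular_relcycle 1 X {} a"
  shows "hclass X (frag_cmul k a) = hclass X a [^]\<^bsub>H1 X\<^esub> (k::int)"
proof -
  interpret comm_group "H1 X" by simp
  have cyc: "singular_relcycle 1 X {} (frag_cmul k a)" for k using a by (simp add: singular_relcycle_cmul)
  have step: "hclass X (frag_cmul (k + 1) a) = hclass X (frag_cmul k a) \<otimes>\<^bsub>H1 X\<^esub> hclass X a" for k
    using hclass_add[OF cyc a] by (simp add: frag_cmul_distrib)
  have step': "hclass X a [^]\<^bsub>H1 X\<^esub> (k + 1) = hclass X a [^]\<^bsub>H1 X\<^esub> k \<otimes>\<^bsub>H1 X\<^esub> hclass X a" for k :: int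
    using hclass_carrier[OF a] int_pow_mult[of "hclass X a" k 1] by simp
  have iff: "hclass X (frag_cmul (k + 1) a) = hclass X a [^]\<^bsub>H1 X\<^esub> (k + 1) \<longleftrightarrow>
      hclass X (frag_cmul k a) = hclass X a [^]\<^bsub>H1 X\<^esub> k" for k :: int
    unfolding step step' by (rule right_cancel) (intro int_pow_closed hclass_carrier cyc a)+
  have 0: "hclass X (frag_cmul 0 a) = hclass X a [^]\<^bsub>H1 X\<^esub> (0::int)"
  proof -
    have "hclass X 0 = Collect (singular_relboundary 1 X {})"
      by (auto simp: homologous_rel_def singular_relboundary_minus)
    then show ?thesis using one_relative_homology_group[of 1 X "{}"] by simp
  qed
  show ?thesis
    by (induction k rule: int_induct[where k = 0]) (use 0 iff iff[of "_ - 1"] in auto)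
qed

lemma hom_induced_hclass:
  assumes "continuous_map X Y f" "singular_relcycle 1 X {} c"
  shows "hom_induced 1 X {} Y {} f (hclass X c) = hclass Y (chain_map 1 f c)"
  using hom_induced_chain_map[of X Y f "{}" "{}" 1 c] assms by simp

lemma closed_path_cycle:
  assumes "continuous_on {0..1} r" "r ` {0..1} \<subseteq> S" "r 0 = r 1"
  shows "singular_relcycle 1 (top_of_set S) {} (frag_of (path_simplex r))"
  unfolding singular_cycle chain_boundary_path_simplex singular_chain_of
  using singular_simplex_path_simplex[OF assms(1,2)] assms(3) by simp

lemma chain_map_path_simplex:
  "chain_map 1 f (frag_of (path_simplex r)) = frag_of (path_simplex (\<lambda>t. f (r t)))"
  unfolding chain_map_of simplex_map_def path_simplex_def by (auto intro!: arg_cong[of _ _ frag_of])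

definition circle_loop :: "complex chain" where
  "circle_loop = frag_of (path_simplex (\<lambda>t. cis (2 * pi * t)))"

lemma circle_loop_cycle: "singular_relcycle 1 circle {} circle_loop"
  unfolding circle_loop_def
  by (intro closed_path_cycle) (auto intro!: continuous_intros)

lemma line_cycle: "singular_relcycle 1 torus {} (frag_of (line_simplex (lattice_point m n)))"
  unfolding torus_eq line_simplex_def
proof (rule closed_path_cycle)
  show "continuous_on {0..1::real} (\<lambda>t. torus_cover (t *\<^sub>R lattice_point m n))"
    by (rule continuous_on_compose2[OF continuous_torus_cover[of UNIV]]) (auto intro!: continuous_intros)
  show "(\<lambda>t. torus_cover (t *\<^sub>R lattice_point m n)) ` {0..1} \<subseteq> sphere 0 1 \<times> sphere 0 1"
    using torus_cover_in_torus by blast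
  show "torus_cover (0 *\<^sub>R lattice_point m n) = torus_cover (1 *\<^sub>R lattice_point m n)"
    using torus_cover_lattice[of 0 m n] by simp
qed

lemma lattice_1i: "lattice_point 1 0 = 1" "lattice_point 0 1 = \<i>"
  by (auto simp: lattice_point_def complex_eq_iff)

definition torus_gen1 :: "(complex \<times> complex) chain set" where
  "torus_gen1 = hclass torus (frag_of (line_simplex 1))"

definition torus_gen2 :: "(complex \<times> complex) chain set" where
  "torus_gen2 = hclass torus (frag_of (line_simplex \<i>))"

lemma torus_gen_carrier: "torus_gen1 \<in> carrier (H1 torus)" "torus_gen2 \<in> carrier (H1 torus)"
  unfolding torus_gen1_def torus_gen2_def
  using hclass_carrier[OF line_cycle[of 1 0]] hclass_carrier[OF line_cycle[of 0 1]] by (auto simp: lattice_1i)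

lemma hclass_combination:
  "hclass torus (frag_cmul m (frag_of (line_simplex 1)) + frag_cmul n (frag_of (line_simplex \<i>)))
    = torus_gen1 [^]\<^bsub>H1 torus\<^esub> m \<otimes>\<^bsub>H1 torus\<^esub> torus_gen2 [^]\<^bsub>H1 torus\<^esub> n"
  using line_cycle[of 1 0] line_cycle[of 0 1]
  by (simp add: hclass_add hclass_cmul singular_relcycle_cmul lattice_1i torus_gen1_def torus_gen2_def)

lemma H1_torus_generated:
  assumes "x \<in> carrier (H1 torus)"
  obtains m n :: int where "x = torus_gen1 [^]\<^bsub>H1 torus\<^esub> m \<otimes>\<^bsub>H1 torus\<^esub> torus_gen2 [^]\<^bsub>H1 torus\<^esub> n"
proof -
  obtain c where c: "x = hclass torus c" "singular_relcycle 1 torus {} c"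
    using assms carrier_relative_homology_group[of 1 torus "{}"] by auto
  have "singular_chain 1 torus c" "chain_boundary 1 c = 0" using c(2) by (simp_all only: singular_cycle)
  then obtain m n where "hom1 c (frag_cmul m (frag_of (line_simplex 1)) + frag_cmul n (frag_of (line_simplex \<i>)))"
    using homologous_torus_chain[of c] by auto
  then have "x = hclass torus (frag_cmul m (frag_of (line_simplex 1)) + frag_cmul n (frag_of (line_simplex \<i>)))"
    unfolding c(1) homologous_rel_set_eq .
  then show ?thesis using that unfolding hclass_combination by blast
qed

text \<open>The lift runs from \<open>p 0\<close> to a lattice translate of \<open>p 0\<close>, so
  the two remainders in the cone formula cancel.\<close>

lemma hom_induced_circle_loop:
  assumes g: "continuous_map circle torus \<gamma>" and w: "winding \<gamma> m n"
  shows "hom_induced 1 circle {} torus {} \<gamma> (hclass circle circle_loop)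
     = torus_gen1 [^]\<^bsub>H1 torus\<^esub> m \<otimes>\<^bsub>H1 torus\<^esub> torus_gen2 [^]\<^bsub>H1 torus\<^esub> n"
proof -
  obtain p where p: "curve_lift \<gamma> p" "p 1 - p 0 = lattice_point m n"
    using w by (auto simp: winding_def lattice_point_def)
  have "path_simplex (\<lambda>t. \<gamma> (cis (2 * pi * t))) = path_simplex (\<lambda>t. torus_cover (p t))"
    using p(1) by (intro path_simplex_eq_iff) (auto simp: curve_lift_def)
  then have 1: "hom_induced 1 circle {} torus {} \<gamma> (hclass circle circle_loop)
      = hclass torus (frag_of (path_simplex (\<lambda>t. torus_cover (p t))))"
    using hom_induced_hclass[OF g circle_loop_cycle] unfolding circle_loop_def chain_map_path_simplex by simp
  have cp: "continuous_on {0..1} p" using p(1) by (simp add: curve_lift_def)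
  have "p 1 = lattice_point m n + p 0" using p(2) by (simp add: algebra_simps)
  moreover have "p 0 = lattice_point 0 0 + p 0" by (simp add: lattice_point_def complex_eq_iff)
  ultimately have "hom1 (frag_of (path_simplex (\<lambda>t. torus_cover (p t))))
      (frag_cmul m (frag_of (line_simplex 1)) + frag_cmul n (frag_of (line_simplex \<i>)))"
    using homologous_lifted_path[OF cp, of m n "p 0" 0 0 "p 0"] by simp
  then have "hclass torus (frag_of (path_simplex (\<lambda>t. torus_cover (p t))))
      = hclass torus (frag_cmul m (frag_of (line_simplex 1)) + frag_cmul n (frag_of (line_simplex \<i>)))"
    unfolding homologous_rel_set_eq .
  then show ?thesis using 1 unfolding hclass_combination by simp
qed

lemma winding_inclusions:
  "continuous_map circle torus (\<lambda>z. (z, 1))" "winding (\<lambda>z. (z, 1)) 1 0"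
  "continuous_map circle torus (\<lambda>z. (1, z))" "winding (\<lambda>z. (1, z)) 0 1"
proof -
  show "continuous_map circle torus (\<lambda>z. (z, 1))" "continuous_map circle torus (\<lambda>z. (1, z))"
    unfolding torus_eq by (auto intro!: continuous_intros)
  have "curve_lift (\<lambda>z. (z, 1)) (\<lambda>t. of_real t)"
    by (auto simp: curve_lift_def torus_cover_def intro!: continuous_intros)
  then show "winding (\<lambda>z. (z, 1)) 1 0" unfolding winding_def
    by (intro exI[of _ "\<lambda>t. of_real t"]) (auto simp: complex_eq_iff)
  have "curve_lift (\<lambda>z. (1, z)) (\<lambda>t. \<i> * of_real t)"
    by (auto simp: curve_lift_def torus_cover_def intro!: continuous_intros)
  then show "winding (\<lambda>z. (1, z)) 0 1" unfolding winding_def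
    by (intro exI[of _ "\<lambda>t. \<i> * of_real t"]) (auto simp: complex_eq_iff)
qed

lemma projections_continuous: "continuous_map torus circle fst" "continuous_map torus circle snd"
  by (simp_all add: continuous_map_fst continuous_map_snd)

lemma hom_induced_id_circle:
  assumes "x \<in> carrier (H1 circle)" "\<And>z. z \<in> sphere 0 1 \<Longrightarrow> f z = z"
  shows "hom_induced 1 circle {} circle {} f x = x"
proof -
  have "hom_induced 1 circle {} circle {} f = hom_induced 1 circle {} circle {} id"
    using assms(2) by (intro hom_induced_eq) auto
  then show ?thesis using hom_induced_id[OF assms(1)] by simp
qed

text \<open>The constant map factors through the torus, where a constant curve has winding (0, 0)
  and therefore trivial class.\<close>

lemma hom_induced_const_circle:
  "hom_induced 1 circle {} circle {} (\<lambda>z. 1) (hclass circle circle_loop) = \<one>\<^bsub>H1 circle\<^esub>"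
proof -
  have c: "continuous_map circle torus (\<lambda>z. (1, 1))" unfolding torus_eq by auto
  have "curve_lift (\<lambda>z. (1, 1)) (\<lambda>t. 0)" by (auto simp: curve_lift_def torus_cover_def)
  then have w: "winding (\<lambda>z. (1, 1)) 0 0" unfolding winding_def
    by (intro exI[of _ "\<lambda>t. 0"]) (auto simp: complex_eq_iff)
  interpret G: group "H1 torus" by simp
  have "hom_induced 1 circle {} torus {} (\<lambda>z. (1, 1)) (hclass circle circle_loop) = \<one>\<^bsub>H1 torus\<^esub>"
    using hom_induced_circle_loop[OF c w] by simp
  then have "hom_induced 1 torus {} circle {} fst (hom_induced 1 circle {} torus {} (\<lambda>z. (1, 1)) (hclass circle circle_loop)) = \<one>\<^bsub>H1 circle\<^esub>"
    using hom_one[OF hom_induced_empty_hom[of 1 torus circle fst]] by simp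
  moreover have "hom_induced 1 torus {} circle {} fst (hom_induced 1 circle {} torus {} (\<lambda>z. (1, 1)) (hclass circle circle_loop))
      = hom_induced 1 circle {} circle {} (fst \<circ> (\<lambda>z. (1, 1))) (hclass circle circle_loop)"
    using hom_induced_compose'[OF c _ projections_continuous(1), of "{}" "{}" "{}" 1] by simp
  ultimately show ?thesis by (simp add: o_def)
qed

text \<open>The two generators are the images of the loop under the inclusions of the coordinate
  circles, so functoriality restricts \<open>f\<close> to these circles.\<close>

lemma hom_induced_path_loop:
  assumes "continuous_map torus circle f"
  shows "hom_induced 1 torus {} circle {} f torus_gen1 = hom_induced 1 circle {} circle {} (\<lambda>z. f (z, 1)) (hclass circle circle_loop)"
    and "hom_induced 1 torus {} circle {} f torus_gen2 = hom_induced 1 circle {} circle {} (\<lambda>z. f (1, z)) (hclass circle circle_loop)"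
proof -
  interpret G: comm_group "H1 torus" by simp
  have "torus_gen1 = hom_induced 1 circle {} torus {} (\<lambda>z. (z, 1)) (hclass circle circle_loop)"
    using hom_induced_circle_loop[OF winding_inclusions(1,2)] torus_gen_carrier by simp
  then show "hom_induced 1 torus {} circle {} f torus_gen1 = hom_induced 1 circle {} circle {} (\<lambda>z. f (z, 1)) (hclass circle circle_loop)"
    using hom_induced_compose'[OF winding_inclusions(1) _ assms, of "{}" "{}" "{}" 1 "hclass circle circle_loop"]
    unfolding o_def by fastforce
  have "torus_gen2 = hom_induced 1 circle {} torus {} (\<lambda>z. (1, z)) (hclass circle circle_loop)"
    using hom_induced_circle_loop[OF winding_inclusions(3,4)] torus_gen_carrier by simp
  then show "hom_induced 1 torus {} circle {} f torus_gen2 = hom_induced 1 circle {} circle {} (\<lambda>z. f (1, z)) (hclass circle circle_loop)"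
    using hom_induced_compose'[OF winding_inclusions(3) _ assms, of "{}" "{}" "{}" 1 "hclass circle circle_loop"]
    unfolding o_def by fastforce
qed

text \<open>The circle is a retract of the torus: its classes are expressed by the generators of the
  torus and projected back, which kills the second generator.\<close>

lemma H1_circle_generated:
  assumes x: "x \<in> carrier (H1 circle)"
  obtains j :: int where "x = hclass circle circle_loop [^]\<^bsub>H1 circle\<^esub> j"
proof -
  interpret G: comm_group "H1 torus" by simp
  interpret C: comm_group "H1 circle" by simp
  let ?i = "hom_induced 1 circle {} torus {} (\<lambda>z. (z, 1))" and ?p = "hom_induced 1 torus {} circle {} fst"
  have pi: "?p (?i x) = x"
    using hom_induced_compose'[OF winding_inclusions(1) _ projections_continuous(1), of "{}" "{}" "{}" 1 x]
      hom_induced_id_circle[OF x, of "fst \<circ> (\<lambda>z. (z, 1))"] by simp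
  have "?i x \<in> carrier (H1 torus)" by (rule hom_in_carrier[OF hom_induced_empty_hom x])
  then obtain m n :: int where mn: "?i x = torus_gen1 [^]\<^bsub>H1 torus\<^esub> m \<otimes>\<^bsub>H1 torus\<^esub> torus_gen2 [^]\<^bsub>H1 torus\<^esub> n"
    by (rule H1_torus_generated)
  have hp: "?p \<in> hom (H1 torus) (H1 circle)" by (rule hom_induced_empty_hom)
  have lc: "hclass circle circle_loop \<in> carrier (H1 circle)" by (rule hclass_carrier[OF circle_loop_cycle])
  have g1: "?p torus_gen1 = hclass circle circle_loop"
    unfolding hom_induced_path_loop(1)[OF projections_continuous(1)] by (rule hom_induced_id_circle[OF lc]) simp
  have g2: "?p torus_gen2 = \<one>\<^bsub>H1 circle\<^esub>"
    unfolding hom_induced_path_loop(2)[OF projections_continuous(1)] using hom_induced_const_circle by simp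
  have "x = ?p (torus_gen1 [^]\<^bsub>H1 torus\<^esub> m \<otimes>\<^bsub>H1 torus\<^esub> torus_gen2 [^]\<^bsub>H1 torus\<^esub> n)" using pi mn by simp
  also have "\<dots> = ?p (torus_gen1 [^]\<^bsub>H1 torus\<^esub> m) \<otimes>\<^bsub>H1 circle\<^esub> ?p (torus_gen2 [^]\<^bsub>H1 torus\<^esub> n)"
    by (rule hom_mult[OF hp]) (intro G.int_pow_closed torus_gen_carrier)+
  also have "?p (torus_gen1 [^]\<^bsub>H1 torus\<^esub> m) = hclass circle circle_loop [^]\<^bsub>H1 circle\<^esub> m"
    using hom_int_pow[OF hp torus_gen_carrier(1) G.is_group C.is_group] g1 by simp
  also have "?p (torus_gen2 [^]\<^bsub>H1 torus\<^esub> n) = \<one>\<^bsub>H1 circle\<^esub>"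
    using hom_int_pow[OF hp torus_gen_carrier(2) G.is_group C.is_group] g2 by simp
  finally have "x = hclass circle circle_loop [^]\<^bsub>H1 circle\<^esub> m" using lc by simp
  then show ?thesis by (rule that)
qed

text \<open>Transported from the reduced homology of \<open>nsphere 1\<close>. Combined with
  cyclicity it says that a generator has infinite order.\<close>

lemma H1_circle_infinite: "infinite (carrier (H1 circle))"
proof -
  have "card (Basis :: complex set) = 2" by simp
  then obtain f :: "(nat \<Rightarrow> real) \<Rightarrow> complex" and g where
    "homeomorphic_maps (nsphere (2 - 1)) (top_of_set (sphere 0 1 \<inter> span Basis)) f g"
    using homeomorphic_maps_nsphere_euclidean_sphere[of "Basis :: complex set" 2]
      independent_Basis orthogonal_Basis by auto
  then have "homeomorphic_maps (nsphere 1) circle f g" by (simp add: span_Basis One_nat_def)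
  then have "nsphere 1 homeomorphic_space circle" unfolding homeomorphic_space_def by blast
  then have "H1 (nsphere 1) \<cong> H1 circle" by (rule homeomorphic_space_imp_isomorphic_homology_groups)
  moreover have "H1 (nsphere 1) \<cong> (integer_group :: int monoid)"
    using reduced_homology_group_nsphere(1)[of 1] un_reduced_homology_group[of 1 "nsphere 1"] by simp
  ultimately have "H1 circle \<cong> (integer_group :: int monoid)"
    by (meson group.iso_sym group_relative_homology_group iso_trans)
  then obtain \<phi> where "bij_betw \<phi> (carrier (H1 circle)) (carrier (integer_group :: int monoid))"
    unfolding is_iso_def iso_def by blast
  then have "finite (carrier (H1 circle)) \<longleftrightarrow> finite (carrier (integer_group :: int monoid))"
    by (rule bij_betw_finite)
  moreover have "carrier (integer_group :: int monoid) = (UNIV :: int set)" by (simp add: integer_group_def)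
  ultimately show ?thesis using infinite_UNIV_int by metis
qed

text \<open>\<open>circle_class\<close> is some generator, and the loop shows that there is one. As
  it generates an infinite group its \<open>ord\<close> is 0, the convention for infinite
  order.\<close>

lemma circle_class_props:
  shows circle_class_carrier: "circle_class \<in> carrier (H1 circle)"
    and circle_class_int_pow_eq: "circle_class [^]\<^bsub>H1 circle\<^esub> (m::int) = circle_class [^]\<^bsub>H1 circle\<^esub> n \<longleftrightarrow> m = n"
proof -
  interpret C: comm_group "H1 circle" by simp
  have lc: "hclass circle circle_loop \<in> carrier (H1 circle)" by (rule hclass_carrier[OF circle_loop_cycle])
  have "generate (H1 circle) {hclass circle circle_loop} = carrier (H1 circle)"
    unfolding C.generate_pow[OF lc] using H1_circle_generated lc by (auto intro: C.int_pow_closed)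
  then have ex: "\<exists>c. c \<in> carrier (H1 circle) \<and> generate (H1 circle) {c} = carrier (H1 circle)" using lc by blast
  have cc: "circle_class \<in> carrier (H1 circle) \<and> generate (H1 circle) {circle_class} = carrier (H1 circle)"
    unfolding circle_class_def by (rule someI_ex[OF ex])
  then show "circle_class \<in> carrier (H1 circle)" by blast
  have "C.ord circle_class = card (generate (H1 circle) {circle_class})"
    using cc by (intro C.generate_pow_card) blast
  also have "\<dots> = 0" using cc H1_circle_infinite by simp
  finally have "C.ord circle_class = 0" .
  then show "circle_class [^]\<^bsub>H1 circle\<^esub> (m::int) = circle_class [^]\<^bsub>H1 circle\<^esub> n \<longleftrightarrow> m = n"
    using C.int_pow_eq[of circle_class m n] cc by auto
qed

text \<open>The chosen \<open>circle_class\<close> is an unknown power \<open>j\<close> of the class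
  of the loop. This exponent enters both sides alike, so the formula does not depend on it.\<close>

lemma curve_class_winding:
  assumes g: "continuous_map circle torus \<gamma>" and w: "winding \<gamma> m n"
  shows "curve_class torus \<gamma> = curve_class torus (\<lambda>z. (z, 1)) [^]\<^bsub>H1 torus\<^esub> m
     \<otimes>\<^bsub>H1 torus\<^esub> curve_class torus (\<lambda>z. (1, z)) [^]\<^bsub>H1 torus\<^esub> n"
proof -
  interpret G: comm_group "H1 torus" by simp
  interpret C: comm_group "H1 circle" by simp
  have lc: "hclass circle circle_loop \<in> carrier (H1 circle)" by (rule hclass_carrier[OF circle_loop_cycle])
  obtain j :: int where j: "circle_class = hclass circle circle_loop [^]\<^bsub>H1 circle\<^esub> j"
    using H1_circle_generated[OF circle_class_carrier] .
  have cc: "curve_class torus \<delta> = (torus_gen1 [^]\<^bsub>H1 torus\<^esub> a \<otimes>\<^bsub>H1 torus\<^esub> torus_gen2 [^]\<^bsub>H1 torus\<^esub> b) [^]\<^bsub>H1 torus\<^esub> j"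
    if "continuous_map circle torus \<delta>" "winding \<delta> a b" for \<delta> a b
    unfolding curve_class_def j
    using hom_int_pow[OF hom_induced_empty_hom lc C.is_group G.is_group] hom_induced_circle_loop[OF that] by simp
  have e1: "curve_class torus (\<lambda>z. (z, 1)) = torus_gen1 [^]\<^bsub>H1 torus\<^esub> j"
    using cc[OF winding_inclusions(1,2)] torus_gen_carrier by simp
  have e2: "curve_class torus (\<lambda>z. (1, z)) = torus_gen2 [^]\<^bsub>H1 torus\<^esub> j"
    using cc[OF winding_inclusions(3,4)] torus_gen_carrier by simp
  show ?thesis unfolding cc[OF assms] e1 e2
    using torus_gen_carrier by (simp add: G.int_pow_distrib G.int_pow_pow mult.commute)
qed


section \<open>Slopes and the intersection pairing\<close>

lemma curve_class_compose:
  assumes "continuous_map circle X \<gamma>" "continuous_map X Y f"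
  shows "curve_class Y (f \<circ> \<gamma>) = hom_induced 1 X {} Y {} f (curve_class X \<gamma>)"
  unfolding curve_class_def using hom_induced_compose_empty[OF assms, of 1] by simp

lemma curve_class_cong:
  assumes "\<And>z. z \<in> sphere 0 1 \<Longrightarrow> \<gamma> z = \<delta> z"
  shows "curve_class X \<gamma> = curve_class X \<delta>"
proof -
  have "hom_induced 1 circle {} X {} \<gamma> = hom_induced 1 circle {} X {} \<delta>"
    using assms by (intro hom_induced_eq) auto
  then show ?thesis by (simp add: curve_class_def)
qed

lemma curve_class_carrier: "curve_class X \<gamma> \<in> carrier (H1 X)"
  unfolding curve_class_def by (rule hom_in_carrier[OF hom_induced_empty_hom circle_class_carrier])

lemma hom_induced_const_circle_class:
  "hom_induced 1 circle {} circle {} (\<lambda>z. 1) circle_class = \<one>\<^bsub>H1 circle\<^esub>"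
proof -
  interpret C: comm_group "H1 circle" by simp
  have lc: "hclass circle circle_loop \<in> carrier (H1 circle)" by (rule hclass_carrier[OF circle_loop_cycle])
  obtain j :: int where j: "circle_class = hclass circle circle_loop [^]\<^bsub>H1 circle\<^esub> j"
    using H1_circle_generated[OF circle_class_carrier] .
  show ?thesis unfolding j
    using hom_int_pow[OF hom_induced_empty_hom lc C.is_group C.is_group] hom_induced_const_circle by simp
qed

section \<open>Homology coordinates on a space homeomorphic to the torus\<close>

context
  fixes T :: "'a topology" and h k
  assumes hk: "homeomorphic_maps torus T h k"
begin

lemma torus_homeo_cont: "continuous_map torus T h" "continuous_map T torus k"
  using hk by (auto simp: homeomorphic_maps_def)

lemma torus_homeo_inverse:
  "x \<in> sphere 0 1 \<times> sphere 0 1 \<Longrightarrow> k (h x) = x" "y \<in> topspace T \<Longrightarrow> h (k y) = y"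
  using hk by (auto simp: homeomorphic_maps_def)

definition gen_class1 where "gen_class1 = curve_class T (\<lambda>z. h (z, 1))"
definition gen_class2 where "gen_class2 = curve_class T (\<lambda>z. h (1, z))"

text \<open>The curve is \<open>h\<close> after \<open>k \<circ> \<gamma>\<close>; the formula for
  the standard torus is pushed forward along \<open>h\<close>.\<close>

lemma curve_class_in_homeomorphic_torus:
  assumes g: "continuous_map circle T \<gamma>" and w: "winding (k \<circ> \<gamma>) m n"
  shows "curve_class T \<gamma> = gen_class1 [^]\<^bsub>H1 T\<^esub> m \<otimes>\<^bsub>H1 T\<^esub> gen_class2 [^]\<^bsub>H1 T\<^esub> n"
proof -
  interpret G: comm_group "H1 torus" by simp
  interpret H: comm_group "H1 T" by simp
  let ?h = "hom_induced 1 torus {} T {} h"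
  have hh: "?h \<in> hom (H1 torus) (H1 T)" by (rule hom_induced_empty_hom)
  have kg: "continuous_map circle torus (k \<circ> \<gamma>)" using g torus_homeo_cont by (metis continuous_map_compose)
  have "curve_class T \<gamma> = curve_class T (h \<circ> (k \<circ> \<gamma>))"
    using g torus_homeo_inverse(2) by (intro curve_class_cong) (auto simp: continuous_map_def Pi_iff)
  also have "\<dots> = ?h (curve_class torus (k \<circ> \<gamma>))" by (rule curve_class_compose[OF kg torus_homeo_cont(1)])
  also have "\<dots> = ?h (curve_class torus (\<lambda>z. (z, 1)) [^]\<^bsub>H1 torus\<^esub> m
     \<otimes>\<^bsub>H1 torus\<^esub> curve_class torus (\<lambda>z. (1, z)) [^]\<^bsub>H1 torus\<^esub> n)"
    by (simp only: curve_class_winding[OF kg w])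
  also have "\<dots> = ?h (curve_class torus (\<lambda>z. (z, 1)) [^]\<^bsub>H1 torus\<^esub> m)
     \<otimes>\<^bsub>H1 T\<^esub> ?h (curve_class torus (\<lambda>z. (1, z)) [^]\<^bsub>H1 torus\<^esub> n)"
    by (rule hom_mult[OF hh]) (intro G.int_pow_closed curve_class_carrier)+
  also have "?h (curve_class torus (\<lambda>z. (z, 1)) [^]\<^bsub>H1 torus\<^esub> m) = gen_class1 [^]\<^bsub>H1 T\<^esub> m"
    using hom_int_pow[OF hh curve_class_carrier G.is_group H.is_group]
      curve_class_compose[OF winding_inclusions(1) torus_homeo_cont(1)] by (simp add: gen_class1_def o_def)
  also have "?h (curve_class torus (\<lambda>z. (1, z)) [^]\<^bsub>H1 torus\<^esub> n) = gen_class2 [^]\<^bsub>H1 T\<^esub> n"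
    using hom_int_pow[OF hh curve_class_carrier G.is_group H.is_group]
      curve_class_compose[OF winding_inclusions(3) torus_homeo_cont(1)] by (simp add: gen_class2_def o_def)
  finally show ?thesis .
qed

lemma project_gen_classes:
  assumes f: "continuous_map torus circle f"
  defines "P \<equiv> hom_induced 1 T {} circle {} (f \<circ> k)"
  shows "P (gen_class1 [^]\<^bsub>H1 T\<^esub> (m::int) \<otimes>\<^bsub>H1 T\<^esub> gen_class2 [^]\<^bsub>H1 T\<^esub> (n::int)) =
     (curve_class circle (\<lambda>z. f (z, 1)) [^]\<^bsub>H1 circle\<^esub> m) \<otimes>\<^bsub>H1 circle\<^esub> (curve_class circle (\<lambda>z. f (1, z)) [^]\<^bsub>H1 circle\<^esub> n)"
proof -
  interpret C: comm_group "H1 circle" by simp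
  interpret H: comm_group "H1 T" by simp
  have hP: "P \<in> hom (H1 T) (H1 circle)" unfolding P_def by (rule hom_induced_empty_hom)
  have fk: "continuous_map T circle (f \<circ> k)" using f torus_homeo_cont by (metis continuous_map_compose)
  have c1: "continuous_map circle T (\<lambda>z. h (z, 1))" "continuous_map circle T (\<lambda>z. h (1, z))"
    using continuous_map_compose[OF winding_inclusions(1) torus_homeo_cont(1)]
      continuous_map_compose[OF winding_inclusions(3) torus_homeo_cont(1)] by (auto simp: o_def)
  have 1: "P gen_class1 = curve_class circle (\<lambda>z. f (z, 1))"
    unfolding P_def gen_class1_def curve_class_compose[OF c1(1) fk, symmetric]
    by (rule curve_class_cong) (simp add: torus_homeo_inverse)
  have 2: "P gen_class2 = curve_class circle (\<lambda>z. f (1, z))"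
    unfolding P_def gen_class2_def curve_class_compose[OF c1(2) fk, symmetric]
    by (rule curve_class_cong) (simp add: torus_homeo_inverse)
  have cc: "gen_class1 \<in> carrier (H1 T)" "gen_class2 \<in> carrier (H1 T)"
    by (simp_all add: gen_class1_def gen_class2_def curve_class_carrier)
  have "P (gen_class1 [^]\<^bsub>H1 T\<^esub> m \<otimes>\<^bsub>H1 T\<^esub> gen_class2 [^]\<^bsub>H1 T\<^esub> n) =
      P (gen_class1 [^]\<^bsub>H1 T\<^esub> m) \<otimes>\<^bsub>H1 circle\<^esub> P (gen_class2 [^]\<^bsub>H1 T\<^esub> n)"
    by (rule hom_mult[OF hP]) (intro H.int_pow_closed cc)+
  then show ?thesis
    using hom_int_pow[OF hP cc(1) H.is_group C.is_group] hom_int_pow[OF hP cc(2) H.is_group C.is_group] 1 2 by simp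
qed

text \<open>Projecting to a factor of the torus turns one generator into \<open>circle_class\<close>
  and the other into the unit, and exponents of \<open>circle_class\<close> are determined.\<close>

lemma gen_classes_independent:
  assumes "gen_class1 [^]\<^bsub>H1 T\<^esub> (m::int) \<otimes>\<^bsub>H1 T\<^esub> gen_class2 [^]\<^bsub>H1 T\<^esub> (n::int)
     = gen_class1 [^]\<^bsub>H1 T\<^esub> (m'::int) \<otimes>\<^bsub>H1 T\<^esub> gen_class2 [^]\<^bsub>H1 T\<^esub> (n'::int)"
  shows "m = m'" "n = n'"
proof -
  interpret C: comm_group "H1 circle" by simp
  have idc: "curve_class circle (\<lambda>z. z) = circle_class"
    unfolding curve_class_def by (rule hom_induced_id_circle[OF circle_class_carrier]) simp
  have const: "curve_class circle (\<lambda>z. 1) = \<one>\<^bsub>H1 circle\<^esub>"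
    unfolding curve_class_def by (rule hom_induced_const_circle_class)
  note P1 = project_gen_classes[OF projections_continuous(1)] and P2 = project_gen_classes[OF projections_continuous(2)]
  have "circle_class [^]\<^bsub>H1 circle\<^esub> m = circle_class [^]\<^bsub>H1 circle\<^esub> m'"
    using P1[of m n] P1[of m' n'] assms circle_class_carrier by (simp add: idc const)
  then show "m = m'" by (simp add: circle_class_int_pow_eq)
  have "circle_class [^]\<^bsub>H1 circle\<^esub> n = circle_class [^]\<^bsub>H1 circle\<^esub> n'"
    using P2[of m n] P2[of m' n'] assms circle_class_carrier by (simp add: idc const)
  then show "n = n'" by (simp add: circle_class_int_pow_eq)
qed

end

text \<open>\<open>h\<close> is the homeomorphism chosen inside the definition of the pairing, and
  independence of its coordinate classes makes the \<open>THE\<close> coordinates equal to the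
  winding.\<close>

lemma intersection_pairing_winding:
  assumes hk: "homeomorphic_maps torus T h k" and h: "h = (SOME h. homeomorphic_map torus T h)"
    and g: "continuous_map circle T \<gamma>" "winding (k \<circ> \<gamma>) m n"
    and d: "continuous_map circle T \<delta>" "winding (k \<circ> \<delta>) m' n'"
  shows "intersection_pairing T (curve_class T \<gamma>) (curve_class T \<delta>) = m * n' - n * m'"
proof -
  have co: "(THE mn::int \<times> int. curve_class T \<eta> = (curve_class T (\<lambda>z. h (z, 1)) [^]\<^bsub>H1 T\<^esub> fst mn)
      \<otimes>\<^bsub>H1 T\<^esub> (curve_class T (\<lambda>z. h (1, z)) [^]\<^bsub>H1 T\<^esub> snd mn)) = (a, b)"
    if "continuous_map circle T \<eta>" "winding (k \<circ> \<eta>) a b" for \<eta> a b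
  proof (rule the_equality)
    note c = curve_class_in_homeomorphic_torus[OF hk that, unfolded gen_class1_def[OF hk] gen_class2_def[OF hk]]
    show "curve_class T \<eta> = (curve_class T (\<lambda>z. h (z, 1)) [^]\<^bsub>H1 T\<^esub> fst (a, b))
      \<otimes>\<^bsub>H1 T\<^esub> (curve_class T (\<lambda>z. h (1, z)) [^]\<^bsub>H1 T\<^esub> snd (a, b))" using c by simp
    fix mn :: "int \<times> int"
    assume "curve_class T \<eta> = (curve_class T (\<lambda>z. h (z, 1)) [^]\<^bsub>H1 T\<^esub> fst mn)
      \<otimes>\<^bsub>H1 T\<^esub> (curve_class T (\<lambda>z. h (1, z)) [^]\<^bsub>H1 T\<^esub> snd mn)"
    then have "a = fst mn \<and> b = snd mn"
      using gen_classes_independent[OF hk, unfolded gen_class1_def[OF hk] gen_class2_def[OF hk], of a b "fst mn" "snd mn"] c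
      by simp
    then show "mn = (a, b)" by auto
  qed
  show ?thesis
    unfolding intersection_pairing_def Let_def h[symmetric] co[OF g] co[OF d] by simp
qed

lemma nullhomotopic_reparametrization:
  assumes "homotopic_with (\<lambda>_. True) circle X p (\<lambda>_. c)" "continuous_map circle circle \<sigma>"
    "\<And>z. z \<in> sphere 0 1 \<Longrightarrow> q z = p (\<sigma> z)"
  shows "homotopic_with (\<lambda>_. True) circle X q (\<lambda>_. c)"
proof -
  have "homotopic_with (\<lambda>_. True) circle X (p \<circ> \<sigma>) ((\<lambda>_. c) \<circ> \<sigma>)"
    using homotopic_with_compose_continuous_map_right[OF assms(1,2)] by simp
  then show ?thesis by (rule homotopic_with_eq) (use assms(3) in auto)
qed

text \<open>Membership in a slope guarantees nontriviality for one parametrization of one curve,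
  while \<open>slope_class\<close> picks its own. A null-homotopy passes along the isotopy and the
  two reparametrizations that connect them.\<close>

lemma nontrivial_curve_isotopy_invariant:
  assumes C: "C \<in> nontrivial_simple_closed_curves X" and iso: "(C, \<gamma> ` sphere 0 1) \<in> isotopic_curves X"
    and emb: "embedding_map circle X \<gamma>"
  shows "\<not> homotopic_with (\<lambda>_. True) circle X \<gamma> (\<lambda>_. c)"
proof
  assume null: "homotopic_with (\<lambda>_. True) circle X \<gamma> (\<lambda>_. c)"
  obtain \<delta> where d: "C = \<delta> ` sphere 0 1" "embedding_map circle X \<delta>" "\<nexists>c. homotopic_with (\<lambda>_. True) circle X \<delta> (\<lambda>_. c)"
    using C unfolding nontrivial_simple_closed_curves_def by blast
  obtain p q where pq: "homotopic_with (embedding_map circle X) circle X p q" "C = p ` sphere 0 1" "\<gamma> ` sphere 0 1 = q ` sphere 0 1"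
    using iso unfolding isotopic_curves_iff_homotopic_with by blast
  have e: "embedding_map circle X p" "embedding_map circle X q" using homotopic_with_imp_property[OF pq(1)] by auto
  obtain \<sigma> where s: "homeomorphic_map circle circle \<sigma>" "\<And>z. z \<in> sphere 0 1 \<Longrightarrow> \<gamma> (\<sigma> z) = q z"
    using embedding_reparametrization[OF emb e(2) pq(3)] by metis
  have "homotopic_with (\<lambda>_. True) circle X q (\<lambda>_. c)"
    by (rule nullhomotopic_reparametrization[OF null homeomorphic_imp_continuous_map[OF s(1)]]) (simp add: s(2))
  moreover have "homotopic_with (\<lambda>_. True) circle X p q" using homotopic_with_mono[OF pq(1)] by simp
  ultimately have np: "homotopic_with (\<lambda>_. True) circle X p (\<lambda>_. c)" using homotopic_with_trans by blast
  obtain \<tau> where t: "homeomorphic_map circle circle \<tau>" "\<And>z. z \<in> sphere 0 1 \<Longrightarrow> p (\<tau> z) = \<delta> z"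
    using embedding_reparametrization[OF e(1) d(2)] pq(2) d(1) by metis
  have "homotopic_with (\<lambda>_. True) circle X \<delta> (\<lambda>_. c)"
    by (rule nullhomotopic_reparametrization[OF np homeomorphic_imp_continuous_map[OF t(1)]]) (simp add: t(2))
  then show False using d(3) by blast
qed

text \<open>Coprimality makes corresponding coordinates divide each other, so they agree up to sign;
  the vanishing determinant makes the two signs equal unless a coordinate is 0.\<close>

lemma proportional_primitive_vectors:
  fixes p q p' q' :: int
  assumes "gcd p q = 1" "gcd p' q' = 1" "p * q' - q * p' = 0"
  shows "(p', q') = (p, q) \<or> (p', q') = (- p, - q)"
proof -
  have e: "p * q' = q * p'" using assms(3) by simp
  have cop: "coprime p q" "coprime q p" "coprime p' q'" "coprime q' p'"
    using assms(1,2) by (simp_all add: coprime_iff_gcd_eq_1 gcd.commute)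
  have "p dvd q * p'" using e by (metis dvd_triv_left)
  then have 1: "p dvd p'" using cop(1) by (simp add: coprime_dvd_mult_right_iff)
  have "q dvd p * q'" using e by (metis dvd_triv_left)
  then have 2: "q dvd q'" using cop(2) by (simp add: coprime_dvd_mult_right_iff)
  have "p' dvd p * q'" using e by (metis dvd_triv_right)
  then have 3: "p' dvd p" using cop(3) by (simp add: coprime_dvd_mult_left_iff)
  have "q' dvd q * p'" using e by (metis dvd_triv_right)
  then have 4: "q' dvd q" using cop(4) by (simp add: coprime_dvd_mult_left_iff)
  have a: "\<bar>p'\<bar> = \<bar>p\<bar>" "\<bar>q'\<bar> = \<bar>q\<bar>" using zdvd_antisym_abs[OF 3 1] zdvd_antisym_abs[OF 4 2] by auto
  then consider "p' = p" "q' = q" | "p' = p" "q' = - q" | "p' = - p" "q' = q" | "p' = - p" "q' = - q" by linarith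
  then show ?thesis
  proof cases
    case 2
    then have "p = 0 \<or> q = 0" using e by auto
    then show ?thesis using 2 by auto
  next
    case 3
    then have "p = 0 \<or> q = 0" using e by auto
    then show ?thesis using 3 by auto
  qed auto
qed

text \<open>Cramer's rule writes m and n times the determinant as combinations of the two bounded
  quantities, and a nonzero integer determinant has absolute value at least 1.\<close>

lemma finite_bounded_pairings:
  fixes p q p' q' N N' :: int
  assumes "p * q' - q * p' \<noteq> 0"
  shows "finite {mn :: int \<times> int. \<bar>fst mn * q - snd mn * p\<bar> \<le> N \<and> \<bar>fst mn * q' - snd mn * p'\<bar> \<le> N'}"
proof -
  define B where "B = \<bar>p\<bar> * N' + \<bar>p'\<bar> * N + \<bar>q\<bar> * N' + \<bar>q'\<bar> * N"
  have "\<bar>m\<bar> \<le> B \<and> \<bar>n\<bar> \<le> B" if b: "\<bar>m * q - n * p\<bar> \<le> N" "\<bar>m * q' - n * p'\<bar> \<le> N'" for m n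
  proof -
    define x y where "x = m * q - n * p" and "y = m * q' - n * p'"
    have N: "0 \<le> N" "0 \<le> N'" using b by linarith+
    have D1: "1 \<le> \<bar>p * q' - q * p'\<bar>" using assms by linarith
    have bd: "\<bar>u * y - v * x\<bar> \<le> \<bar>u\<bar> * N' + \<bar>v\<bar> * N" for u v
    proof -
      have "\<bar>u * y - v * x\<bar> \<le> \<bar>u\<bar> * \<bar>y\<bar> + \<bar>v\<bar> * \<bar>x\<bar>" using abs_triangle_ineq4[of "u * y" "v * x"] by (simp add: abs_mult)
      also have "\<dots> \<le> \<bar>u\<bar> * N' + \<bar>v\<bar> * N" using b by (intro add_mono mult_left_mono) (auto simp: x_def y_def)
      finally show ?thesis .
    qed
    have "p * y - p' * x = m * (p * q' - q * p')" "q * y - q' * x = n * (p * q' - q * p')"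
      by (simp_all add: x_def y_def algebra_simps)
    then have 1: "\<bar>m\<bar> * \<bar>p * q' - q * p'\<bar> \<le> \<bar>p\<bar> * N' + \<bar>p'\<bar> * N" "\<bar>n\<bar> * \<bar>p * q' - q * p'\<bar> \<le> \<bar>q\<bar> * N' + \<bar>q'\<bar> * N"
      using bd[of p p'] bd[of q q'] by (simp_all add: abs_mult)
    have "\<bar>m\<bar> * 1 \<le> \<bar>m\<bar> * \<bar>p * q' - q * p'\<bar>" "\<bar>n\<bar> * 1 \<le> \<bar>n\<bar> * \<bar>p * q' - q * p'\<bar>"
      using D1 by (intro mult_left_mono; simp)+
    moreover have "0 \<le> \<bar>p\<bar> * N' + \<bar>p'\<bar> * N" "0 \<le> \<bar>q\<bar> * N' + \<bar>q'\<bar> * N" using N by simp_all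
    ultimately show ?thesis using 1 unfolding B_def by linarith
  qed
  then have "{mn :: int \<times> int. \<bar>fst mn * q - snd mn * p\<bar> \<le> N \<and> \<bar>fst mn * q' - snd mn * p'\<bar> \<le> N'} \<subseteq> {- B..B} \<times> {- B..B}"
    by (auto simp: abs_le_iff) fastforce+
  then show ?thesis by (rule finite_subset) simp
qed

lemma isotopic_curves_Image_eq:
  assumes "(C, C') \<in> isotopic_curves X"
  shows "isotopic_curves X `` {C} = isotopic_curves X `` {C'}"
  using isotopic_curves_trans[OF assms] isotopic_curves_trans[OF isotopic_curves_sym[OF assms]] by auto

text \<open>\<open>c\<close> is the winding of a representative curve, carried to the standard torus
  by \<open>k\<close>. Slopes whose windings agree up to sign coincide, which turns distinctness of
  slopes into a nonzero determinant of primitive vectors.\<close>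

theorem slope_coordinates:
  assumes "torus homeomorphic_space T"
  obtains c :: "'a set set \<Rightarrow> int \<times> int" where
    "inj_on c (slopes T)"
    "\<And>\<alpha> \<beta>. \<lbrakk>\<alpha> \<in> slopes T; \<beta> \<in> slopes T\<rbrakk> \<Longrightarrow> slope_distance T \<alpha> \<beta> = \<bar>fst (c \<alpha>) * snd (c \<beta>) - snd (c \<alpha>) * fst (c \<beta>)\<bar>"
    "\<And>\<alpha> \<beta>. \<lbrakk>\<alpha> \<in> slopes T; \<beta> \<in> slopes T; \<alpha> \<noteq> \<beta>\<rbrakk> \<Longrightarrow> fst (c \<alpha>) * snd (c \<beta>) - snd (c \<alpha>) * fst (c \<beta>) \<noteq> 0"
proof -
  define h where "h = (SOME h. homeomorphic_map torus T h)"
  have "homeomorphic_map torus T h"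
    unfolding h_def using assms homeomorphic_space by (metis someI_ex)
  then obtain k where hk: "homeomorphic_maps torus T h k" using homeomorphic_map_maps by blast
  then have homk: "homeomorphic_map T torus k" and homh: "homeomorphic_map torus T h"
    using homeomorphic_maps_map by blast+
  have Haus: "Hausdorff_space T" using assms Hausdorff_torus homeomorphic_Hausdorff_space by blast
  \<comment> \<open>The very choice made in \<open>slope_class\<close>, so that
    \<open>slope_distance\<close> is computed from these curves.\<close>
  define rep where "rep = (\<lambda>\<alpha>. SOME \<gamma>. embedding_map circle T \<gamma> \<and> \<gamma> ` sphere 0 1 \<in> \<alpha>)"
  define c where "c = (\<lambda>\<alpha>. SOME mn. winding (k \<circ> rep \<alpha>) (fst mn) (snd mn))"
  have rep: "embedding_map circle T (rep \<alpha>)" "continuous_map circle T (rep \<alpha>)"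
     "\<alpha> = isotopic_curves T `` {rep \<alpha> ` sphere 0 1}" "embedding_map circle torus (k \<circ> rep \<alpha>)"
     "winding (k \<circ> rep \<alpha>) (fst (c \<alpha>)) (snd (c \<alpha>))" "(fst (c \<alpha>), snd (c \<alpha>)) \<noteq> (0, 0)"
    if \<alpha>: "\<alpha> \<in> slopes T" for \<alpha>
  proof -
    obtain C where C: "C \<in> nontrivial_simple_closed_curves T" "\<alpha> = isotopic_curves T `` {C}"
      using \<alpha> unfolding slopes_def by (auto elim!: quotientE)
    obtain \<gamma> where \<gamma>: "embedding_map circle T \<gamma>" "C = \<gamma> ` sphere 0 1"
      using C(1) unfolding nontrivial_simple_closed_curves_def by blast
    have "embedding_map circle T \<gamma> \<and> \<gamma> ` sphere 0 1 \<in> \<alpha>"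
      using \<gamma> isotopic_curves_refl C(2) by blast
    then have r: "embedding_map circle T (rep \<alpha>) \<and> rep \<alpha> ` sphere 0 1 \<in> \<alpha>"
      unfolding rep_def by (rule someI[where P = "\<lambda>\<gamma>. embedding_map circle T \<gamma> \<and> \<gamma> ` sphere 0 1 \<in> \<alpha>"])
    then show e: "embedding_map circle T (rep \<alpha>)" by blast
    then show cr: "continuous_map circle T (rep \<alpha>)" using embedding_map_circle_iff[OF Haus] by blast
    have iso: "(C, rep \<alpha> ` sphere 0 1) \<in> isotopic_curves T" using r C(2) by blast
    show "\<alpha> = isotopic_curves T `` {rep \<alpha> ` sphere 0 1}"
      by (rule trans[OF C(2) isotopic_curves_Image_eq[OF iso]])
    show "embedding_map circle torus (k \<circ> rep \<alpha>)"
      using e homk homeomorphic_imp_embedding_map embedding_map_compose by blast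
    have ckr: "continuous_map circle torus (k \<circ> rep \<alpha>)"
      using cr homk homeomorphic_imp_continuous_map continuous_map_compose by blast
    then obtain m n where "winding (k \<circ> rep \<alpha>) m n" by (rule winding_exists)
    then have "winding (k \<circ> rep \<alpha>) (fst (m, n)) (snd (m, n))" by simp
    then show w: "winding (k \<circ> rep \<alpha>) (fst (c \<alpha>)) (snd (c \<alpha>))"
      unfolding c_def by (rule someI[where P = "\<lambda>mn. winding (k \<circ> rep \<alpha>) (fst mn) (snd mn)"])
    show "(fst (c \<alpha>), snd (c \<alpha>)) \<noteq> (0, 0)"
    proof
      assume "(fst (c \<alpha>), snd (c \<alpha>)) = (0, 0)"
      then obtain x where "homotopic_with (\<lambda>_. True) circle torus (k \<circ> rep \<alpha>) (\<lambda>_. x)"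
        using winding_0_nullhomotopic[OF _ ckr] w by auto
      then have "homotopic_with (\<lambda>_. True) circle T (h \<circ> (k \<circ> rep \<alpha>)) (h \<circ> (\<lambda>_. x))"
        by (rule homotopic_with_compose_continuous_map_left[OF _ homeomorphic_imp_continuous_map[OF homh]]) simp
      then have "homotopic_with (\<lambda>_. True) circle T (rep \<alpha>) (\<lambda>_. h x)"
        by (rule homotopic_with_eq)
          (use cr torus_homeo_inverse(2)[OF hk] in \<open>auto simp: continuous_map_def Pi_iff\<close>)
      then show False using nontrivial_curve_isotopy_invariant[OF C(1) iso e] by blast
    qed
  qed
  have prim: "gcd (fst (c \<alpha>)) (snd (c \<alpha>)) = 1" if "\<alpha> \<in> slopes T" for \<alpha>
    using simple_closed_curve_primitive rep[OF that] by blast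
  have same: "\<alpha> = \<beta>" if ab: "\<alpha> \<in> slopes T" "\<beta> \<in> slopes T" and
     cc: "c \<beta> = c \<alpha> \<or> (fst (c \<beta>), snd (c \<beta>)) = (- fst (c \<alpha>), - snd (c \<alpha>))" for \<alpha> \<beta>
  proof -
    have "((k \<circ> rep \<alpha>) ` sphere 0 1, (k \<circ> rep \<beta>) ` sphere 0 1) \<in> isotopic_curves torus"
    proof (cases "c \<beta> = c \<alpha>")
      case True
      then show ?thesis using isotopic_if_same_winding rep[OF ab(1)] rep[OF ab(2)] by metis
    next
      case False
      then have e: "fst (c \<beta>) = - fst (c \<alpha>)" "snd (c \<beta>) = - snd (c \<alpha>)" using cc by auto
      have w: "winding ((k \<circ> rep \<beta>) \<circ> cnj) (fst (c \<alpha>)) (snd (c \<alpha>))"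
        using winding_cnj[OF rep(5)[OF ab(2)]] e by simp
      have "((k \<circ> rep \<alpha>) ` sphere 0 1, ((k \<circ> rep \<beta>) \<circ> cnj) ` sphere 0 1) \<in> isotopic_curves torus"
        by (rule isotopic_if_same_winding[OF rep(4)[OF ab(1)] embedding_cnj(1)[OF rep(4)[OF ab(2)]] rep(5)[OF ab(1)] w rep(6)[OF ab(1)]])
      then show ?thesis unfolding embedding_cnj(2)[OF rep(4)[OF ab(2)]] .
    qed
    then have "(h ` (k \<circ> rep \<alpha>) ` sphere 0 1, h ` (k \<circ> rep \<beta>) ` sphere 0 1) \<in> isotopic_curves T"
      using homh by (rule isotopic_curves_homeomorphic_image)
    moreover have "h ` (k \<circ> rep \<delta>) ` sphere 0 1 = rep \<delta> ` sphere 0 1" if "\<delta> \<in> slopes T" for \<delta>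
      unfolding image_image using rep(2)[OF that] torus_homeo_inverse(2)[OF hk]
      by (intro image_cong) (auto simp: continuous_map_def Pi_iff)
    ultimately have "(rep \<alpha> ` sphere 0 1, rep \<beta> ` sphere 0 1) \<in> isotopic_curves T" using ab by simp
    then have "isotopic_curves T `` {rep \<alpha> ` sphere 0 1} = isotopic_curves T `` {rep \<beta> ` sphere 0 1}"
      by (rule isotopic_curves_Image_eq)
    then show ?thesis using rep(3)[OF ab(1)] rep(3)[OF ab(2)] by simp
  qed
  show ?thesis
  proof (rule that[of c])
    show "inj_on c (slopes T)" using same by (auto intro!: inj_onI)
    show "slope_distance T \<alpha> \<beta> = \<bar>fst (c \<alpha>) * snd (c \<beta>) - snd (c \<alpha>) * fst (c \<beta>)\<bar>"
      if "\<alpha> \<in> slopes T" "\<beta> \<in> slopes T" for \<alpha> \<beta>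
      using intersection_pairing_winding[OF hk h_def rep(2)[OF that(1)] rep(5)[OF that(1)] rep(2)[OF that(2)] rep(5)[OF that(2)]]
      by (simp add: slope_distance_def slope_class_def rep_def)
    show "fst (c \<alpha>) * snd (c \<beta>) - snd (c \<alpha>) * fst (c \<beta>) \<noteq> 0"
      if "\<alpha> \<in> slopes T" "\<beta> \<in> slopes T" "\<alpha> \<noteq> \<beta>" for \<alpha> \<beta>
      using proportional_primitive_vectors[OF prim[OF that(1)] prim[OF that(2)]] same[OF that(1,2)] that(3)
      by (metis prod.collapse)
  qed
qed

lemma finite_slopes_near_two_slopes:
  assumes "torus homeomorphic_space T" "\<beta> \<in> slopes T" "\<beta>' \<in> slopes T" "\<beta> \<noteq> \<beta>'"
  shows "finite {\<alpha> \<in> slopes T. slope_distance T \<alpha> \<beta> \<le> N \<and> slope_distance T \<alpha> \<beta>' \<le> N'}"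
proof -
  obtain c :: "'a set set \<Rightarrow> int \<times> int" where c: "inj_on c (slopes T)"
    "\<And>\<alpha> \<beta>. \<lbrakk>\<alpha> \<in> slopes T; \<beta> \<in> slopes T\<rbrakk> \<Longrightarrow> slope_distance T \<alpha> \<beta> = \<bar>fst (c \<alpha>) * snd (c \<beta>) - snd (c \<alpha>) * fst (c \<beta>)\<bar>"
    "\<And>\<alpha> \<beta>. \<lbrakk>\<alpha> \<in> slopes T; \<beta> \<in> slopes T; \<alpha> \<noteq> \<beta>\<rbrakk> \<Longrightarrow> fst (c \<alpha>) * snd (c \<beta>) - snd (c \<alpha>) * fst (c \<beta>) \<noteq> 0"
    using slope_coordinates[OF assms(1)] by metis
  let ?A = "{\<alpha> \<in> slopes T. slope_distance T \<alpha> \<beta> \<le> N \<and> slope_distance T \<alpha> \<beta>' \<le> N'}"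
  have "c ` ?A \<subseteq> {mn. \<bar>fst mn * snd (c \<beta>) - snd mn * fst (c \<beta>)\<bar> \<le> N \<and> \<bar>fst mn * snd (c \<beta>') - snd mn * fst (c \<beta>')\<bar> \<le> N'}"
    using c(2) assms(2,3) by auto
  then have "finite (c ` ?A)"
    using finite_bounded_pairings[OF c(3)[OF assms(2-4)]] finite_subset by blast
  moreover have "inj_on c ?A" using c(1) by (rule inj_on_subset) auto
  ultimately show ?thesis using finite_imageD by blast
qed

lemma property_VH_if_boundary_torus:
  assumes T: "torus homeomorphic_space boundary_space (torus_bundle f)" and c: "c \<in> class_C" "f \<in> c"
  shows "property_VH (torus_bundle f)"
proof -
  let ?M = "torus_bundle f"
  let ?T = "boundary_space ?M"
  obtain \<beta>31 \<beta>32 \<beta>41 \<beta>42 where b: "beta_slopes 3 c f \<beta>31 \<beta>32" "beta_slopes 4 c f \<beta>41 \<beta>42"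
    "{\<beta>31, \<beta>32} \<inter> {\<beta>41, \<beta>42} = {}"
    using c(1)[unfolded class_C_def mem_Collect_eq, THEN conjunct2, THEN bspec, OF c(2)] by metis
  have sl: "\<beta>31 \<in> slopes ?T" "\<beta>32 \<in> slopes ?T" "\<beta>41 \<in> slopes ?T" "\<beta>42 \<in> slopes ?T"
    using b(1,2) by (auto simp: beta_slopes_def Let_def)
  obtain N3 :: int where N3: "\<forall>\<alpha>\<in>slopes ?T. slope_distance ?T \<alpha> \<beta>31 > N3 \<and> slope_distance ?T \<alpha> \<beta>32 > 1 \<longrightarrow>
      virtually_haken (dehn_filling ?M \<alpha>)"
    using b(1) unfolding beta_slopes_def Let_def by blast
  obtain N4 :: int where N4: "\<forall>\<alpha>\<in>slopes ?T. slope_distance ?T \<alpha> \<beta>41 > N4 \<and> slope_distance ?T \<alpha> \<beta>42 > 1 \<longrightarrow>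
      virtually_haken (dehn_filling ?M \<alpha>)"
    using b(2) unfolding beta_slopes_def Let_def by blast
  let ?F = "\<lambda>\<beta> N \<beta>' N'. {\<alpha> \<in> slopes ?T. slope_distance ?T \<alpha> \<beta> \<le> N \<and> slope_distance ?T \<alpha> \<beta>' \<le> N'}"
  \<comment> \<open>An exceptional slope violates the premise for i = 3 and the one for i = 4. Each
    can fail in two ways, which gives four pairs of slopes, each consisting of distinct slopes by
    disjointness.\<close>
  have "{\<alpha> \<in> slopes ?T. \<not> virtually_haken (dehn_filling ?M \<alpha>)} \<subseteq>
      ?F \<beta>31 N3 \<beta>41 N4 \<union> ?F \<beta>31 N3 \<beta>42 1 \<union> ?F \<beta>32 1 \<beta>41 N4 \<union> ?F \<beta>32 1 \<beta>42 1"
    using N3 N4 by (auto simp: not_le)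
  moreover have "finite (?F \<beta>31 N3 \<beta>41 N4 \<union> ?F \<beta>31 N3 \<beta>42 1 \<union> ?F \<beta>32 1 \<beta>41 N4 \<union> ?F \<beta>32 1 \<beta>42 1)"
    using b(3) by (intro finite_UnI finite_slopes_near_two_slopes[OF T] sl) auto
  ultimately show ?thesis unfolding property_VH_def using finite_subset by blast
qed


section \<open>The boundary of the torus bundle\<close>

text \<open>On the unit circle \<open>\<bar>Arg (- z)\<bar>\<close> is \<open>arccos (- Re z)\<close>; so this is the squared distance of a point
  of the torus from the centre of the removed disc, in angular coordinates.\<close>

definition disc_dist2 :: "complex \<times> complex \<Rightarrow> real" where
  "disc_dist2 x = (arccos (- Re (fst x)))\<^sup>2 + (arccos (- Re (snd x)))\<^sup>2"

text \<open>Angular coordinates about the centre (-1, -1) of the removed disc; the minus signs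
  absorb the shift by pi in \<open>removed_disc\<close>.\<close>

definition disc_point :: "complex \<Rightarrow> complex \<times> complex" where
  "disc_point u = (- cis (Re u), - cis (Im u))"

abbreviation "torus_set \<equiv> sphere (0::complex) 1 \<times> sphere (0::complex) 1"
abbreviation "torus_line \<equiv> torus_set \<times> (UNIV :: real set)"

lemma continuous_disc_dist2: "continuous_on torus_set disc_dist2"
proof -
  have "\<bar>Re z\<bar> \<le> 1" if "cmod z = 1" for z using abs_Re_le_cmod[of z] that by simp
  then have "- 1 \<le> - Re z \<and> - Re z \<le> 1" if "cmod z = 1" for z using that by (simp add: abs_le_iff)
  then show ?thesis unfolding disc_dist2_def[abs_def]
    by (intro continuous_intros) auto
qed

lemma disc_point_in_torus: "disc_point u \<in> torus_set" by (simp add: disc_point_def)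

lemma arccos_cos_abs: "\<bar>x\<bar> \<le> pi \<Longrightarrow> (arccos (cos x))\<^sup>2 = x\<^sup>2"
  using arccos_cos[of x] arccos_cos2[of x] by (cases "x \<ge> 0") auto

lemma disc_dist2_disc_point:
  assumes "cmod u \<le> pi"
  shows "disc_dist2 (disc_point u) = (cmod u)\<^sup>2"
proof -
  have "\<bar>Re u\<bar> \<le> pi" "\<bar>Im u\<bar> \<le> pi" using assms abs_Re_le_cmod[of u] abs_Im_le_cmod[of u] by auto
  then show ?thesis by (simp add: disc_dist2_def disc_point_def arccos_cos_abs cmod_power2)
qed

lemma disc_point_surj:
  assumes "x \<in> torus_set"
  obtains u where "x = disc_point u" "(cmod u)\<^sup>2 = disc_dist2 x"
proof -
  have z: "cis (Arg (- z)) = - z" if "cmod z = 1" for z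
    using cis_Arg[of "- z"] that by (metis div_by_1 neg_equal_0_iff_equal norm_minus_cancel norm_zero of_real_1 sgn_eq zero_neq_one)
  have a: "(arccos (- Re z))\<^sup>2 = (Arg (- z))\<^sup>2" if "cmod z = 1" for z
  proof -
    have "- Re z = cos (Arg (- z))" using arg_cong[OF z[OF that], of Re] by simp
    moreover have "\<bar>Arg (- z)\<bar> \<le> pi" using Arg_bounded[of "- z"] by linarith
    ultimately show ?thesis using arccos_cos_abs[of "Arg (- z)"] by simp
  qed
  let ?u = "Complex (Arg (- fst x)) (Arg (- snd x))"
  have "x = disc_point ?u" using assms z[of "fst x"] z[of "snd x"] by (auto simp: disc_point_def prod_eq_iff)
  moreover have "(cmod ?u)\<^sup>2 = disc_dist2 x"
    using assms a[of "fst x"] a[of "snd x"] by (auto simp: disc_dist2_def cmod_power2)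
  ultimately show ?thesis by (rule that)
qed

lemma disc_point_shift: "disc_point u = (cis a, cis b)" if "u = Complex (a - pi) (b - pi)"
  using that by (simp add: disc_point_def complex_eq_iff cos_diff sin_diff)

text \<open>Written as a sublevel set of a continuous function, the disc lets openness and
  compactness be read off. Its radius 1 is below pi, so arccos recovers the absolute values of the
  angles.\<close>

lemma removed_disc_eq: "removed_disc = {x \<in> torus_set. disc_dist2 x < 1}"
proof (intro equalityI subsetI)
  fix x assume "x \<in> removed_disc"
  then obtain a b where ab: "x = (cis a, cis b)" "(a - pi)\<^sup>2 + (b - pi)\<^sup>2 < 1" by (auto simp: removed_disc_def)
  let ?u = "Complex (a - pi) (b - pi)"
  have "(cmod ?u)\<^sup>2 < 1" using ab by (simp add: cmod_power2)
  moreover from this have "cmod ?u \<le> pi" using pi_gt3 power2_less_imp_less[of "cmod ?u" 1] by auto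
  ultimately show "x \<in> {x \<in> torus_set. disc_dist2 x < 1}"
    using disc_point_shift[of ?u a b] disc_dist2_disc_point[of ?u] disc_point_in_torus[of ?u] ab(1) by simp
next
  fix x assume x: "x \<in> {x \<in> torus_set. disc_dist2 x < 1}"
  then obtain u where u: "x = disc_point u" "(cmod u)\<^sup>2 = disc_dist2 x" using disc_point_surj by blast
  have "x = (cis (Re u + pi), cis (Im u + pi))" using disc_point_shift[of u "Re u + pi" "Im u + pi"] u(1) by simp
  moreover have "(Re u + pi - pi)\<^sup>2 + (Im u + pi - pi)\<^sup>2 < 1" using x u(2) by (simp add: cmod_power2)
  ultimately show "x \<in> removed_disc" unfolding removed_disc_def by blast
qed

lemma F_boundary_eq: "F_boundary = {x \<in> torus_set. disc_dist2 x = 1}"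
proof (intro equalityI subsetI)
  fix x assume "x \<in> F_boundary"
  then obtain a b where ab: "x = (cis a, cis b)" "(a - pi)\<^sup>2 + (b - pi)\<^sup>2 = 1" by (auto simp: F_boundary_def)
  let ?u = "Complex (a - pi) (b - pi)"
  have "(cmod ?u)\<^sup>2 = 1" using ab by (simp add: cmod_power2)
  moreover from this have "cmod ?u \<le> pi" using pi_gt3 norm_ge_zero[of ?u] by (auto simp: power2_eq_1_iff simp del: norm_ge_zero)
  ultimately show "x \<in> {x \<in> torus_set. disc_dist2 x = 1}"
    using disc_point_shift[of ?u a b] disc_dist2_disc_point[of ?u] disc_point_in_torus[of ?u] ab(1) by simp
next
  fix x assume x: "x \<in> {x \<in> torus_set. disc_dist2 x = 1}"
  then obtain u where u: "x = disc_point u" "(cmod u)\<^sup>2 = disc_dist2 x" using disc_point_surj by blast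
  have "x = (cis (Re u + pi), cis (Im u + pi))" using disc_point_shift[of u "Re u + pi" "Im u + pi"] u(1) by simp
  moreover have "(Re u + pi - pi)\<^sup>2 + (Im u + pi - pi)\<^sup>2 = 1" using x u(2) by (simp add: cmod_power2)
  ultimately show "x \<in> F_boundary" unfolding F_boundary_def by blast
qed

definition F_set :: "(complex \<times> complex) set" where "F_set = {x \<in> torus_set. disc_dist2 x \<ge> 1}"

lemma F_space_eq: "F_space = top_of_set F_set"
  unfolding F_space_def removed_disc_eq F_set_def by (rule arg_cong[of _ _ top_of_set]) auto

text \<open>Angles in [-1, 1] differ by less than a full turn.\<close>

lemma disc_point_inj: "\<lbrakk>cmod u \<le> 1; cmod v \<le> 1; disc_point u = disc_point v\<rbrakk> \<Longrightarrow> u = v"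
proof -
  assume uv: "cmod u \<le> 1" "cmod v \<le> 1" "disc_point u = disc_point v"
  have b: "\<bar>Re u\<bar> \<le> 1" "\<bar>Re v\<bar> \<le> 1" "\<bar>Im u\<bar> \<le> 1" "\<bar>Im v\<bar> \<le> 1"
    using uv(1,2) abs_Re_le_cmod abs_Im_le_cmod by (meson order_trans)+
  have inj: "a = b" if "\<bar>a\<bar> \<le> 1" "\<bar>b\<bar> \<le> 1" "cis a = cis b" for a b :: real
  proof -
    have "cis (2 * pi * (a / (2 * pi))) = cis (2 * pi * (b / (2 * pi)))" using that(3) by simp
    then obtain n :: int where "a / (2 * pi) = b / (2 * pi) + of_int n" unfolding cis_2pi_eq_iff by blast
    then have n: "a - b = 2 * pi * of_int n" by (simp add: field_simps)
    have "\<bar>2 * pi * real_of_int n\<bar> \<le> 2" using that(1,2) n by linarith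
    then have "pi * \<bar>real_of_int n\<bar> \<le> 1" by (simp add: abs_mult)
    moreover have "3 * \<bar>real_of_int n\<bar> \<le> pi * \<bar>real_of_int n\<bar>" using pi_gt3 by (intro mult_right_mono) auto
    ultimately have "\<bar>real_of_int n\<bar> < 1" by linarith
    then have "n = 0" by linarith
    then show ?thesis using n by simp
  qed
  show ?thesis using uv(3) inj b by (intro complex_eqI) (auto simp: disc_point_def)
qed

lemma continuous_disc_point: "continuous_on S disc_point"
  unfolding disc_point_def[abs_def] by (intro continuous_intros)

lemma disc_point_image: "disc_point ` sphere 0 1 = F_boundary"
proof (intro equalityI subsetI)
  fix x assume "x \<in> disc_point ` sphere 0 1"
  then obtain u where u: "cmod u = 1" "x = disc_point u" by auto
  then show "x \<in> F_boundary"
    using disc_dist2_disc_point[of u] disc_point_in_torus[of u] pi_gt3 by (simp add: F_boundary_eq)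
next
  fix x assume x: "x \<in> F_boundary"
  then obtain u where u: "x = disc_point u" "(cmod u)\<^sup>2 = disc_dist2 x" using disc_point_surj F_boundary_eq by blast
  then have "(cmod u)\<^sup>2 = 1\<^sup>2" using x by (simp add: F_boundary_eq)
  then have "cmod u = 1" by (rule power2_eq_imp_eq) auto
  then show "x \<in> disc_point ` sphere 0 1" using u(1) by auto
qed

section \<open>Charts of the product of the torus with a line\<close>

lemma Euclidean_space_3_homeomorphic:
  "Euclidean_space 3 homeomorphic_space (euclidean :: (real \<times> real \<times> real) topology)"
proof -
  let ?E = "{x :: nat \<Rightarrow> real. \<forall>i\<ge>3. x i = 0}"
  have e: "Euclidean_space 3 = top_of_set ?E" unfolding Euclidean_space_def powertop_real_eq_euclidean by simp
  define f where "f = (\<lambda>(a, b, c). (\<lambda>i::nat. if i = 0 then a else if i = 1 then b else if i = 2 then c else 0 :: real))"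
  define g where "g = (\<lambda>x :: nat \<Rightarrow> real. (x 0, x 1, x 2))"
  have "continuous_on UNIV f"
  proof (rule continuous_on_coordinatewise_then_product)
    fix i :: nat
    consider "i = 0" | "i = 1" | "i = 2" | "i > 2" by linarith
    then show "continuous_on UNIV (\<lambda>x. f x i)"
      by cases (auto simp: f_def case_prod_unfold intro!: continuous_intros)
  qed
  moreover have "continuous_on ?E g" unfolding g_def by (intro continuous_on_Pair continuous_on_coordinate)
  moreover have "f (g x) = x" if "x \<in> ?E" for x
  proof
    fix i show "f (g x) i = x i"
    proof -
      consider "i = 0" | "i = 1" | "i = 2" | "i \<ge> 3" by linarith
      then show ?thesis using that by cases (auto simp: f_def g_def)
    qed
  qed
  moreover have "g (f y) = y" for y by (cases y) (simp add: f_def g_def)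
  moreover have "f y \<in> ?E" for y by (auto simp: f_def case_prod_unfold)
  ultimately have "homeomorphic_maps (Euclidean_space 3) euclidean g f"
    unfolding homeomorphic_maps_def e by (auto simp: continuous_map_in_subtopology)
  then show ?thesis unfolding homeomorphic_space_def by blast
qed

definition chart :: "complex \<Rightarrow> complex \<Rightarrow> real \<times> real \<times> real \<Rightarrow> (complex \<times> complex) \<times> real" where
  "chart z w = (\<lambda>(a, b, r). ((z * cis a, w * cis b), r))"

definition chart_inv :: "complex \<Rightarrow> complex \<Rightarrow> (complex \<times> complex) \<times> real \<Rightarrow> real \<times> real \<times> real" where
  "chart_inv z w = (\<lambda>((x, y), r). (Arg (x / z), Arg (y / w), r))"

text \<open>Positive real parts keep both quotients away from the branch cut of \<open>Arg\<close>,
  where \<open>chart_inv\<close> is discontinuous.\<close>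

definition chart_dom :: "complex \<Rightarrow> complex \<Rightarrow> ((complex \<times> complex) \<times> real) set" where
  "chart_dom z w = {x. Re (fst (fst x) / z) > 0 \<and> Re (snd (fst x) / w) > 0}"

lemma chart_props:
  assumes zw: "cmod z = 1" "cmod w = 1"
  shows "continuous_on UNIV (chart z w)" "chart z w p \<in> torus_line"
    "open (chart_dom z w)" "continuous_on (chart_dom z w) (chart_inv z w)"
    "x \<in> chart_dom z w \<Longrightarrow> x \<in> torus_line \<Longrightarrow> chart z w (chart_inv z w x) = x"
    "\<lbrakk>\<bar>a\<bar> < 1; \<bar>b\<bar> < 1\<rbrakk> \<Longrightarrow> chart z w (a, b, r) \<in> chart_dom z w \<and> chart_inv z w (chart z w (a, b, r)) = (a, b, r)"
    "((z, w), r) \<in> chart_dom z w" "chart_inv z w ((z, w), r) = (0, 0, r)"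
proof -
  have nz: "z \<noteq> 0" "w \<noteq> 0" using zw by auto
  show "continuous_on UNIV (chart z w)"
    unfolding chart_def case_prod_unfold by (intro continuous_intros)
  show "chart z w p \<in> torus_line"
    using zw by (simp add: chart_def case_prod_unfold norm_mult)
  show "open (chart_dom z w)"
    unfolding chart_dom_def by (intro open_Collect_conj open_Collect_less continuous_intros) (use nz in auto)
  show "continuous_on (chart_dom z w) (chart_inv z w)"
    unfolding chart_inv_def case_prod_unfold chart_dom_def
    by (intro continuous_intros) (use nz in \<open>auto simp: complex_nonpos_Reals_iff\<close>)
  show "chart z w (chart_inv z w x) = x" if "x \<in> chart_dom z w" "x \<in> torus_line"
  proof -
    have "z * cis (Arg (u / z)) = u" if "cmod u = 1" "cmod z = 1" for u z
    proof -
      have "u / z \<noteq> 0" "cmod (u / z) = 1" using that by (auto simp: norm_divide)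
      then have "cis (Arg (u / z)) = u / z" using cis_Arg[of "u / z"] by (simp add: sgn_eq)
      then show ?thesis using that by auto
    qed
    then show ?thesis using that zw by (auto simp: chart_def chart_inv_def)
  qed
  show "chart z w (a, b, r) \<in> chart_dom z w \<and> chart_inv z w (chart z w (a, b, r)) = (a, b, r)" if "\<bar>a\<bar> < 1" "\<bar>b\<bar> < 1"
  proof -
    have "cos t > 0" "Arg (cis t) = t" if "\<bar>t\<bar> < 1" for t
      using that pi_gt3 by (auto intro!: cos_gt_zero_pi Arg_cis)
    then show ?thesis using that nz by (auto simp: chart_def chart_inv_def chart_dom_def)
  qed
  show "((z, w), r) \<in> chart_dom z w" "chart_inv z w ((z, w), r) = (0, 0, r)"
    using nz by (auto simp: chart_dom_def chart_inv_def)
qed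

text \<open>Small balls in the coordinates of \<open>chart\<close>, which are homeomorphic to the
  whole space, as \<open>manifold_interior\<close> demands.\<close>

lemma torus_line_locally_Euclidean:
  assumes W: "openin (top_of_set torus_line) W" and y: "y \<in> W"
  obtains W' where "openin (top_of_set torus_line) W'" "y \<in> W'" "W' \<subseteq> W"
    "top_of_set W' homeomorphic_space Euclidean_space 3"
proof -
  obtain z w r where yz: "y = ((z, w), r)" by (metis surj_pair)
  have "y \<in> torus_line" using W y openin_imp_subset by blast
  then have zw: "cmod z = 1" "cmod w = 1" by (auto simp: yz)
  note ch = chart_props[OF zw]
  obtain O1 where O1: "open O1" "W = torus_line \<inter> O1" using W by (auto simp: openin_open)
  have "open (chart z w -` O1)" using O1(1) ch(1) by (simp add: open_vimage)
  moreover have "(0, 0, r) \<in> chart z w -` O1" using y O1(2) by (simp add: chart_def yz)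
  ultimately obtain e where e: "e > 0" "ball (0, 0, r) e \<subseteq> chart z w -` O1" by (meson openE)
  define d where "d = min e 1"
  define B where "B = ball ((0, 0, r) :: real \<times> real \<times> real) d"
  have "d > 0" using e by (simp add: d_def)
  have Bsub: "\<bar>a\<bar> < 1 \<and> \<bar>b\<bar> < 1 \<and> (a, b, t) \<in> chart z w -` O1" if "(a, b, t) \<in> B" for a b t
  proof -
    have dd: "dist (0, 0, r) (a, b, t) < d" using that by (simp add: B_def)
    have "dist 0 a \<le> dist (0, 0, r) (a, b, t)" using dist_fst_le[of "(0, 0, r)" "(a, b, t)"] by simp
    moreover have "dist 0 b \<le> dist (0, 0, r) (a, b, t)"
      using dist_snd_le[of "(0, 0, r)" "(a, b, t)"] dist_fst_le[of "(0::real, r)" "(b, t)"] by simp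
    ultimately have "\<bar>a\<bar> < 1" "\<bar>b\<bar> < 1" using dd by (auto simp: d_def)
    moreover have "(a, b, t) \<in> ball (0, 0, r) e" using dd by (simp add: d_def)
    ultimately show ?thesis using e(2) by blast
  qed
  define W' where "W' = chart z w ` B"
  have W'eq: "W' = torus_line \<inter> (chart_dom z w \<inter> chart_inv z w -` B)"
  proof (intro equalityI subsetI)
    fix x assume "x \<in> W'"
    then obtain a b t where "(a, b, t) \<in> B" "x = chart z w (a, b, t)" by (auto simp: W'_def)
    then show "x \<in> torus_line \<inter> (chart_dom z w \<inter> chart_inv z w -` B)"
      using ch(6)[of a b t] Bsub[of a b t] ch(2)[of "(a, b, t)"] by simp
  next
    fix x assume "x \<in> torus_line \<inter> (chart_dom z w \<inter> chart_inv z w -` B)"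
    then show "x \<in> W'" unfolding W'_def using ch(5)[of x] by (intro image_eqI[of _ _ "chart_inv z w x"]) auto
  qed
  have "open (chart_dom z w \<inter> chart_inv z w -` B)"
    using ch(3,4) by (simp add: B_def continuous_on_open_vimage Int_commute)
  then have o: "openin (top_of_set torus_line) W'" unfolding W'eq by (simp add: openin_open_Int)
  have "chart z w ` B \<subseteq> W" using Bsub ch(2) unfolding O1(2) by (auto simp: image_subset_iff)
  then have sub: "W' \<subseteq> W" by (simp add: W'_def)
  have yW: "y \<in> W'" unfolding W'_def B_def using \<open>d > 0\<close> by (intro image_eqI[of _ _ "(0, 0, r)"]) (auto simp: chart_def yz)
  have "homeomorphic_maps (top_of_set B) (top_of_set W') (chart z w) (chart_inv z w)"
    unfolding homeomorphic_maps_def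
  proof (intro conjI ballI)
    show "continuous_map (top_of_set B) (top_of_set W') (chart z w)"
      using ch(1) continuous_on_subset by (auto simp: W'_def)
    show "continuous_map (top_of_set W') (top_of_set B) (chart_inv z w)"
      using ch(4) continuous_on_subset[of "chart_dom z w" _ W'] W'eq by auto
    show "chart_inv z w (chart z w x) = x" if "x \<in> topspace (top_of_set B)" for x
      using that ch(6) Bsub by (cases x) auto
    show "chart z w (chart_inv z w x) = x" if "x \<in> topspace (top_of_set W')" for x
      using that ch(5) W'eq by auto
  qed
  then have "top_of_set W' homeomorphic_space top_of_set B"
    using homeomorphic_space_def homeomorphic_space_sym by blast
  also have "top_of_set B homeomorphic_space (euclidean :: (real \<times> real \<times> real) topology)"
  proof -
    have "B homeomorphic (UNIV :: (real \<times> real \<times> real) set)"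
      unfolding B_def using \<open>d > 0\<close> by (rule homeomorphic_ball_UNIV)
    then obtain f g :: "real \<times> real \<times> real \<Rightarrow> real \<times> real \<times> real" where "homeomorphism B UNIV f g"
      unfolding homeomorphic_def by blast
    then have "homeomorphic_maps (top_of_set B) euclidean f g"
      unfolding homeomorphism_def homeomorphic_maps_def continuous_map_in_subtopology image_subset_iff_funcset[symmetric]
      by simp
    then show ?thesis unfolding homeomorphic_space_def by blast
  qed
  also have "(euclidean :: (real \<times> real \<times> real) topology) homeomorphic_space Euclidean_space 3"
    using Euclidean_space_3_homeomorphic homeomorphic_space_sym by blast
  finally show ?thesis using that[OF o yW sub] by simp
qed

lemma sphere_torus_compact: "compact torus_set"
  by (intro compact_Times) auto

lemma F_boundary_subset: "F_boundary \<subseteq> F_set" "F_set \<subseteq> torus_set"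
  by (auto simp: F_boundary_eq F_set_def)

lemma openin_F_interior: "openin (top_of_set torus_set) (F_set - F_boundary)"
proof -
  have "F_set - F_boundary = torus_set \<inter> disc_dist2 -` {1<..}"
    by (auto simp: F_set_def F_boundary_eq)
  then show ?thesis using continuous_openin_preimage_gen[OF continuous_disc_dist2, of "{1<..}"] by simp
qed

lemma closed_F_boundary: "closedin (top_of_set torus_set) F_boundary"
proof -
  have "F_boundary = torus_set \<inter> disc_dist2 -` {1}" by (auto simp: F_boundary_eq)
  then show ?thesis using continuous_closedin_preimage[OF continuous_disc_dist2, of "{1}"] by simp
qed

text \<open>Radial approach through the removed disc. These points serve to refute open
  neighbourhoods of a boundary point that stay within \<open>F_set\<close>.\<close>

lemma F_boundary_accessible:
  assumes "x \<in> F_boundary"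
  obtains X where "\<And>n. X n \<in> torus_set - F_set" "X \<longlonglongrightarrow> x"
proof -
  obtain u where u: "cmod u = 1" "x = disc_point u" using assms disc_point_image by (metis imageE mem_sphere_0)
  define s where "s = (\<lambda>n. 1 - 1 / (real n + 2))"
  have s: "0 < s n" "s n < 1" for n by (auto simp: s_def field_simps)
  have "s \<longlonglongrightarrow> 1" unfolding s_def by real_asymp
  then have "(\<lambda>n. of_real (s n) * u) \<longlonglongrightarrow> of_real 1 * u" by (intro tendsto_intros)
  then have "(\<lambda>n. disc_point (of_real (s n) * u)) \<longlonglongrightarrow> disc_point (of_real 1 * u)"
    by (rule continuous_on_tendsto_compose[OF continuous_disc_point[of UNIV]]) auto
  moreover have "disc_point (of_real (s n) * u) \<in> torus_set - F_set" for n
  proof -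
    have c: "cmod (of_real (s n) * u) = s n" using u(1) s[of n] by (simp add: norm_mult)
    moreover have "s n \<le> pi" using s[of n] pi_gt3 by linarith
    ultimately have "disc_dist2 (disc_point (of_real (s n) * u)) = (s n)\<^sup>2" using disc_dist2_disc_point by metis
    also have "\<dots> < 1" using s[of n] by (simp add: power_less_one_iff abs_square_less_1)
    finally show ?thesis using disc_point_in_torus by (simp add: F_set_def)
  qed
  ultimately show ?thesis using that[of "\<lambda>n. disc_point (of_real (s n) * u)"] u(2) by simp
qed

section \<open>The mapping torus of a homeomorphism that fixes the boundary circle\<close>

locale punctured_torus_homeo =
  fixes f :: "complex \<times> complex \<Rightarrow> complex \<times> complex"
  assumes F_homeo: "F_homeo f"
begin

text \<open>A glued pair is represented by its point at height 1, so the points of the bundle form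
  the product of \<open>F_set\<close> with the half-open interval (0, 1].\<close>

definition q :: "(complex \<times> complex) \<times> real \<Rightarrow> (complex \<times> complex) \<times> real" where
  "q = (\<lambda>(z, t). if t = 0 then (f z, 1) else (z, t))"

definition g where "g = inv_into F_set f"

lemma f_props: "continuous_on F_set f" "f ` F_set = F_set" "inj_on f F_set" "\<And>z. z \<in> F_boundary \<Longrightarrow> f z = z"
proof -
  have h: "homeomorphic_map (top_of_set F_set) (top_of_set F_set) f"
    using F_homeo by (simp add: F_homeo_def F_space_eq)
  show "continuous_on F_set f" using homeomorphic_imp_continuous_map[OF h] by simp
  show "f ` F_set = F_set" using homeomorphic_imp_surjective_map[OF h] by simp
  show "inj_on f F_set" using homeomorphic_imp_injective_map[OF h] by simp
  show "\<And>z. z \<in> F_boundary \<Longrightarrow> f z = z" using F_homeo by (simp add: F_homeo_def)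
qed

lemma compact_F_set: "compact F_set"
proof -
  have "F_set = torus_set \<inter> disc_dist2 -` {1..}" by (auto simp: F_set_def)
  then have "closedin (top_of_set torus_set) F_set"
    using continuous_closedin_preimage[OF continuous_disc_dist2, of "{1..}"] by simp
  then show ?thesis using sphere_torus_compact closedin_compact by blast
qed

lemma g_props: "continuous_on F_set g" "\<And>z. z \<in> F_set \<Longrightarrow> g z \<in> F_set" "\<And>z. z \<in> F_set \<Longrightarrow> f (g z) = z"
    "\<And>z. z \<in> F_set \<Longrightarrow> g (f z) = z" "\<And>z. z \<in> F_set \<Longrightarrow> f z \<in> F_set"
proof -
  show 1: "\<And>z. z \<in> F_set \<Longrightarrow> g z \<in> F_set" "\<And>z. z \<in> F_set \<Longrightarrow> f (g z) = z" "\<And>z. z \<in> F_set \<Longrightarrow> g (f z) = z"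
     "\<And>z. z \<in> F_set \<Longrightarrow> f z \<in> F_set"
    using f_props by (auto simp: g_def inv_into_into f_inv_into_f)
  show "continuous_on F_set g"
    using continuous_on_inv[OF f_props(1) compact_F_set] 1(3) f_props(2) by simp
qed

lemma f_boundary_iff: "z \<in> F_set \<Longrightarrow> f z \<in> F_boundary \<longleftrightarrow> z \<in> F_boundary"
  using f_props(3,4) F_boundary_subset(1) by (metis inj_onD subsetD)

abbreviation M where "M \<equiv> torus_bundle f"

lemma M_quotient: "quotient_map (top_of_set (F_set \<times> {0..1})) M q"
  using quotient_map_quotient_along[of "prod_topology F_space interval_space" q]
  unfolding torus_bundle_def q_def F_space_eq prod_topology_subtopology_eu .

lemma topspace_M: "topspace M = F_set \<times> {0<..1}"
proof -
  have "q ` (F_set \<times> {0..1}) = F_set \<times> {0<..1}"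
  proof (intro equalityI subsetI)
    fix x assume "x \<in> q ` (F_set \<times> {0..1})"
    then show "x \<in> F_set \<times> {0<..1}" using g_props(5) by (auto simp: q_def split: if_splits)
  next
    fix x assume "x \<in> F_set \<times> {0<..1::real}"
    then show "x \<in> q ` (F_set \<times> {0..1})" by (intro image_eqI[of _ _ x]) (auto simp: q_def)
  qed
  then show ?thesis using quotient_imp_surjective_map[OF M_quotient] by simp
qed

text \<open>Cutting the bundle along the fibre at height \<open>s\<close>.\<close>

definition V :: "real \<Rightarrow> ((complex \<times> complex) \<times> real) set" where
  "V s = F_set \<times> ({0<..1} - {s})"

text \<open>The part below the cut is stacked on top of the part above it, following the gluing of
  (z, 0) to (f z, 1); this straightens the complement of a fibre into a product.\<close>

definition unroll :: "real \<Rightarrow> (complex \<times> complex) \<times> real \<Rightarrow> (complex \<times> complex) \<times> real" where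
  "unroll s = (\<lambda>(z, t). if t > s then (z, t) else (f z, t + 1))"

definition roll :: "(complex \<times> complex) \<times> real \<Rightarrow> (complex \<times> complex) \<times> real" where
  "roll = (\<lambda>(z, t). if t \<le> 1 then (z, t) else (g z, t - 1))"

lemma openin_V:
  assumes "0 < s" "s < 1"
  shows "openin M (V s)" "quotient_map (top_of_set (F_set \<times> ({0..1} - {s}))) (subtopology M (V s)) q"
proof -
  have pre: "{x \<in> topspace (top_of_set (F_set \<times> {0..1})). q x \<in> V s} = F_set \<times> ({0..1} - {s})"
    using assms g_props(5) by (auto simp: q_def V_def split: if_splits)
  have "openin (top_of_set (F_set \<times> {0..1})) (F_set \<times> ({0..1} - {s}))"
  proof -
    have "F_set \<times> ({0..1} - {s}) = (F_set \<times> {0..1}) \<inter> (UNIV \<times> (- {s}))" by auto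
    moreover have "open ((UNIV :: (complex \<times> complex) set) \<times> (- {s}))" by (intro open_Times) auto
    ultimately show ?thesis by (simp add: openin_open_Int)
  qed
  moreover have "V s \<subseteq> topspace M" by (auto simp: V_def topspace_M)
  ultimately show op: "openin M (V s)"
    using M_quotient[unfolded quotient_map_def, THEN conjunct2, rule_format, of "V s"] unfolding pre by blast
  have "quotient_map (subtopology (top_of_set (F_set \<times> {0..1})) (F_set \<times> ({0..1} - {s}))) (subtopology M (V s)) q"
    by (rule quotient_map_restriction[OF M_quotient pre]) (use op in blast)
  moreover have "(F_set \<times> {0..1}) \<inter> (F_set \<times> ({0..1} - {s})) = F_set \<times> ({0..1} - {s})" by auto
  ultimately show "quotient_map (top_of_set (F_set \<times> ({0..1} - {s}))) (subtopology M (V s)) q"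
    by (simp add: subtopology_subtopology)
qed

lemma unroll_homeomorphic_maps:
  assumes s: "0 < s" "s < 1"
  shows "homeomorphic_maps (subtopology M (V s)) (top_of_set (F_set \<times> {s<..<s + 1})) (unroll s) roll"
  unfolding homeomorphic_maps_def
proof (intro conjI ballI)
  have VM: "topspace (subtopology M (V s)) = V s" by (auto simp: V_def topspace_M)
  \<comment> \<open>Continuity on the quotient is tested after composition with \<open>q\<close>,
    separately on the two open pieces on either side of the cut.\<close>
  have "continuous_on (F_set \<times> ({0..<s} \<union> {s<..1})) (unroll s \<circ> q)"
  proof -
    let ?A = "F_set \<times> {0..<s}" and ?B = "F_set \<times> {s<..1}"
    have eq: "F_set \<times> ({0..<s} \<union> {s<..1}) = ?A \<union> ?B" by auto
    have A: "?A = (?A \<union> ?B) \<inter> (UNIV \<times> {..<s})" and B: "?B = (?A \<union> ?B) \<inter> (UNIV \<times> {s<..})" by auto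
    have "open ((UNIV :: (complex \<times> complex) set) \<times> {..<s})" "open ((UNIV :: (complex \<times> complex) set) \<times> {s<..})"
      by (auto intro: open_Times)
    then have oA: "openin (top_of_set (?A \<union> ?B)) ?A" and oB: "openin (top_of_set (?A \<union> ?B)) ?B"
      using A B by (metis openin_open_Int)+
    have "continuous_on ?A (\<lambda>x. f (fst x))"
      by (rule continuous_on_compose2[OF f_props(1) continuous_on_fst[OF continuous_on_id]]) auto
    then have "continuous_on ?A (\<lambda>x. (f (fst x), snd x + 1))" by (intro continuous_intros)
    then have cA: "continuous_on ?A (unroll s \<circ> q)"
      by (rule continuous_on_eq) (use s in \<open>auto simp: unroll_def q_def\<close>)
    have "continuous_on ?B (\<lambda>x. x)" by (rule continuous_on_id)
    then have cB: "continuous_on ?B (unroll s \<circ> q)"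
      by (rule continuous_on_eq) (use s in \<open>auto simp: unroll_def q_def\<close>)
    show ?thesis unfolding eq by (rule continuous_on_Un_local_open[OF oA oB cA cB])
  qed
  moreover have "{0..<s} \<union> {s<..1} = {0..1} - {s}" using s by auto
  ultimately have c: "continuous_on (F_set \<times> ({0..1} - {s})) (unroll s \<circ> q)" by simp
  have im: "(unroll s \<circ> q) ` (F_set \<times> ({0..1} - {s})) \<subseteq> F_set \<times> {s<..<s + 1}"
    using s g_props(5) by (auto simp: unroll_def q_def split: if_splits)
  have "continuous_map (top_of_set (F_set \<times> ({0..1} - {s}))) (top_of_set (F_set \<times> {s<..<s + 1})) (unroll s \<circ> q)"
    using c im unfolding image_subset_iff_funcset continuous_map_subtopology_eu by blast
  then show "continuous_map (subtopology M (V s)) (top_of_set (F_set \<times> {s<..<s + 1})) (unroll s)"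
    using continuous_compose_quotient_map_eq[OF openin_V(2)[OF s]] by blast
  have qc: "continuous_map (top_of_set (F_set \<times> {0..1})) M q" using quotient_imp_continuous_map[OF M_quotient] .
  let ?Y = "top_of_set (F_set \<times> {s<..<s + 1})"
  \<comment> \<open>This is \<open>roll\<close> as a map into the bundle; at height 1 the two
    formulas agree because \<open>q\<close> sends (g z, 0) to (z, 1).\<close>
  have "continuous_map ?Y M (\<lambda>x. if snd x \<le> 1 then q x else q (g (fst x), snd x - 1))"
  proof (rule continuous_map_cases_le)
    show "continuous_map ?Y euclideanreal snd" "continuous_map ?Y euclideanreal (\<lambda>x. 1)" by (auto intro: continuous_intros)
    have s1: "subtopology ?Y {x \<in> topspace ?Y. snd x \<le> 1} = top_of_set (F_set \<times> {s<..1})"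
      unfolding subtopology_subtopology using s by (intro arg_cong[of _ _ top_of_set]) auto
    show "continuous_map (subtopology ?Y {x \<in> topspace ?Y. snd x \<le> 1}) M q"
      unfolding s1 by (rule continuous_map_from_subtopology_mono[OF qc]) (use s in auto)
    have s2: "subtopology ?Y {x \<in> topspace ?Y. 1 \<le> snd x} = top_of_set (F_set \<times> {1..<s + 1})"
      unfolding subtopology_subtopology using s by (intro arg_cong[of _ _ top_of_set]) auto
    have "continuous_on (F_set \<times> {1..<s + 1}) (\<lambda>x. g (fst x))"
      by (rule continuous_on_compose2[OF g_props(1) continuous_on_fst[OF continuous_on_id]]) auto
    then have "continuous_on (F_set \<times> {1..<s + 1}) (\<lambda>x. (g (fst x), snd x - 1))" by (intro continuous_intros)
    then have "continuous_map (top_of_set (F_set \<times> {1..<s + 1})) (top_of_set (F_set \<times> {0..1})) (\<lambda>x. (g (fst x), snd x - 1))"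
      using g_props(2) s by auto
    from continuous_map_compose[OF this qc]
    show "continuous_map (subtopology ?Y {x \<in> topspace ?Y. 1 \<le> snd x}) M (\<lambda>x. q (g (fst x), snd x - 1))"
      unfolding s2 by (simp add: o_def)
    show "q x = q (g (fst x), snd x - 1)" if "x \<in> topspace ?Y" "snd x = 1" for x
      using that g_props(3) by (auto simp: q_def)
  qed
  then have "continuous_map ?Y M roll"
    by (rule continuous_map_eq) (use s in \<open>auto simp: roll_def q_def\<close>)
  moreover have "roll ` (F_set \<times> {s<..<s + 1}) \<subseteq> V s"
    using s g_props(2) by (auto simp: roll_def V_def split: if_splits)
  ultimately show "continuous_map ?Y (subtopology M (V s)) roll"
    by (auto simp: continuous_map_in_subtopology)
  show "roll (unroll s x) = x" if "x \<in> topspace (subtopology M (V s))" for x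
  proof -
    obtain z t where z: "x = (z, t)" by (cases x)
    have "z \<in> F_set" "0 < t" "t \<le> 1" using that unfolding VM z by (auto simp: V_def)
    then show ?thesis using g_props(4)[of z] by (cases "t > s") (auto simp: z unroll_def roll_def)
  qed
  show "unroll s (roll y) = y" if "y \<in> topspace ?Y" for y
    using that s g_props(3) by (auto simp: unroll_def roll_def)
qed

lemma cut_height:
  obtains s :: real where "0 < s" "s < 1" "s \<noteq> t"
  by (rule that[of "if t = 1/2 then 1/4 else 1/2"]) auto

text \<open>Once the bundle is cut away from the height of \<open>x\<close>, the unrolled point lies
  in an open subset of torus times line.\<close>

lemma interior_points_of_bundle:
  assumes x: "x \<in> topspace M" "fst x \<notin> F_boundary"
  shows "x \<in> manifold_interior 3 M"
proof -
  obtain s where s: "0 < s" "s < 1" "s \<noteq> snd x" using cut_height .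
  note hm = unroll_homeomorphic_maps[OF s(1,2)]
  define W where "W = (F_set - F_boundary) \<times> {s<..<s + 1}"
  have xV: "x \<in> V s" using x(1) s(3) by (auto simp: topspace_M V_def)
  have VM: "topspace (subtopology M (V s)) = V s" by (auto simp: V_def topspace_M)
  have "unroll s x \<in> F_set \<times> {s<..<s + 1}" using hm xV VM unfolding homeomorphic_maps_def continuous_map_def by auto
  moreover have "fst (unroll s x) \<notin> F_boundary"
    using x f_boundary_iff by (auto simp: unroll_def case_prod_unfold topspace_M)
  ultimately have yW: "unroll s x \<in> W" by (auto simp: W_def)
  have oW: "openin (top_of_set torus_line) W"
  proof -
    have "openin (prod_topology (top_of_set torus_set) euclidean) W"
      unfolding W_def openin_prod_Times_iff using openin_F_interior by simp
    moreover have "prod_topology (top_of_set torus_set) (euclidean :: real topology) = top_of_set torus_line"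
      using prod_topology_subtopology_eu[of torus_set "UNIV :: real set"] by simp
    ultimately show ?thesis by simp
  qed
  obtain W' where W': "openin (top_of_set torus_line) W'" "unroll s x \<in> W'" "W' \<subseteq> W"
    "top_of_set W' homeomorphic_space Euclidean_space 3"
    using torus_line_locally_Euclidean[OF oW yW] .
  let ?Y = "top_of_set (F_set \<times> {s<..<s + 1})"
  have sub: "F_set \<times> {s<..<s + 1} \<subseteq> torus_line" using F_boundary_subset(2) by auto
  have W'sub: "W' \<subseteq> F_set \<times> {s<..<s + 1}" using W'(3) by (auto simp: W_def)
  have "openin ?Y W'" using openin_subset_trans[OF W'(1) W'sub sub] .
  define U where "U = {y \<in> V s. unroll s y \<in> W'}"
  have "continuous_map (subtopology M (V s)) ?Y (unroll s)" using hm by (simp add: homeomorphic_maps_def)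
  then have "openin (subtopology M (V s)) U"
    using openin_continuous_map_preimage[of "subtopology M (V s)" ?Y "unroll s" W'] \<open>openin ?Y W'\<close>
    unfolding VM U_def by simp
  then have oU: "openin M U" using openin_V(1)[OF s(1,2)] openin_trans_full by blast
  have "homeomorphic_maps (subtopology (subtopology M (V s)) U) (subtopology ?Y W') (unroll s) roll"
  proof (rule homeomorphic_maps_subtopologies_alt[OF hm])
    show "unroll s ` (topspace (subtopology M (V s)) \<inter> U) \<subseteq> W'" by (auto simp: U_def)
    show "roll ` (topspace ?Y \<inter> W') \<subseteq> U"
    proof
      fix z assume "z \<in> roll ` (topspace ?Y \<inter> W')"
      then obtain y where y: "y \<in> topspace ?Y" "y \<in> W'" "z = roll y" by auto
      have "roll y \<in> V s" using hm y(1) VM unfolding homeomorphic_maps_def continuous_map_def by auto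
      moreover have "unroll s (roll y) = y" using hm y(1) unfolding homeomorphic_maps_def by auto
      ultimately show "z \<in> U" using y by (simp add: U_def)
    qed
  qed
  moreover have "V s \<inter> U = U" by (auto simp: U_def)
  then have "subtopology (subtopology M (V s)) U = subtopology M U" by (simp add: subtopology_subtopology)
  moreover have "subtopology ?Y W' = top_of_set W'" using W'sub by (simp add: subtopology_subtopology Int_absorb1)
  ultimately have "subtopology M U homeomorphic_space top_of_set W'" unfolding homeomorphic_space_def by auto
  then have "subtopology M U homeomorphic_space Euclidean_space 3" using W'(4) homeomorphic_space_trans by blast
  moreover have "x \<in> U" using xV W'(2) by (simp add: U_def)
  ultimately show ?thesis using oU unfolding manifold_interior_def by blast
qed

text \<open>A Euclidean neighbourhood, followed by unrolling and a chart, gives an injective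
  continuous map \<open>G\<close> from an open set of 3-space to 3-space. By invariance of domain
  its image is a neighbourhood of the chart coordinates of the boundary point, yet it contains none
  of the nearby points that come from the removed disc.\<close>

lemma boundary_points_of_bundle:
  assumes x: "x \<in> topspace M" "fst x \<in> F_boundary"
  shows "x \<notin> manifold_interior 3 M"
proof
  assume "x \<in> manifold_interior 3 M"
  then obtain U where U: "openin M U" "x \<in> U" "subtopology M U homeomorphic_space Euclidean_space 3"
    unfolding manifold_interior_def by blast
  then have "subtopology M U homeomorphic_space (euclidean :: (real \<times> real \<times> real) topology)"
    using Euclidean_space_3_homeomorphic homeomorphic_space_trans by blast
  then obtain a b where ab: "homeomorphic_maps (subtopology M U) (euclidean :: (real \<times> real \<times> real) topology) a b"
    unfolding homeomorphic_space_def by blast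
  obtain s where s: "0 < s" "s < 1" "s \<noteq> snd x" using cut_height .
  note hm = unroll_homeomorphic_maps[OF s(1,2)]
  have VM: "topspace (subtopology M (V s)) = V s" by (auto simp: V_def topspace_M)
  have xV: "x \<in> V s" using x(1) s(3) by (auto simp: topspace_M V_def)
  obtain z w r where y: "unroll s x = ((z, w), r)" by (metis surj_pair)
  \<comment> \<open>Unrolling may apply \<open>f\<close>, but \<open>f\<close> fixes the points of
    the boundary circle.\<close>
  have zx: "(z, w) = fst x" using arg_cong[OF y, of fst] x(2) f_props(4) by (auto simp: unroll_def case_prod_unfold split: if_splits)
  then have zwB: "(z, w) \<in> F_boundary" using x(2) by simp
  then have zw: "cmod z = 1" "cmod w = 1" by (auto simp: F_boundary_eq)
  note ch = chart_props[OF zw]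
  have bc: "continuous_map euclidean (subtopology M U) b" using ab by (simp add: homeomorphic_maps_def)
  have UM: "topspace (subtopology M U) = U" using U(1) openin_subset by fastforce
  have bU: "b p \<in> U" for p using bc UM unfolding continuous_map_def by auto
  have bM: "continuous_map euclidean M b" using bc by (simp add: continuous_map_in_subtopology)
  define P1 where "P1 = {p. b p \<in> V s}"
  have "open P1"
    using openin_continuous_map_preimage[OF bM openin_V(1)[OF s(1,2)]] by (simp add: P1_def)
  have "continuous_map (top_of_set P1) (subtopology M (V s)) b"
    using bM unfolding continuous_map_in_subtopology by (auto simp: P1_def continuous_map_from_subtopology)
  then have "continuous_map (top_of_set P1) (top_of_set (F_set \<times> {s<..<s + 1})) (unroll s \<circ> b)"
    by (rule continuous_map_compose) (use hm in \<open>simp add: homeomorphic_maps_def\<close>)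
  then have cu: "continuous_on P1 (unroll s \<circ> b)" and imu: "\<And>p. p \<in> P1 \<Longrightarrow> unroll s (b p) \<in> F_set \<times> {s<..<s + 1}"
    by (auto simp: Pi_iff)
  define P where "P = P1 \<inter> (unroll s \<circ> b) -` chart_dom z w"
  have "open P" unfolding P_def using continuous_open_preimage[OF cu \<open>open P1\<close> ch(3)] .
  define G where "G = chart_inv z w \<circ> (unroll s \<circ> b)"
  have cG: "continuous_on P G" unfolding G_def
    by (rule continuous_on_compose[OF continuous_on_subset[OF cu] continuous_on_subset[OF ch(4)]]) (auto simp: P_def)
  have chG: "chart z w (G p) = unroll s (b p)" if "p \<in> P" for p
  proof -
    have "unroll s (b p) \<in> torus_line" using imu[of p] that F_boundary_subset(2) by (auto simp: P_def)
    then show ?thesis using that ch(5)[of "unroll s (b p)"] by (simp add: G_def P_def)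
  qed
  have injG: "inj_on G P"
  proof (rule inj_onI)
    fix p p' assume p: "p \<in> P" "p' \<in> P" "G p = G p'"
    then have "unroll s (b p) = unroll s (b p')" using chG by metis
    then have "roll (unroll s (b p)) = roll (unroll s (b p'))" by simp
    moreover have "b p \<in> V s" "b p' \<in> V s" using p by (auto simp: P_def P1_def)
    ultimately have "b p = b p'" using hm VM unfolding homeomorphic_maps_def by auto
    then have "a (b p) = a (b p')" by simp
    then show "p = p'" using ab unfolding homeomorphic_maps_def by auto
  qed
  have "open (G ` P)" by (rule invariance_of_domain[OF cG \<open>open P\<close> injG])
  have bax: "b (a x) = x" using ab UM U(2) unfolding homeomorphic_maps_def by auto
  have "a x \<in> P" using bax xV y ch(7) by (simp add: P_def P1_def)
  moreover have "G (a x) = (0, 0, r)" using bax y ch(8) by (simp add: G_def)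
  ultimately have 0: "(0, 0, r) \<in> G ` P" by force
  obtain X where X: "\<And>n. X n \<in> torus_set - F_set" "X \<longlonglongrightarrow> (z, w)" 
    using F_boundary_accessible[OF zwB] by metis
  have lim: "(\<lambda>n. (X n, r)) \<longlonglongrightarrow> ((z, w), r)" using X(2) by (intro tendsto_intros)
  then have ev: "eventually (\<lambda>n. (X n, r) \<in> chart_dom z w) sequentially"
    using ch(3,7) topological_tendstoD by blast
  have "isCont (chart_inv z w) ((z, w), r)" using ch(3,4,7) continuous_on_eq_continuous_at by blast
  then have "(\<lambda>n. chart_inv z w (X n, r)) \<longlonglongrightarrow> chart_inv z w ((z, w), r)" using lim by (rule isCont_tendsto_compose)
  then have "eventually (\<lambda>n. chart_inv z w (X n, r) \<in> G ` P) sequentially"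
    using \<open>open (G ` P)\<close> 0 unfolding ch(8) by (rule topological_tendstoD)
  then have "eventually (\<lambda>n. (X n, r) \<in> chart_dom z w \<and> chart_inv z w (X n, r) \<in> G ` P) sequentially"
    using ev by (rule eventually_conj[rotated])
  then obtain n where n: "(X n, r) \<in> chart_dom z w" "chart_inv z w (X n, r) \<in> G ` P"
    using eventually_happens'[OF sequentially_bot] by blast
  then obtain p where p: "p \<in> P" "chart_inv z w (X n, r) = G p" by blast
  have "(X n, r) \<in> torus_line" using X(1)[of n] by auto
  then have "(X n, r) = unroll s (b p)" using ch(5)[OF n(1)] chG[OF p(1)] p(2) by metis
  then have "X n \<in> F_set" using imu[of p] p(1) by (auto simp: P_def)
  then show False using X(1)[of n] by blast
qed

lemma manifold_boundary_bundle: "manifold_boundary 3 M = F_boundary \<times> {0<..1}"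
proof -
  have "manifold_boundary 3 M = {x \<in> topspace M. fst x \<in> F_boundary}"
    unfolding manifold_boundary_def using interior_points_of_bundle boundary_points_of_bundle by auto
  then show ?thesis using F_boundary_subset(1) by (auto simp: topspace_M)
qed

text \<open>As \<open>f\<close> is the identity on the boundary circle, the gluing there closes
  circle times interval up to circle times circle. The mutually inverse maps \<open>E\<close> and
  \<open>K\<close> are continuous because they become so after composition with quotient maps onto
  their domains.\<close>

theorem boundary_of_bundle_is_torus: "torus homeomorphic_space boundary_space M"
proof -
  let ?B = "F_boundary \<times> {0<..1::real}" and ?A = "F_boundary \<times> {0..1::real}"
  have pre: "{x \<in> topspace (top_of_set (F_set \<times> {0..1})). q x \<in> ?B} = ?A"
    using F_boundary_subset(1)
    by (auto simp: q_def case_prod_unfold mem_Times_iff f_boundary_iff split: if_splits)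
  have "closedin (top_of_set (F_set \<times> {0..1})) ?A"
  proof -
    have "closedin (top_of_set torus_set) F_boundary" by (rule closed_F_boundary)
    then have "compact F_boundary" using sphere_torus_compact closedin_compact by blast
    then have "compact ?A" by (intro compact_Times) auto
    then have "closed ?A" by (rule compact_imp_closed)
    moreover have "?A \<subseteq> F_set \<times> {0..1}" using F_boundary_subset(1) by auto
    ultimately show ?thesis by (rule closed_subset[rotated])
  qed
  moreover have "?B \<subseteq> topspace M" using F_boundary_subset(1) by (auto simp: topspace_M)
  ultimately have cl: "closedin M ?B"
    using M_quotient[unfolded quotient_map_closedin, THEN conjunct2, rule_format, of ?B] unfolding pre by blast
  have "quotient_map (subtopology (top_of_set (F_set \<times> {0..1})) ?A) (subtopology M ?B) q"
    by (rule quotient_map_restriction[OF M_quotient pre]) (use cl in blast)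
  moreover have "(F_set \<times> {0..1}) \<inter> ?A = ?A" using F_boundary_subset(1) by auto
  ultimately have qB: "quotient_map (top_of_set ?A) (subtopology M ?B) q"
    by (simp add: subtopology_subtopology)
  have "inj_on disc_point (sphere 0 1)" by (rule inj_onI) (simp add: disc_point_inj)
  then obtain k where k: "homeomorphism (sphere 0 1) F_boundary disc_point k"
    using homeomorphism_compact[OF _ continuous_disc_point disc_point_image] by auto
  then have kc: "continuous_on F_boundary k" and kim: "k ` F_boundary = sphere 0 1"
    and kd: "\<And>u. u \<in> sphere 0 1 \<Longrightarrow> k (disc_point u) = u" and dk: "\<And>z. z \<in> F_boundary \<Longrightarrow> disc_point (k z) = z"
    by (auto simp: homeomorphism_def)
  define K where "K = (\<lambda>x::(complex \<times> complex) \<times> real. (k (fst x), cis (2 * pi * snd x)))"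
  define E where "E = (\<lambda>x::complex \<times> complex. q (disc_point (fst x), Arg2pi (snd x) / (2 * pi)))"
  have "continuous_on ?A (\<lambda>x. k (fst x))"
    by (rule continuous_on_compose2[OF kc continuous_on_fst[OF continuous_on_id]]) auto
  then have "continuous_on ?A K" unfolding K_def by (intro continuous_intros)
  then have "continuous_on ?A (K \<circ> q)"
    by (rule continuous_on_eq) (use f_props(4) in \<open>auto simp: K_def q_def\<close>)
  moreover have "(K \<circ> q) ` ?A \<subseteq> torus_set"
    using kim f_props(4) by (auto simp: K_def q_def split: if_splits)
  ultimately have "continuous_map (top_of_set ?A) torus (K \<circ> q)" 
    unfolding torus_eq image_subset_iff_funcset continuous_map_subtopology_eu by blast
  then have cK: "continuous_map (subtopology M ?B) torus K"
    using continuous_compose_quotient_map_eq[OF qB] by blast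
  define p where "p = (\<lambda>(u::complex, t::real). (u, cis (2 * pi * t)))"
  have Arg: "cis (2 * pi * (Arg2pi v / (2 * pi))) = v" if "v \<in> sphere 0 1" for v
    using Arg2pi[of v] that by (simp add: is_Arg_def cis_conv_exp)
  \<comment> \<open>A continuous surjection from a compact space to a Hausdorff space; it is what
    allows the discontinuous \<open>Arg2pi\<close> in \<open>E\<close>.\<close>
  have qp: "quotient_map (top_of_set (sphere 0 1 \<times> {0..1})) torus p"
  proof (rule T1_Spaces.continuous_imp_quotient_map)
    show "continuous_map (top_of_set (sphere 0 1 \<times> {0..1})) torus p"
      unfolding torus_eq p_def case_prod_unfold by (auto intro!: continuous_intros)
    show "compact_space (top_of_set (sphere (0::complex) 1 \<times> {0..1::real}))"
      by (simp add: compact_space_subtopology compact_Times)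
    show "Hausdorff_space torus" by (rule Hausdorff_torus)
    show "p ` topspace (top_of_set (sphere 0 1 \<times> {0..1})) = topspace torus"
    proof (intro equalityI subsetI)
      fix y assume "y \<in> topspace torus"
      then have y: "fst y \<in> sphere 0 1" "snd y \<in> sphere 0 1" unfolding torus_eq by auto
      have "0 \<le> Arg2pi (snd y) / (2 * pi)" "Arg2pi (snd y) / (2 * pi) \<le> 1" using Arg2pi[of "snd y"] by (auto simp: field_simps)
      then show "y \<in> p ` topspace (top_of_set (sphere 0 1 \<times> {0..1}))"
        using y Arg[OF y(2)] by (intro image_eqI[of _ _ "(fst y, Arg2pi (snd y) / (2 * pi))"]) (auto simp: p_def prod_eq_iff)
    qed (auto simp: torus_eq p_def)
  qed
  \<comment> \<open>For height 1 the argument is 0, so \<open>E\<close> evaluates \<open>q\<close>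
    at height 0; there \<open>q\<close> gives the same point because \<open>f\<close> fixes the
    circle.\<close>
  have Ep: "(E \<circ> p) x = q (disc_point (fst x), snd x)" if x: "x \<in> sphere 0 1 \<times> {0..1}" for x
  proof -
    define t where "t = Arg2pi (cis (2 * pi * snd x)) / (2 * pi)"
    have "0 \<le> t" "t < 1" using Arg2pi[of "cis (2 * pi * snd x)"] by (auto simp: t_def field_simps)
    have "cis (2 * pi * t) = cis (2 * pi * snd x)" unfolding t_def by (rule Arg) simp
    then obtain n :: int where n: "t = snd x + of_int n" unfolding cis_2pi_eq_iff by blast
    have fx: "f (disc_point (fst x)) = disc_point (fst x)"
      using x disc_point_image by (intro f_props(4)) auto
    show ?thesis
    proof (cases "snd x = 1")
      case True
      then have "-1 \<le> real_of_int n" "real_of_int n < 0" using n \<open>0 \<le> t\<close> \<open>t < 1\<close> by auto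
      then have "n = -1" by linarith
      then have "t = 0" using n True by simp
      then show ?thesis using True fx by (simp add: E_def p_def case_prod_unfold q_def t_def)
    next
      case False
      then have "0 \<le> snd x" "snd x < 1" using x by auto
      then have "\<bar>real_of_int n\<bar> < 1" using n \<open>0 \<le> t\<close> \<open>t < 1\<close> by linarith
      then have "n = 0" by linarith
      then have "t = snd x" using n by simp
      then show ?thesis by (simp add: E_def p_def case_prod_unfold t_def)
    qed
  qed
  have "continuous_on (sphere 0 1 \<times> {0..1::real}) (\<lambda>x. disc_point (fst x))"
    by (rule continuous_on_compose2[OF continuous_disc_point[of UNIV] continuous_on_fst[OF continuous_on_id]]) auto
  then have "continuous_on (sphere 0 1 \<times> {0..1::real}) (\<lambda>x. (disc_point (fst x), snd x))" by (intro continuous_intros)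
  moreover have "(\<lambda>x. (disc_point (fst x), snd x)) ` (sphere 0 1 \<times> {0..1::real}) \<subseteq> ?A" using disc_point_image by auto
  ultimately have "continuous_map (top_of_set (sphere 0 1 \<times> {0..1})) (top_of_set ?A) (\<lambda>x. (disc_point (fst x), snd x))"
    by (simp add: image_subset_iff_funcset)
  from continuous_map_compose[OF this quotient_imp_continuous_map[OF qB]]
  have "continuous_map (top_of_set (sphere 0 1 \<times> {0..1})) (subtopology M ?B) (E \<circ> p)"
    by (rule continuous_map_eq) (use Ep in auto)
  then have cE: "continuous_map torus (subtopology M ?B) E"
    using continuous_compose_quotient_map_eq[OF qp] by blast
  have "K (E y) = y" if "y \<in> topspace torus" for y
  proof -
    have y: "fst y \<in> sphere 0 1" "snd y \<in> sphere 0 1" using that unfolding torus_eq by auto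
    have fb: "disc_point (fst y) \<in> F_boundary" using y disc_point_image by blast
    show ?thesis
    proof (cases "Arg2pi (snd y) = 0")
      case True
      then have "E y = (disc_point (fst y), 1)" using f_props(4)[OF fb] by (simp add: E_def q_def)
      moreover have "snd y = 1" using Arg[OF y(2)] True by simp
      ultimately show ?thesis using kd[OF y(1)] by (intro prod_eqI) (simp_all add: K_def)
    next
      case False
      then have "E y = (disc_point (fst y), Arg2pi (snd y) / (2 * pi))" by (simp add: E_def q_def)
      then show ?thesis using kd[OF y(1)] Arg[OF y(2)] by (intro prod_eqI) (simp_all add: K_def)
    qed
  qed
  moreover have "E (K x) = x" if "x \<in> topspace (subtopology M ?B)" for x
  proof -
    have x: "fst x \<in> F_boundary" "0 < snd x" "snd x \<le> 1" using that by auto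
    have kx: "k (fst x) \<in> sphere 0 1" using kim x(1) by blast
    have "E (K x) = (E \<circ> p) (k (fst x), snd x)" by (simp add: K_def p_def)
    also have "\<dots> = q (fst x, snd x)" using Ep[of "(k (fst x), snd x)"] kx x dk[OF x(1)] by simp
    also have "\<dots> = x" using x by (simp add: q_def case_prod_unfold)
    finally show ?thesis .
  qed
  ultimately have "homeomorphic_maps torus (subtopology M ?B) E K"
    using cE cK unfolding homeomorphic_maps_def by blast
  then show ?thesis unfolding manifold_boundary_bundle homeomorphic_space_def by blast
qed

end

theorem corollary1p3:
  fixes c :: "(complex \<times> complex \<Rightarrow> complex \<times> complex) set"
    and f :: "complex \<times> complex \<Rightarrow> complex \<times> complex"
    and M :: "((complex \<times> complex) \<times> real) topology"
  assumes "c \<in> mapping_classes" and "f \<in> c"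
    and "M = torus_bundle f"
    and "orientable 3 M" and "atoroidal M"
    and "c \<in> class_C"
  shows "property_VH M"
proof -
  \<comment> \<open>Being related by \<open>isotopic_F\<close> already includes being a
    homeomorphism of \<open>F_space\<close> that fixes the boundary.\<close>
  obtain f0 where "c = isotopic_F `` {f0}"
    using assms(1) unfolding mapping_classes_def by (auto elim: quotientE)
  then have "(f0, f) \<in> isotopic_F" using assms(2) by simp
  then have "F_homeo f" by (auto simp: isotopic_F_def)
  then have "torus homeomorphic_space boundary_space (torus_bundle f)"
    by (intro punctured_torus_homeo.boundary_of_bundle_is_torus punctured_torus_homeo.intro)
  then show ?thesis
    using property_VH_if_boundary_torus assms(2,3,6) by simp
qed

end
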